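(* The algebra $A(S^4_q)$ is the algebra of coinvariants under the right coaction $\delta_R:A(S^7_q)\to A(S^7_q)\otimes A(SU_q(2))$, that is, $$A(S^4_q)=\{f\in A(S^7_q) : \delta_R(f)=f\otimes 1\}.$$
   Context: Fix $q\in\mathbb{R}$, $q\neq 0$; algebras are unital and over $\mathbb{C}$. For $i\in\{1,2,3,4\}$ put $i'=5-i$, $(\varepsilon_1,\varepsilon_2,\varepsilon_3,\varepsilon_4)=(1,1,-1,-1)$, $(\rho_1,\rho_2,\rho_3,\rho_4)=(2,1,-1,-2)$. Let $e_i^{\,j}\in M_4(\mathbb{C})$ be the matrix unit with $1$ in row $i$, column $j$, and let $$R=q\sum_{i}e_i^{\,i}\otimes e_i^{\,i}+\sum_{i\neq j,j'}e_i^{\,i}\otimes e_j^{\,j}+q^{-1}\sum_i e_{i'}^{\,i'}\otimes e_i^{\,i}+(q-q^{-1})\sum_{i>j}e_i^{\,j}\otimes e_j^{\,i}-(q-q^{-1})\sum_{i>j}q^{\rho_i-\rho_j}\varepsilon_i\varepsilon_j\,e_i^{\,j}\otimes e_{i'}^{\,j'},$$ with $i,j$ ranging over $1,\dots,4$. Let $C$ be the matrix $C_i^{\,j}=q^{\rho_j}\varepsilon_i\delta_{ij'}$. $A(Sp_q(2))$ is the algebra generated by the entries $T_i^{\,j}$ (row $i$, column $j$, $1\le i,j\le 4$) of a matrix $T$ with relations $R\,T_1T_2=T_2T_1R$ (where $T_1=T\otimes 1$, $T_2=1\otimes T$), and $TCT^tC^{-1}=CT^tC^{-1}T=1$. It is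 a Hopf $*$-algebra with $\Delta(T_i^{\,j})=\sum_kT_i^{\,k}\otimes T_k^{\,j}$, $\varepsilon(T_i^{\,j})=\delta_{ij}$, $S(T)=CT^tC^{-1}$, i.e. $S(T)_i^{\,j}=-q^{\rho_{i'}+\rho_j}\varepsilon_i\varepsilon_{j'}T_{j'}^{\,i'}$, and antilinear anti-involution (denoted by a bar) $\overline{T}=S(T)^t$, i.e. $\overline{T_i^{\,j}}=S(T)_j^{\,i}$. $A(S^7_q)$ is the subalgebra of $A(Sp_q(2))$ generated by $x_i=T_i^{\,4}$ and $\bar x^i=\overline{x_i}=S(T)_4^{\,i}=q^{2+\rho_i}\varepsilon_{i'}T_{i'}^{\,1}$, $i=1,\dots,4$. $A(S^4_q)$ is the subalgebra of $A(S^7_q)$ generated by the entries of $p=vv^*$ ($v^*$ the conjugate transpose), where $$v=\begin{pmatrix} q^{-3}x_1 & q^{-2}x_2\\ -q^{-1}\bar x^2 & q^{-1}\bar x^1\\ q^{-1}x_3 & -x_4\\ -\bar x^4 & -\bar x^3\end{pmatrix}.$$ $A(SU_q(2))$ is the Hopf $*$-algebra generated by $\alpha,\gamma,\bar\alpha=\alpha^*,\bar\gamma=\gamma^*$ with relations $\alpha\gamma=q\gamma\alpha$, $\alpha\bar\gamma=q\bar\gamma\alpha$, $\gamma\bar\gamma=\bar\gamma\gamma$, $\alpha\bar\alpha+q^2\bar\gamma\gamma=1$, $\bar\alpha\alpha+\bar\gamma\gamma=1$ (and their conjugates), with Hopf structure such that the matrix $u=\begin{pmatrix}\alpha&-q\bar\gamma\\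 \gamma&\bar\alpha\end{pmatrix}$ satisfies $\Delta(u_{ij})=\sum_ku_{ik}\otimes u_{kj}$, $\varepsilon(u_{ij})=\delta_{ij}$, $S(u_{ij})=(u_{ji})^*$. The right coaction $\delta_R:A(S^7_q)\to A(S^7_q)\otimes A(SU_q(2))$ is the $*$-algebra homomorphism with $\delta_R(v_{ij})=\sum_kv_{ik}\otimes u_{kj}$; explicitly $\delta_R(x_1)=x_1\otimes\alpha+q\,x_2\otimes\gamma$, $\delta_R(x_2)=-x_1\otimes\bar\gamma+x_2\otimes\bar\alpha$, $\delta_R(x_3)=x_3\otimes\alpha-q\,x_4\otimes\gamma$, $\delta_R(x_4)=x_3\otimes\bar\gamma+x_4\otimes\bar\alpha$, and $\delta_R(\bar x^i)=\overline{\delta_R(x_i)}$. *)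

theory Defs
  imports Complex_Main "HOL-Algebra.QuotRing" "HOL-Algebra.Module" "HOL-Library.Poly_Mapping"
begin

section \<open>Complex star-algebras\<close>

text \<open>The library locale \<^locale>\<open>algebra\<close> is restricted to commutative rings, so only the underlying
  record is reused here, with \<^typ>\<open>complex\<close> as scalars, and extended by an antilinear involution.\<close>

record 'a star_alg = "(complex, 'a) module" +
  star :: "'a \<Rightarrow> 'a"

definition star_alg_hom ::
  "('a, 'c) star_alg_scheme \<Rightarrow> ('b, 'd) star_alg_scheme \<Rightarrow> ('a \<Rightarrow> 'b) set" where
  "star_alg_hom A B = {h \<in> ring_hom A B.
     (\<forall>c. \<forall>a\<in>carrier A. h (c \<odot>\<^bsub>A\<^esub> a) = c \<odot>\<^bsub>B\<^esub> h a) \<and>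
     (\<forall>a\<in>carrier A. h (star A a) = star B (h a))}"

inductive_set gen_subalg :: "('a, 'c) star_alg_scheme \<Rightarrow> 'a set \<Rightarrow> 'a set"
  for A (structure) and S where
  gen: "s \<in> S \<Longrightarrow> s \<in> gen_subalg A S"
| one: "\<one> \<in> gen_subalg A S"
| add: "a \<in> gen_subalg A S \<Longrightarrow> b \<in> gen_subalg A S \<Longrightarrow> a \<oplus> b \<in> gen_subalg A S"
| mult: "a \<in> gen_subalg A S \<Longrightarrow> b \<in> gen_subalg A S \<Longrightarrow> a \<otimes> b \<in> gen_subalg A S"
| smult: "a \<in> gen_subalg A S \<Longrightarrow> c \<odot> a \<in> gen_subalg A S"

definition subalg :: "'a star_alg \<Rightarrow> 'a set \<Rightarrow> 'a star_alg" where
  "subalg A S = A\<lparr>carrier := gen_subalg A S\<rparr>"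

text \<open>The algebra of a monoid \<open>M\<close>: formal complex combinations of elements of \<open>M\<close>. The star is the
  antilinear extension of its prescribed values \<open>\<sigma>\<close> on \<open>M\<close>.\<close>

definition monoid_alg ::
  "('m, 'c) monoid_scheme \<Rightarrow> ('m \<Rightarrow> 'm \<Rightarrow>\<^sub>0 complex) \<Rightarrow> ('m \<Rightarrow>\<^sub>0 complex) star_alg" where
  "monoid_alg M \<sigma> = \<lparr>
     carrier = {f. Poly_Mapping.keys f \<subseteq> carrier M},
     mult = (\<lambda>f g. \<Sum>a\<in>Poly_Mapping.keys f. \<Sum>b\<in>Poly_Mapping.keys g.
       Poly_Mapping.single (a \<otimes>\<^bsub>M\<^esub> b) (Poly_Mapping.lookup f a * Poly_Mapping.lookup g b)),
     one = Poly_Mapping.single \<one>\<^bsub>M\<^esub> 1,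
     zero = 0,
     add = (+),
     smult = (\<lambda>c. Poly_Mapping.map ((*) c)),
     star = (\<lambda>f. \<Sum>a\<in>Poly_Mapping.keys f.
       Poly_Mapping.map ((*) (cnj (Poly_Mapping.lookup f a))) (\<sigma> a))\<rparr>"

definition word_monoid :: "'g set \<Rightarrow> 'g list monoid" where
  "word_monoid G = \<lparr>carrier = lists G, mult = (@), one = []\<rparr>"

text \<open>The free algebra on \<open>G\<close>, with the antilinear anti-multiplicative map sending each \<open>g \<in> G\<close> to
  \<open>s g\<close>: on words, \<open>(g\<^sub>1 \<dots> g\<^sub>n)\<^sup>* = s g\<^sub>n \<dots> s g\<^sub>1\<close>. The multiplication of
  \<open>monoid_alg\<close> does not depend on its second argument, hence the dummy \<open>\<lambda>_. 0\<close>.\<close>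

definition free_star_alg ::
  "'g set \<Rightarrow> ('g \<Rightarrow> 'g list \<Rightarrow>\<^sub>0 complex) \<Rightarrow> ('g list \<Rightarrow>\<^sub>0 complex) star_alg" where
  "free_star_alg G s = monoid_alg (word_monoid G)
     (\<lambda>w. foldr (\<lambda>g f. f \<otimes>\<^bsub>monoid_alg (word_monoid G) (\<lambda>_. 0)\<^esub> s g) w (Poly_Mapping.single [] 1))"

text \<open>Quotient by the two-sided ideal generated by \<open>Q\<close>. Scalar multiplication acts on
  representatives; so does the star, provided the ideal is star-invariant.\<close>

definition cls :: "'a star_alg \<Rightarrow> 'a set \<Rightarrow> 'a \<Rightarrow> 'a set" where
  "cls A Q a = Idl\<^bsub>A\<^esub> Q +>\<^bsub>A\<^esub> a"

definition quot_alg :: "'a star_alg \<Rightarrow> 'a set \<Rightarrow> 'a set star_alg" where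
  "quot_alg A Q = (let B = A Quot (Idl\<^bsub>A\<^esub> Q) in \<lparr>
     carrier = carrier B, mult = mult B, one = one B, zero = zero B, add = add B,
     smult = (\<lambda>c X. \<Union>a\<in>X. cls A Q (c \<odot>\<^bsub>A\<^esub> a)),
     star = (\<lambda>X. \<Union>a\<in>X. cls A Q (star A a))\<rparr>)"

text \<open>Tensor product: formal combinations of pairs modulo bilinearity. The linear span of
  \<open>bilinear_rels A B\<close> is closed under multiplication by pairs, so it coincides with the ideal
  generated, and the quotient is the usual tensor product of vector spaces with
  \<open>(a \<otimes> b)(a' \<otimes> b') = aa' \<otimes> bb'\<close> and \<open>(a \<otimes> b)\<^sup>* = a\<^sup>* \<otimes> b\<^sup>*\<close>.\<close>

definition pair_alg :: "'a star_alg \<Rightarrow> 'b star_alg \<Rightarrow> ('a \<times> 'b \<Rightarrow>\<^sub>0 complex) star_alg" where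
  "pair_alg A B = monoid_alg (A \<times>\<times> B) (\<lambda>(a, b). Poly_Mapping.single (star A a, star B b) 1)"

definition bilinear_rels :: "'a star_alg \<Rightarrow> 'b star_alg \<Rightarrow> ('a \<times> 'b \<Rightarrow>\<^sub>0 complex) set" where
  "bilinear_rels A B =
     {Poly_Mapping.single (a \<oplus>\<^bsub>A\<^esub> a', b) 1 - Poly_Mapping.single (a, b) 1 - Poly_Mapping.single (a', b) 1
       | a a' b. a \<in> carrier A \<and> a' \<in> carrier A \<and> b \<in> carrier B} \<union>
     {Poly_Mapping.single (a, b \<oplus>\<^bsub>B\<^esub> b') 1 - Poly_Mapping.single (a, b) 1 - Poly_Mapping.single (a, b') 1
       | a b b'. a \<in> carrier A \<and> b \<in> carrier B \<and> b' \<in> carrier B} \<union>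
     {Poly_Mapping.single (c \<odot>\<^bsub>A\<^esub> a, b) 1 - Poly_Mapping.single (a, b) c
       | c a b. a \<in> carrier A \<and> b \<in> carrier B} \<union>
     {Poly_Mapping.single (a, c \<odot>\<^bsub>B\<^esub> b) 1 - Poly_Mapping.single (a, b) c
       | c a b. a \<in> carrier A \<and> b \<in> carrier B}"

definition tensor_alg :: "'a star_alg \<Rightarrow> 'b star_alg \<Rightarrow> ('a \<times> 'b \<Rightarrow>\<^sub>0 complex) set star_alg" where
  "tensor_alg A B = quot_alg (pair_alg A B) (bilinear_rels A B)"

definition tensor :: "'a star_alg \<Rightarrow> 'b star_alg \<Rightarrow> 'a \<Rightarrow> 'b \<Rightarrow> ('a \<times> 'b \<Rightarrow>\<^sub>0 complex) set" where
  "tensor A B a b = cls (pair_alg A B) (bilinear_rels A B) (Poly_Mapping.single (a, b) 1)"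


section \<open>The quantum symplectic group\<close>

text \<open>Indices run over \<open>{1..4}\<close>, and \<open>i' = 5 - i\<close>.\<close>

definition eps :: "nat \<Rightarrow> complex" where
  "eps i = (if i \<le> 2 then 1 else - 1)"

definition rho :: "nat \<Rightarrow> int" where
  "rho i = (if i = 1 then 2 else if i = 2 then 1 else if i = 3 then - 1 else - 2)"

definition qpow :: "real \<Rightarrow> int \<Rightarrow> complex" where
  "qpow q n = complex_of_real (q powi n)"

text \<open>\<open>munit i j k l a b c d\<close> is the entry of \<open>e\<^sub>i\<^sup>j \<otimes> e\<^sub>k\<^sup>l\<close> in row \<open>(a, b)\<close>, column \<open>(c, d)\<close>;
  likewise \<open>Rmat q a b c d\<close> is an entry of \<open>R\<close>.\<close>

definition munit :: "nat \<Rightarrow> nat \<Rightarrow> nat \<Rightarrow> nat \<Rightarrow> nat \<Rightarrow> nat \<Rightarrow> nat \<Rightarrow> nat \<Rightarrow> complex" where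
  "munit i j k l a b c d = of_bool (a = i \<and> c = j \<and> b = k \<and> d = l)"

definition Rmat :: "real \<Rightarrow> nat \<Rightarrow> nat \<Rightarrow> nat \<Rightarrow> nat \<Rightarrow> complex" where
  "Rmat q a b c d =
     qpow q 1 * (\<Sum>i\<in>{1..4}. munit i i i i a b c d)
     + (\<Sum>(i, j) \<in> {(i, j). i \<in> {1..4} \<and> j \<in> {1..4} \<and> i \<noteq> j \<and> i \<noteq> 5 - j}. munit i i j j a b c d)
     + qpow q (-1) * (\<Sum>i\<in>{1..4}. munit (5 - i) (5 - i) i i a b c d)
     + (qpow q 1 - qpow q (-1)) *
        (\<Sum>(i, j) \<in> {(i, j). i \<in> {1..4} \<and> j \<in> {1..4} \<and> i > j}. munit i j j i a b c d)
     - (qpow q 1 - qpow q (-1)) *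
        (\<Sum>(i, j) \<in> {(i, j). i \<in> {1..4} \<and> j \<in> {1..4} \<and> i > j}.
           qpow q (rho i - rho j) * eps i * eps j * munit i j (5 - i) (5 - j) a b c d)"

definition Cmat :: "real \<Rightarrow> nat \<Rightarrow> nat \<Rightarrow> complex" where
  "Cmat q i j = qpow q (rho j) * eps i * of_bool (i = 5 - j)"

definition Cinv :: "real \<Rightarrow> nat \<Rightarrow> nat \<Rightarrow> complex" where
  "Cinv q i j = - Cmat q i j"

lemma idx_cases: "(i::nat) \<in> {1..4} \<Longrightarrow> i = 1 \<or> i = 2 \<or> i = 3 \<or> i = 4"
  by (simp add: atLeastAtMost_iff) linarith

lemma sum_idx: "(\<Sum>k\<in>{1..4::nat}. f k) = f 1 + f 2 + f 3 + f 4"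
proof -
  have "{1..4::nat} = {1, 2, 3, 4}" by auto
  then show ?thesis by (simp add: add.assoc)
qed

lemma qpow_mult: "q \<noteq> 0 \<Longrightarrow> qpow q m * qpow q n = qpow q (m + n)"
  by (simp add: qpow_def power_int_add)

lemma qpow_0: "qpow q 0 = 1"
  by (simp add: qpow_def)

lemma Cinv_inverse:
  assumes q: "q \<noteq> 0" and i: "i \<in> {1..4}" and j: "j \<in> {1..4}"
  shows "(\<Sum>k\<in>{1..4}. Cmat q i k * Cinv q k j) = of_bool (i = j)"
    and "(\<Sum>k\<in>{1..4}. Cinv q i k * Cmat q k j) = of_bool (i = j)"
proof -
  have *: "(\<Sum>k\<in>{1..4}. Cmat q i k * Cmat q k j) = - of_bool (i = j)"
    unfolding sum_idx using idx_cases[OF i] idx_cases[OF j]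
    apply (elim disjE; hypsubst)
    apply (simp_all add: Cmat_def rho_def eps_def qpow_mult[OF q] qpow_0)
    done
  then show "(\<Sum>k\<in>{1..4}. Cmat q i k * Cinv q k j) = of_bool (i = j)"
    and "(\<Sum>k\<in>{1..4}. Cinv q i k * Cmat q k j) = of_bool (i = j)"
    by (simp_all add: Cinv_def sum_negf)
qed

text \<open>\<open>T\<^sub>i\<^sup>j\<close> is the letter \<open>(i, j)\<close>, and \<open>antip q i j\<close> is \<open>S(T)\<^sub>i\<^sup>j = (C T\<^sup>t C\<^sup>-\<^sup>1)\<^sub>i\<^sup>j\<close> in the free
  algebra.\<close>

definition antip :: "real \<Rightarrow> nat \<Rightarrow> nat \<Rightarrow> (nat \<times> nat) list \<Rightarrow>\<^sub>0 complex" where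
  "antip q i j = (\<Sum>k\<in>{1..4}. \<Sum>l\<in>{1..4}. Poly_Mapping.single [(l, k)] (Cmat q i k * Cinv q l j))"

lemma antip_explicit:
  assumes q: "q \<noteq> 0" and i: "i \<in> {1..4}" and j: "j \<in> {1..4}"
  shows "antip q i j = Poly_Mapping.single [(5 - j, 5 - i)]
    (- qpow q (rho (5 - i) + rho j) * eps i * eps (5 - j))"
  unfolding antip_def sum_idx using idx_cases[OF i] idx_cases[OF j]
  apply (elim disjE; hypsubst)
  apply (simp_all add: Cmat_def Cinv_def rho_def eps_def qpow_mult[OF q])
  done

definition Sp_free :: "real \<Rightarrow> ((nat \<times> nat) list \<Rightarrow>\<^sub>0 complex) star_alg" where
  "Sp_free q = free_star_alg ({1..4} \<times> {1..4}) (\<lambda>(i, j). antip q j i)"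

text \<open>Entrywise: \<open>R T\<^sub>1 T\<^sub>2 = T\<^sub>2 T\<^sub>1 R\<close>, \<open>T C T\<^sup>t C\<^sup>-\<^sup>1 = 1\<close> and \<open>C T\<^sup>t C\<^sup>-\<^sup>1 T = 1\<close>, using
  \<open>(T\<^sub>1 T\<^sub>2)\<^sub>m\<^sub>n\<^sup>c\<^sup>d = T\<^sub>m\<^sup>c T\<^sub>n\<^sup>d\<close> and \<open>(T\<^sub>2 T\<^sub>1)\<^sub>a\<^sub>b\<^sup>m\<^sup>n = T\<^sub>b\<^sup>n T\<^sub>a\<^sup>m\<close>.\<close>

definition Sp_rels :: "real \<Rightarrow> ((nat \<times> nat) list \<Rightarrow>\<^sub>0 complex) set" where
  "Sp_rels q =
     {(\<Sum>m\<in>{1..4}. \<Sum>n\<in>{1..4}. Poly_Mapping.single [(m, c), (n, d)] (Rmat q a b m n))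
       - (\<Sum>m\<in>{1..4}. \<Sum>n\<in>{1..4}. Poly_Mapping.single [(b, n), (a, m)] (Rmat q m n c d))
       | a b c d. a \<in> {1..4} \<and> b \<in> {1..4} \<and> c \<in> {1..4} \<and> d \<in> {1..4}} \<union>
     {(\<Sum>k\<in>{1..4}. \<Sum>l\<in>{1..4}. \<Sum>m\<in>{1..4}.
         Poly_Mapping.single [(i, k), (m, l)] (Cmat q k l * Cinv q m j))
       - Poly_Mapping.single [] (of_bool (i = j)) | i j. i \<in> {1..4} \<and> j \<in> {1..4}} \<union>
     {(\<Sum>k\<in>{1..4}. \<Sum>l\<in>{1..4}. \<Sum>m\<in>{1..4}.
         Poly_Mapping.single [(l, k), (m, j)] (Cmat q i k * Cinv q l m))
       - Poly_Mapping.single [] (of_bool (i = j)) | i j. i \<in> {1..4} \<and> j \<in> {1..4}}"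

type_synonym sp_elem = "((nat \<times> nat) list \<Rightarrow>\<^sub>0 complex) set"

definition A_Sp :: "real \<Rightarrow> sp_elem star_alg" where
  "A_Sp q = quot_alg (Sp_free q) (Sp_rels q)"

definition Tgen :: "real \<Rightarrow> nat \<Rightarrow> nat \<Rightarrow> sp_elem" where
  "Tgen q i j = cls (Sp_free q) (Sp_rels q) (Poly_Mapping.single [(i, j)] 1)"


section \<open>The quantum spheres\<close>

definition xgen :: "real \<Rightarrow> nat \<Rightarrow> sp_elem" where
  "xgen q i = Tgen q i 4"

definition xbar :: "real \<Rightarrow> nat \<Rightarrow> sp_elem" where
  "xbar q i = star (A_Sp q) (xgen q i)"

definition A_S7 :: "real \<Rightarrow> sp_elem star_alg" where
  "A_S7 q = subalg (A_Sp q) (xgen q ` {1..4} \<union> xbar q ` {1..4})"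

definition vmat :: "real \<Rightarrow> nat \<Rightarrow> nat \<Rightarrow> sp_elem" where
  "vmat q i j = (let sc = (\<lambda>c a. c \<odot>\<^bsub>A_S7 q\<^esub> a) in
     [[sc (qpow q (-3)) (xgen q 1),   sc (qpow q (-2)) (xgen q 2)],
      [sc (- qpow q (-1)) (xbar q 2), sc (qpow q (-1)) (xbar q 1)],
      [sc (qpow q (-1)) (xgen q 3),   sc (- 1) (xgen q 4)],
      [sc (- 1) (xbar q 4),            sc (- 1) (xbar q 3)]] ! (i - 1) ! (j - 1))"

definition pmat :: "real \<Rightarrow> nat \<Rightarrow> nat \<Rightarrow> sp_elem" where
  "pmat q i j = vmat q i 1 \<otimes>\<^bsub>A_S7 q\<^esub> star (A_S7 q) (vmat q j 1) \<oplus>\<^bsub>A_S7 q\<^esub>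
                vmat q i 2 \<otimes>\<^bsub>A_S7 q\<^esub> star (A_S7 q) (vmat q j 2)"

definition A_S4 :: "real \<Rightarrow> sp_elem star_alg" where
  "A_S4 q = subalg (A_S7 q) {pmat q i j | i j. i \<in> {1..4} \<and> j \<in> {1..4}}"


section \<open>The quantum group SU(2) and the coaction\<close>

datatype su_gen = Al | Ga | AlBar | GaBar

fun su_bar :: "su_gen \<Rightarrow> su_gen" where
  "su_bar Al = AlBar"
| "su_bar Ga = GaBar"
| "su_bar AlBar = Al"
| "su_bar GaBar = Ga"

definition SU_free :: "(su_gen list \<Rightarrow>\<^sub>0 complex) star_alg" where
  "SU_free = free_star_alg UNIV (\<lambda>g. Poly_Mapping.single [su_bar g] 1)"

definition SU_rels0 :: "real \<Rightarrow> (su_gen list \<Rightarrow>\<^sub>0 complex) set" where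
  "SU_rels0 q =
     {Poly_Mapping.single [Al, Ga] 1 - Poly_Mapping.single [Ga, Al] (qpow q 1),
      Poly_Mapping.single [Al, GaBar] 1 - Poly_Mapping.single [GaBar, Al] (qpow q 1),
      Poly_Mapping.single [Ga, GaBar] 1 - Poly_Mapping.single [GaBar, Ga] 1,
      Poly_Mapping.single [Al, AlBar] 1 + Poly_Mapping.single [GaBar, Ga] (qpow q 2)
        - Poly_Mapping.single [] 1,
      Poly_Mapping.single [AlBar, Al] 1 + Poly_Mapping.single [GaBar, Ga] 1
        - Poly_Mapping.single [] 1}"

definition SU_rels :: "real \<Rightarrow> (su_gen list \<Rightarrow>\<^sub>0 complex) set" where
  "SU_rels q = SU_rels0 q \<union> star SU_free ` SU_rels0 q"

type_synonym su_elem = "(su_gen list \<Rightarrow>\<^sub>0 complex) set"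

definition A_SU :: "real \<Rightarrow> su_elem star_alg" where
  "A_SU q = quot_alg SU_free (SU_rels q)"

definition su :: "real \<Rightarrow> su_gen \<Rightarrow> su_elem" where
  "su q g = cls SU_free (SU_rels q) (Poly_Mapping.single [g] 1)"

definition umat :: "real \<Rightarrow> nat \<Rightarrow> nat \<Rightarrow> su_elem" where
  "umat q i j = [[su q Al, (- qpow q 1) \<odot>\<^bsub>A_SU q\<^esub> su q GaBar],
                 [su q Ga, su q AlBar]] ! (i - 1) ! (j - 1)"

text \<open>The conditions below fix \<open>\<delta>\<close> on the algebra generators of \<open>A_S7 q\<close>, hence on its carrier;
  values of \<open>\<delta>\<close> off the carrier are irrelevant.\<close>

definition is_right_coaction ::
  "real \<Rightarrow> (sp_elem \<Rightarrow> (sp_elem \<times> su_elem \<Rightarrow>\<^sub>0 complex) set) \<Rightarrow> bool" where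
  "is_right_coaction q \<delta> \<longleftrightarrow>
     \<delta> \<in> star_alg_hom (A_S7 q) (tensor_alg (A_S7 q) (A_SU q)) \<and>
     (\<forall>i\<in>{1..4}. \<forall>j\<in>{1..2}. \<delta> (vmat q i j) =
        tensor (A_S7 q) (A_SU q) (vmat q i 1) (umat q 1 j) \<oplus>\<^bsub>tensor_alg (A_S7 q) (A_SU q)\<^esub>
        tensor (A_S7 q) (A_SU q) (vmat q i 2) (umat q 2 j))"

end

theory Submission
  imports Defs
begin

text \<open>Each row \<open>v\<^sub>i = (v\<^sub>i\<^sub>1, v\<^sub>i\<^sub>2)\<close> of the matrix \<open>v\<close> transforms under the coaction like the
fundamental corepresentation of quantum \<open>SU(2)\<close>, and the entries of \<open>v\<close> are, up to nonzero
scalars, the eight generators of the 7-sphere. The entries of \<open>p = v v\<^sup>*\<close> are, up to nonzero scalars, the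
quantum minors \<open>m\<^sub>i\<^sub>j = v\<^sub>i\<^sub>1 v\<^sub>j\<^sub>2 - q v\<^sub>i\<^sub>2 v\<^sub>j\<^sub>1\<close>. They are coinvariant because the quantum determinant
of \<open>u\<close> is \<open>1\<close>. So the theorem is a quantum version of the first fundamental theorem of invariant
theory for \<open>SL(2)\<close>: a coinvariant polynomial in four doublets is a polynomial in their minors.

The converse inclusion rests on two facts.

First, the R-matrix relations allow one to exchange two rows:
\<open>v\<^sub>j\<^sub>r v\<^sub>l\<^sub>s\<close> is a combination of \<open>v\<^sub>l\<^sub>r v\<^sub>j\<^sub>s\<close> and \<open>\<epsilon>\<^sub>r\<^sub>s m\<^sub>l\<^sub>j\<close> (and for one pair of rows of two more terms of
the same shape), in which the coefficient of \<open>m\<^sub>l\<^sub>j\<close> does not vanish. Contracting such a relation with a third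
row gives a three-term relation of Pluecker type that expresses \<open>v\<^sub>i\<^sub>k m\<^sub>l\<^sub>j\<close> through products with
the minor on the left (\<open>passes_exchange\<close>, \<open>vgen_minors\<close>). Hence every element is a combination
of products \<open>b w\<close>, where \<open>b\<close> is a polynomial in the minors and \<open>w\<close> a word in the \<open>v\<^sub>i\<^sub>k\<close>, and by
\<open>v\<^sub>i\<^sub>2 v\<^sub>j\<^sub>1 = q\<^sup>-\<^sup>1 (v\<^sub>i\<^sub>1 v\<^sub>j\<^sub>2 - m\<^sub>i\<^sub>j)\<close> one may sort the column indices of \<open>w\<close> modulo shorter words, keeping
its row indices in place.

Second, an upper triangular two-dimensional representation of the algebra of quantum \<open>SU(2)\<close> turns the
coaction into twisted derivations of the 7-sphere, the lowering and raising operators of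
the quantum enveloping algebra. They kill the minors, hence act on \<open>w\<close> alone, and kill every coinvariant
(\<open>coinvariant_twisted_deriv\<close>). On a sorted word
of positive length lowering followed by raising, or raising followed by lowering, is multiplication by a nonzero
number modulo shorter words; this uses that \<open>q\<close> is real. So the leading part of a coinvariant
vanishes, and descending along the length of words leaves a polynomial in the minors
(\<open>invariants_are_minors\<close>). The argument takes place in the free algebra on the \<open>v\<^sub>i\<^sub>k\<close>, modulo the
ideal of their relations.\<close>

section \<open>Free algebras\<close>

text \<open>With concatenation as addition of exponents, the finitely supported functions on words form the free
algebra as an instance of the class of rings.\<close>

instantiation list :: (type) monoid_add
begin
definition zero_list :: "'a list" where "zero_list = []"
definition plus_list :: "'a list \<Rightarrow> 'a list \<Rightarrow> 'a list" where "plus_list = (@)"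
instance by standard (simp_all add: zero_list_def plus_list_def)
end

abbreviation monom :: "'a \<Rightarrow> ('a \<Rightarrow>\<^sub>0 complex)" where
  "monom u \<equiv> Poly_Mapping.single u 1"

definition scal :: "complex \<Rightarrow> ('a \<Rightarrow>\<^sub>0 complex) \<Rightarrow> ('a \<Rightarrow>\<^sub>0 complex)" where
  "scal c = Poly_Mapping.map ((*) c)"

lemma lookup_scal [simp]: "Poly_Mapping.lookup (scal c f) u = c * Poly_Mapping.lookup f u"
  by (simp add: scal_def map.rep_eq when_def)

lemma scal_single [simp]: "scal c (Poly_Mapping.single u d) = Poly_Mapping.single u (c * d)"
  by (rule poly_mapping_eqI) (simp add: lookup_single when_def)

global_interpretation pm: vector_space "scal :: complex \<Rightarrow> ('a \<Rightarrow>\<^sub>0 complex) \<Rightarrow> _"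
  by unfold_locales
    (auto intro!: poly_mapping_eqI simp: lookup_add algebra_simps)

lemma scal_conv_mult: "scal c (f :: 'a::monoid_add \<Rightarrow>\<^sub>0 complex) = Poly_Mapping.single 0 c * f"
  unfolding scal_def by (rule mult_map_scale_conv_mult)

lemma scal_mult_left [simp]: "scal c f * g = scal c (f * (g :: 'a::monoid_add \<Rightarrow>\<^sub>0 complex))"
  by (simp add: scal_conv_mult mult.assoc)

lemma single_induct [case_names zero add single]:
  fixes f :: "'a \<Rightarrow>\<^sub>0 complex"
  assumes "P 0" and "\<And>f g. P f \<Longrightarrow> P g \<Longrightarrow> P (f + g)" and "\<And>u c. P (Poly_Mapping.single u c)"
  shows "P f"
proof (induction f rule: update_induct)
  case const
  then show ?case using assms(1) by simp
next
  case (update f u c)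
  have "Poly_Mapping.update u c f = f + Poly_Mapping.single u c"
    by (rule poly_mapping_eqI) (use update(1) in \<open>auto simp: lookup_update lookup_add lookup_single when_def in_keys_iff\<close>)
  then show ?case using assms(2)[OF update(3) assms(3)] by simp
qed

lemma mult_single_0: "f * Poly_Mapping.single 0 c = scal c (f :: 'a::monoid_add \<Rightarrow>\<^sub>0 complex)"
  by (induction f rule: single_induct)
    (simp_all add: distrib_right pm.scale_right_distrib mult_single mult.commute)

lemma scal_mult_right [simp]: "f * scal c g = scal c (f * (g :: 'a::monoid_add \<Rightarrow>\<^sub>0 complex))"
  by (metis mult.assoc mult_single_0 scal_conv_mult scal_mult_left)

lemma monom_mult: "monom u * monom v = monom (u + v :: 'a::monoid_add)"
  by (simp add: mult_single)

lemma single_conv_scal: "Poly_Mapping.single u c = scal c (monom u)"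
  by simp

lemma single_empty: "monom ([] :: 'a list) = 1"
  by (simp flip: zero_list_def)

lemma monom_Cons: "monom (x # u) = monom [x] * monom u"
  by (simp add: monom_mult plus_list_def)

lemma monom_append: "monom (u @ w) = monom u * monom w"
  by (simp add: monom_mult plus_list_def)

definition linext :: "(complex \<Rightarrow> 'b \<Rightarrow> 'b) \<Rightarrow> ('a \<Rightarrow> 'b) \<Rightarrow> ('a \<Rightarrow>\<^sub>0 complex) \<Rightarrow> 'b::ab_group_add" where
  "linext s \<phi> f = (\<Sum>u\<in>Poly_Mapping.keys f. s (Poly_Mapping.lookup f u) (\<phi> u))"

lemma linext_superset:
  assumes "vector_space s" "finite U" "Poly_Mapping.keys f \<subseteq> U"
  shows "linext s \<phi> f = (\<Sum>u\<in>U. s (Poly_Mapping.lookup f u) (\<phi> u))"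
proof -
  interpret vector_space s by fact
  show ?thesis unfolding linext_def
    by (rule sum.mono_neutral_left) (use assms in \<open>auto simp: in_keys_iff\<close>)
qed

lemma linext_add:
  assumes "vector_space s"
  shows "linext s \<phi> (f + g) = linext s \<phi> f + linext s \<phi> g"
proof -
  interpret vector_space s by fact
  let ?U = "Poly_Mapping.keys f \<union> Poly_Mapping.keys g"
  have "linext s \<phi> (f + g) = (\<Sum>u\<in>?U. s (Poly_Mapping.lookup (f + g) u) (\<phi> u))"
    by (rule linext_superset) (use assms keys_add[of f g] in auto)
  also have "\<dots> = (\<Sum>u\<in>?U. s (Poly_Mapping.lookup f u) (\<phi> u)) + (\<Sum>u\<in>?U. s (Poly_Mapping.lookup g u) (\<phi> u))"
    by (simp add: lookup_add scale_left_distrib sum.distrib)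
  also have "\<dots> = linext s \<phi> f + linext s \<phi> g"
    by (subst (1 2) linext_superset[OF assms, of ?U]) auto
  finally show ?thesis .
qed

lemma linext_zero [simp]: "linext s \<phi> 0 = 0"
  by (simp add: linext_def)

lemma linext_single:
  assumes "vector_space s"
  shows "linext s \<phi> (Poly_Mapping.single u c) = s c (\<phi> u)"
proof -
  interpret vector_space s by fact
  show ?thesis by (simp add: linext_def)
qed

lemma linext_scal:
  assumes "vector_space s"
  shows "linext s \<phi> (scal c f) = s c (linext s \<phi> f)"
proof -
  interpret vector_space s by fact
  show ?thesis
    by (induction f rule: single_induct)
      (simp_all add: linext_add[OF assms] linext_single[OF assms] pm.scale_right_distrib scale_right_distrib)
qed

lemma linext_diff:
  assumes "vector_space s"
  shows "linext s \<phi> (f - g) = linext s \<phi> f - linext s \<phi> g"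
  by (metis add_diff_cancel_right' assms diff_add_cancel linext_add)

lemmas pm_linext_add = linext_add[OF pm.vector_space_axioms]
  and pm_linext_single = linext_single[OF pm.vector_space_axioms]
  and pm_linext_scal = linext_scal[OF pm.vector_space_axioms]
  and pm_linext_diff = linext_diff[OF pm.vector_space_axioms]


section \<open>Minors of doublets and twisted derivations\<close>

text \<open>The free algebra on doublets indexed by \<open>'i\<close>; the column indices \<open>1\<close> and \<open>2\<close> are encoded as \<open>False\<close> and \<open>True\<close>.\<close>

type_synonym 'i doublets = "('i \<times> bool) list \<Rightarrow>\<^sub>0 complex"

definition vgen :: "'i \<Rightarrow> bool \<Rightarrow> 'i doublets" where
  "vgen i k = monom [(i, k)]"

definition minor :: "complex \<Rightarrow> 'i \<Rightarrow> 'i \<Rightarrow> 'i doublets" where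
  "minor q i j = vgen i False * vgen j True - scal q (vgen i True * vgen j False)"

inductive_set minors :: "complex \<Rightarrow> 'i doublets set" for q where
  const: "scal c 1 \<in> minors q"
| minor: "minor q i j \<in> minors q"
| add: "x \<in> minors q \<Longrightarrow> y \<in> minors q \<Longrightarrow> x + y \<in> minors q"
| mult: "x \<in> minors q \<Longrightarrow> y \<in> minors q \<Longrightarrow> x * y \<in> minors q"

lemma minors_one: "1 \<in> minors q"
  using minors.const[of 1] by simp

lemma minors_scal: "x \<in> minors q \<Longrightarrow> scal c x \<in> minors q"
  using minors.mult[OF minors.const[of c q], of x] by simp

text \<open>The operators by which \<open>K\<close> and the lowering and raising generators of the quantum enveloping algebra of
\<open>sl(2)\<close> act. The parameters \<open>g\<close> and \<open>h\<close> are the weights of lowering (\<open>v\<^sub>i\<^sub>1\<close> to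
\<open>v\<^sub>i\<^sub>2\<close>) and raising (\<open>v\<^sub>i\<^sub>2\<close> to \<open>v\<^sub>i\<^sub>1\<close>). Both are twisted by the same automorphism, so that a single
family of derivations covers the two.\<close>

definition word_weight :: "complex \<Rightarrow> ('i \<times> bool) list \<Rightarrow> complex" where
  "word_weight q u = prod_list (map (\<lambda>(i, k). if k then inverse q else q) u)"

definition weight_op :: "complex \<Rightarrow> 'i doublets \<Rightarrow> 'i doublets" where
  "weight_op q = linext scal (\<lambda>u. scal (word_weight q u) (monom u))"

fun word_deriv :: "complex \<Rightarrow> complex \<Rightarrow> complex \<Rightarrow> ('i \<times> bool) list \<Rightarrow> 'i doublets" where
  "word_deriv q g h [] = 0"
| "word_deriv q g h ((i, k) # u) = scal (if k then inverse q else q) (vgen i k) * word_deriv q g h u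
     + scal (if k then h else g) (vgen i (\<not> k)) * monom u"

definition twisted_deriv :: "complex \<Rightarrow> complex \<Rightarrow> complex \<Rightarrow> 'i doublets \<Rightarrow> 'i doublets" where
  "twisted_deriv q g h = linext scal (word_deriv q g h)"

lemma weight_op_add [simp]: "weight_op q (x + y) = weight_op q x + weight_op q y"
  by (simp add: weight_op_def pm_linext_add)

lemma weight_op_scal [simp]: "weight_op q (scal c x) = scal c (weight_op q x)"
  by (simp add: weight_op_def pm_linext_scal)

lemma weight_op_diff [simp]: "weight_op q (x - y) = weight_op q x - weight_op q y"
  by (simp add: weight_op_def pm_linext_diff)

lemma weight_op_single: "weight_op q (Poly_Mapping.single u c) = Poly_Mapping.single u (c * word_weight q u)"
  by (simp add: weight_op_def pm_linext_single)

lemma weight_op_one [simp]: "weight_op q 1 = 1"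
  using weight_op_single[of q "[]" 1] by (simp add: single_empty word_weight_def)

lemma twisted_deriv_add [simp]: "twisted_deriv q g h (x + y) = twisted_deriv q g h x + twisted_deriv q g h y"
  by (simp add: twisted_deriv_def pm_linext_add)

lemma twisted_deriv_scal [simp]: "twisted_deriv q g h (scal c x) = scal c (twisted_deriv q g h x)"
  by (simp add: twisted_deriv_def pm_linext_scal)

lemma twisted_deriv_diff [simp]: "twisted_deriv q g h (x - y) = twisted_deriv q g h x - twisted_deriv q g h y"
  by (simp add: twisted_deriv_def pm_linext_diff)

lemma twisted_deriv_single: "twisted_deriv q g h (Poly_Mapping.single u c) = scal c (word_deriv q g h u)"
  by (simp add: twisted_deriv_def pm_linext_single)

lemma twisted_deriv_zero [simp]: "twisted_deriv q g h 0 = 0"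
  by (simp add: twisted_deriv_def)

lemma twisted_deriv_one [simp]: "twisted_deriv q g h 1 = 0"
  using twisted_deriv_single[of q g h "[]" 1] by (simp add: single_empty)

lemma word_weight_append: "word_weight q (u @ w) = word_weight q u * word_weight q w"
  by (simp add: word_weight_def)

lemma weight_op_mult: "weight_op q (x * y) = weight_op q x * weight_op q y"
proof (induction x rule: single_induct)
  case (single u c)
  show ?case
    by (induction y rule: single_induct)
      (simp_all add: distrib_left mult_single weight_op_single plus_list_def word_weight_append mult_ac, simp add: weight_op_def)
qed (simp_all add: distrib_right, simp add: weight_op_def)

lemma word_deriv_append: "word_deriv q g h (u @ w) = weight_op q (monom u) * word_deriv q g h w + word_deriv q g h u * monom w"
proof (induction u)
  case Nil
  show ?case by (simp add: single_empty)
next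
  case (Cons a u)
  obtain i k where a: "a = (i, k)" by (cases a)
  have K: "weight_op q (monom (a # u)) = scal (if k then inverse q else q) (vgen i k) * weight_op q (monom u)"
    by (subst monom_Cons) (simp add: weight_op_mult weight_op_single a vgen_def word_weight_def)
  show ?case
    unfolding K using Cons by (simp add: a distrib_left distrib_right mult.assoc monom_append pm.scale_right_distrib)
qed

lemma twisted_deriv_mult: "twisted_deriv q g h (x * y) = weight_op q x * twisted_deriv q g h y + twisted_deriv q g h x * y"
proof (induction x rule: single_induct)
  case (single u c)
  show ?case
  proof (induction y rule: single_induct)
    case (single w d)
    have "twisted_deriv q g h (Poly_Mapping.single u c * Poly_Mapping.single w d) = scal (c * d) (word_deriv q g h (u @ w))"
      by (simp add: mult_single plus_list_def twisted_deriv_single)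
    also have "\<dots> = scal (c * d) (weight_op q (monom u) * word_deriv q g h w + word_deriv q g h u * monom w)"
      by (simp add: word_deriv_append)
    also have "\<dots> = weight_op q (Poly_Mapping.single u c) * twisted_deriv q g h (Poly_Mapping.single w d)
        + twisted_deriv q g h (Poly_Mapping.single u c) * Poly_Mapping.single w d"
      unfolding single_conv_scal[of u c] single_conv_scal[of w d]
      by (simp only: weight_op_scal twisted_deriv_scal scal_mult_left scal_mult_right) (simp add: twisted_deriv_single pm.scale_right_distrib mult.commute)
    finally show ?case .
  qed (simp_all add: distrib_left)
qed (simp_all add: distrib_right, simp add: weight_op_def)

lemma weight_op_vgen: "weight_op q (vgen i k) = scal (if k then inverse q else q) (vgen i k)"
  by (simp add: vgen_def weight_op_single word_weight_def)

lemma twisted_deriv_vgen: "twisted_deriv q g h (vgen i k) = scal (if k then h else g) (vgen i (\<not> k))"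
  by (simp add: vgen_def[of i k] twisted_deriv_single single_empty)

text \<open>A minor has weight \<open>q \<cdot> q\<^sup>-\<^sup>1 = 1\<close>, and the two terms of its derivative cancel. Consequently twisted
derivations are linear over the algebra of minors.\<close>

lemma minors_weight_op: "x \<in> minors q \<Longrightarrow> q \<noteq> 0 \<Longrightarrow> weight_op q x = x"
  by (induction rule: minors.induct) (simp_all add: minor_def weight_op_mult weight_op_vgen)

lemma minors_twisted_deriv: "x \<in> minors q \<Longrightarrow> q \<noteq> 0 \<Longrightarrow> twisted_deriv q g h x = 0"
  by (induction rule: minors.induct)
    (simp_all add: minor_def twisted_deriv_mult weight_op_vgen twisted_deriv_vgen pm.scale_right_distrib minors_weight_op algebra_simps)

lemma twisted_deriv_minors_mult: "x \<in> minors q \<Longrightarrow> q \<noteq> 0 \<Longrightarrow> twisted_deriv q g h (x * y) = x * twisted_deriv q g h y"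
  by (simp add: twisted_deriv_mult minors_weight_op minors_twisted_deriv)

text \<open>The working principle for all the filtrations below: a linear map is controlled on a spanning set.\<close>

lemma span_linear_image:
  assumes add: "\<And>x y. f (x + y) = f x + f y" and scl: "\<And>c x. f (scal c x) = scal c (f x)"
    and S: "\<And>x. x \<in> S \<Longrightarrow> f x \<in> pm.span T" and x: "x \<in> pm.span S"
  shows "f x \<in> pm.span T"
proof -
  have f0: "f 0 = 0" using scl[of 0 0] by simp
  show ?thesis
    using x by (induction rule: pm.span_induct_alt)
      (simp_all add: f0 add scl pm.span_zero pm.span_add pm.span_scale S)
qed


section \<open>Moving minors to the left\<close>

definition skew :: "complex \<Rightarrow> bool \<Rightarrow> bool \<Rightarrow> complex" where
  "skew q r s = (if r = s then 0 else if s then 1 else - q)"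

text \<open>The difference of the two sides of an exchange relation for the rows \<open>j\<close> and \<open>l\<close>. On the tensor square of the
fundamental corepresentation the equivariant maps are spanned by the identity and the projection to
\<open>skew\<close>, which accounts for the shape of the relation. Rows \<open>a\<close> and \<open>b\<close> enter through a correction of the same shape.\<close>

definition exchange_defect ::
  "complex \<Rightarrow> complex \<Rightarrow> complex \<Rightarrow> complex \<Rightarrow> 'i \<Rightarrow> 'i \<Rightarrow> 'i \<Rightarrow> 'i \<Rightarrow> bool \<Rightarrow> bool \<Rightarrow> 'i doublets" where
  "exchange_defect q t e f j l a b r s =
     vgen j r * vgen l s - (scal (t * q) (vgen l r * vgen j s) - scal (t * inverse q * skew q r s) (minor q l j)
       + scal e (vgen a r * vgen b s) + scal (f * skew q r s) (minor q a b))"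

locale doublet_ideal =
  fixes q :: complex and J :: "'i doublets set"
  assumes q0: "q \<noteq> 0"
    and J_zero: "0 \<in> J"
    and J_add: "x \<in> J \<Longrightarrow> y \<in> J \<Longrightarrow> x + y \<in> J"
    and J_left: "x \<in> J \<Longrightarrow> y * x \<in> J"
    and J_right: "x \<in> J \<Longrightarrow> x * y \<in> J"
begin

lemma J_scal: "x \<in> J \<Longrightarrow> scal c x \<in> J"
  using J_left[of x "scal c 1"] by simp

lemma J_diff: "x \<in> J \<Longrightarrow> y \<in> J \<Longrightarrow> x - y \<in> J"
  using J_add[OF _ J_scal[of y "-1"]] by simp

text \<open>The elements that can be written with all minors standing to the left of a single generator of column \<open>k\<close>.\<close>

definition column_span :: "bool \<Rightarrow> 'i doublets set" where
  "column_span k = pm.span (J \<union> {b * vgen i k | b i. b \<in> minors q})"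

lemma J_column_span: "x \<in> J \<Longrightarrow> x \<in> column_span k"
  unfolding column_span_def by (rule pm.span_base) auto

lemma minors_vgen_column_span: "b \<in> minors q \<Longrightarrow> b * vgen i k \<in> column_span k"
  unfolding column_span_def by (rule pm.span_base) auto

lemma column_span_add: "x \<in> column_span k \<Longrightarrow> y \<in> column_span k \<Longrightarrow> x + y \<in> column_span k"
  and column_span_diff: "x \<in> column_span k \<Longrightarrow> y \<in> column_span k \<Longrightarrow> x - y \<in> column_span k"
  and column_span_scal: "x \<in> column_span k \<Longrightarrow> scal c x \<in> column_span k"
  unfolding column_span_def by (auto intro: pm.span_add pm.span_diff pm.span_scale)

lemma column_span_minors_mult: "x \<in> column_span k \<Longrightarrow> b \<in> minors q \<Longrightarrow> b * x \<in> column_span k"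
  unfolding column_span_def
  by (rule span_linear_image[where f = "\<lambda>x. b * x"])
    (auto simp: distrib_left intro!: pm.span_base dest: J_left,
      metis minors.mult mult.assoc)

definition passes :: "'i \<Rightarrow> 'i \<Rightarrow> bool" where
  "passes j l \<longleftrightarrow> (\<forall>i k. vgen i k * minor q j l \<in> column_span k)"

lemma passes_mod:
  assumes "minor q j l \<in> J"
  shows "passes j l"
  using assms by (simp add: passes_def J_column_span J_left)

text \<open>Contracting the first two factors of \<open>v\<^sub>i v\<^sub>j v\<^sub>l\<close> with \<open>skew\<close> gives \<open>m\<^sub>i\<^sub>j v\<^sub>l\<close>; exchanging the last two factors beforehand gives
\<open>m\<^sub>i\<^sub>l v\<^sub>j\<close> and, from the \<open>skew\<close> term, a nonzero multiple of \<open>v\<^sub>i m\<^sub>l\<^sub>j\<close>. Solving for the latter moves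
the minor to the left. Contracting the exchange relation itself makes \<open>m\<^sub>j\<^sub>l\<close> proportional to \<open>m\<^sub>l\<^sub>j\<close>, up to \<open>m\<^sub>a\<^sub>b\<close>.\<close>

lemma passes_exchange:
  assumes lam: "t \<noteq> 0"
    and extra: "passes a b"
    and swap: "\<And>r s. exchange_defect q t e f j l a b r s \<in> J"
  shows "passes l j" and "passes j l"
proof -
  let ?X = "\<lambda>r s. vgen j r * vgen l s - (scal (t * q) (vgen l r * vgen j s)
        - scal (t * inverse q * skew q r s) (minor q l j)
        + scal e (vgen a r * vgen b s) + scal (f * skew q r s) (minor q a b))"
  have canc: "q * (x * inverse q) = x" for x
    using q0 by simp
  have lj: "vgen i k * minor q l j \<in> column_span k" for i k
  proof -
    (* contract v_i with the first factor of the exchange relation of rows j and l *)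
    have "vgen i False * ?X True k - scal q (vgen i True * ?X False k) \<in> J"
      unfolding exchange_defect_def[symmetric] by (intro J_diff J_scal J_left swap)
    also have "vgen i False * ?X True k - scal q (vgen i True * ?X False k)
      = minor q i j * vgen l k - scal (t * q) (minor q i l * vgen j k) - scal t (vgen i k * minor q l j)
        - scal e (minor q i a * vgen b k) + scal (f * q) (vgen i k * minor q a b)"
      using q0 by (cases k) (simp_all add: minor_def skew_def canc algebra_simps pm.scale_right_diff_distrib pm.scale_right_distrib)
    finally have J: "\<dots> \<in> J" .
    have "scal (inverse t) (minor q i j * vgen l k - scal (t * q) (minor q i l * vgen j k)
        - scal e (minor q i a * vgen b k) + scal (f * q) (vgen i k * minor q a b) -
        (minor q i j * vgen l k - scal (t * q) (minor q i l * vgen j k) - scal t (vgen i k * minor q l j)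
        - scal e (minor q i a * vgen b k) + scal (f * q) (vgen i k * minor q a b))) \<in> column_span k"
      using extra by (intro column_span_scal column_span_diff column_span_add J_column_span[OF J] minors_vgen_column_span minors.minor)
        (auto simp: passes_def)
    then show ?thesis using lam by (simp add: algebra_simps)
  qed
  then show "passes l j" by (simp add: passes_def)
  (* contract the two factors of the exchange relation with each other *)
  have "?X False True - scal q (?X True False) \<in> J"
    unfolding exchange_defect_def[symmetric] by (intro J_diff J_scal swap)
  also have "?X False True - scal q (?X True False)
    = minor q j l + scal (t * inverse q) (minor q l j) - scal (e + f * (1 + q * q)) (minor q a b)"
    using q0 by (simp add: minor_def skew_def canc algebra_simps pm.scale_right_diff_distrib pm.scale_right_distrib pm.scale_left_distrib)
  finally have J: "\<dots> \<in> J" .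
  show "passes j l"
    unfolding passes_def
  proof (intro allI)
    fix i k
    have "vgen i k * (minor q j l + scal (t * inverse q) (minor q l j) - scal (e + f * (1 + q * q)) (minor q a b))
       - scal (t * inverse q) (vgen i k * minor q l j) + scal (e + f * (1 + q * q)) (vgen i k * minor q a b) \<in> column_span k"
      by (rule column_span_add[OF column_span_diff[OF J_column_span[OF J_left[OF J]] column_span_scal[OF lj]] column_span_scal])
        (use extra in \<open>simp add: passes_def\<close>)
    then show "vgen i k * minor q j l \<in> column_span k" by (simp add: algebra_simps)
  qed
qed

end


section \<open>Descent along the length of words\<close>

text \<open>Besides \<open>q\<close> being real, the fundamental theorem depends on two facts about the ideal: minors can be moved to the left, and the derivations descend to the quotient.\<close>

locale doublet_fft = doublet_ideal q J for q and J :: "'i doublets set" +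
  assumes q_real: "q \<in> \<real>"
    and passes: "passes j l"
    and D_J: "x \<in> J \<Longrightarrow> twisted_deriv q g h x \<in> J"
begin

lemma vgen_minors: "b \<in> minors q \<Longrightarrow> vgen i k * b \<in> column_span k"
proof (induction arbitrary: i rule: minors.induct)
  case (const c)
  show ?case using minors_vgen_column_span[OF minors.const[of c]] by simp
next
  case (minor j l)
  show ?case using passes by (simp add: passes_def)
next
  case (add x y)
  then show ?case by (simp add: distrib_left column_span_add)
next
  case (mult x y)
  have "z * y \<in> column_span k" if "z \<in> column_span k" for z
    using that unfolding column_span_def
  proof (rule span_linear_image[where f = "\<lambda>z. z * y", rotated 3])
    fix z assume "z \<in> J \<union> {b * vgen i k | b i. b \<in> minors q}"
    then have "z * y \<in> column_span k"
    proof (cases "z \<in> J")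
      case False
      then obtain b i where "z = b * vgen i k" "b \<in> minors q" using \<open>z \<in> _\<close> by auto
      then show ?thesis using mult.IH(2) by (simp add: mult.assoc column_span_minors_mult)
    qed (simp add: J_column_span J_right)
    then show "z * y \<in> pm.span (J \<union> {b * vgen i k | b i. b \<in> minors q})"
      by (simp add: column_span_def)
  qed (simp_all add: distrib_right)
  then show ?case using mult.IH(1)[of i] by (simp flip: mult.assoc)
qed

text \<open>Since minors can be moved to the left, this filtration by the length of words with coefficients among the minors is compatible with multiplication.\<close>

definition short_span :: "nat \<Rightarrow> 'i doublets set" where
  "short_span n = pm.span (J \<union> {b * monom u | b u. b \<in> minors q \<and> length u < n})"

lemma J_short_span: "x \<in> J \<Longrightarrow> x \<in> short_span n"
  unfolding short_span_def by (rule pm.span_base) auto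

lemma monom_short_span: "b \<in> minors q \<Longrightarrow> length u < n \<Longrightarrow> b * monom u \<in> short_span n"
  unfolding short_span_def by (rule pm.span_base) auto

lemma short_span_add: "x \<in> short_span k \<Longrightarrow> y \<in> short_span k \<Longrightarrow> x + y \<in> short_span k"
  and short_span_diff: "x \<in> short_span k \<Longrightarrow> y \<in> short_span k \<Longrightarrow> x - y \<in> short_span k"
  and short_span_scal: "x \<in> short_span k \<Longrightarrow> scal c x \<in> short_span k"
  and short_span_zero: "0 \<in> short_span k"
  unfolding short_span_def by (auto intro: pm.span_add pm.span_diff pm.span_scale pm.span_zero)

lemma short_span_linear_image:
  assumes add: "\<And>x y. f (x + y) = f x + f y" and scl: "\<And>c x. f (scal c x) = scal c (f x)"
    and J: "\<And>x. x \<in> J \<Longrightarrow> f x \<in> pm.span T"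
    and S: "\<And>b u. b \<in> minors q \<Longrightarrow> length u < n \<Longrightarrow> f (b * monom u) \<in> pm.span T" and x: "x \<in> short_span n"
  shows "f x \<in> pm.span T"
  by (rule span_linear_image[where f = f, OF add scl _ x[unfolded short_span_def]]) (use J S in auto)

lemma short_span_mono: "x \<in> short_span m \<Longrightarrow> m \<le> n \<Longrightarrow> x \<in> short_span n"
  unfolding short_span_def by (erule set_mp[OF pm.span_mono, rotated]) (blast intro: order_less_le_trans)

lemma short_span_minors_mult: "x \<in> short_span n \<Longrightarrow> b \<in> minors q \<Longrightarrow> b * x \<in> short_span n"
  unfolding short_span_def[of n]
  by (rule short_span_linear_image[where f = "\<lambda>x. b * x", unfolded short_span_def])
    (auto simp: distrib_left intro!: pm.span_base dest: J_left,
      metis minors.mult mult.assoc)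

lemma column_span_monom: "x \<in> column_span k \<Longrightarrow> length u < n \<Longrightarrow> x * monom u \<in> short_span (Suc n)"
  unfolding column_span_def short_span_def
proof (rule span_linear_image[where f = "\<lambda>x. x * monom u", rotated 3])
  fix x assume x: "x \<in> J \<union> {b * vgen i k | b i. b \<in> minors q}" and u: "length u < n"
  show "x * monom u \<in> pm.span (J \<union> {b * monom u | b u. b \<in> minors q \<and> length u < Suc n})"
  proof (cases "x \<in> J")
    case False
    with x obtain b i where "x = b * vgen i k" "b \<in> minors q" by auto
    with u show ?thesis
      by (auto intro!: pm.span_base exI[of _ b] exI[of _ "(i, k) # u"] simp: vgen_def mult.assoc simp flip: monom_Cons)
  qed (auto intro!: pm.span_base J_right)
qed (simp_all add: distrib_right)

lemma short_span_vgen_mult: "x \<in> short_span n \<Longrightarrow> vgen i k * x \<in> short_span (Suc n)"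
  unfolding short_span_def[of "Suc n"]
proof (rule short_span_linear_image[where f = "\<lambda>x. vgen i k * x"])
  fix b :: "'i doublets" and u :: "('i \<times> bool) list"
  assume "b \<in> minors q" "length u < n"
  then show "vgen i k * (b * monom u) \<in> pm.span (J \<union> {b * monom u | b u. b \<in> minors q \<and> length u < Suc n})"
    using column_span_monom[OF vgen_minors] by (simp add: short_span_def flip: mult.assoc)
qed (auto simp: distrib_left intro!: pm.span_base J_left)

text \<open>The word with rows \<open>I\<close> whose first \<open>r\<close> letters are in column 1 and the remaining ones in column 2.\<close>

fun sorted_word :: "'i list \<Rightarrow> nat \<Rightarrow> 'i doublets" where
  "sorted_word [] r = 1"
| "sorted_word (i # I) 0 = vgen i True * sorted_word I 0"
| "sorted_word (i # I) (Suc r) = vgen i False * sorted_word I r"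

lemma sorted_word_monom: "\<exists>u. length u = length I \<and> sorted_word I r = monom u"
proof (induction I r rule: sorted_word.induct)
  case (2 i I)
  then obtain u where "length u = length I" "sorted_word I 0 = monom u" by auto
  then show ?case by (intro exI[of _ "(i, True) # u"]) (simp add: vgen_def flip: monom_Cons)
next
  case (3 i I r)
  then obtain u where "length u = length I" "sorted_word I r = monom u" by auto
  then show ?case by (intro exI[of _ "(i, False) # u"]) (simp add: vgen_def flip: monom_Cons)
qed (simp add: single_empty)

lemma sorted_word_short_span: "b \<in> minors q \<Longrightarrow> length I < n \<Longrightarrow> b * sorted_word I r \<in> short_span n"
  using sorted_word_monom[of I r] monom_short_span by metis

text \<open>Moving a letter of column 2 to the right past one letter of column 1 costs a factor \<open>q\<^sup>-\<^sup>1\<close> and a minor,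
which is absorbed in the coefficients and leaves a word that is shorter by two letters. Only the column indices
move; the rows keep their order.\<close>

lemma vgen_sorted_word:
  "r \<le> length I \<Longrightarrow> vgen i True * sorted_word I r - scal (inverse q ^ r) (sorted_word (i # I) r) \<in> short_span (Suc (length I))"
proof (induction I r arbitrary: i rule: sorted_word.induct)
  case (3 j I r)
  let ?e = "vgen j True * sorted_word I r - scal (inverse q ^ r) (sorted_word (j # I) r)"
  have "?e \<in> short_span (Suc (length I))" using 3(1)[of j] 3(2) by simp
  then have "scal (inverse q) (vgen i False * ?e - minor q i j * sorted_word I r) \<in> short_span (Suc (Suc (length I)))"
    by (rule short_span_scal[OF short_span_diff[OF short_span_vgen_mult sorted_word_short_span[OF minors.minor]]]) auto
  also have "scal (inverse q) (vgen i False * ?e - minor q i j * sorted_word I r)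
    = vgen i True * sorted_word (j # I) (Suc r) - scal (inverse q ^ Suc r) (sorted_word (i # j # I) (Suc r))"
    using q0 by (simp add: minor_def algebra_simps pm.scale_right_diff_distrib)
  finally show ?case by simp
qed (simp_all add: short_span_zero)

text \<open>The coefficients by which lowering and raising act on the leading terms of sorted words: variants of the
quantum integers \<open>[r]\<close> and \<open>[n - r]\<close>, defined by the recursions in which they arise. The second argument
of \<open>up_coeff\<close> is the length of the word.\<close>

fun down_coeff :: "nat \<Rightarrow> complex" where
  "down_coeff 0 = 0"
| "down_coeff (Suc r) = q * down_coeff r + inverse q ^ r"

fun up_coeff :: "nat \<Rightarrow> nat \<Rightarrow> complex" where
  "up_coeff r 0 = 0"
| "up_coeff 0 (Suc n) = inverse q * inverse q * up_coeff 0 n + 1"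
| "up_coeff (Suc r) (Suc n) = q * up_coeff r n"

text \<open>Up to a power of \<open>q\<close> the coefficients are sums of even powers of the real number \<open>q\<close>, the constant term being \<open>1\<close>; these sums are positive.\<close>

lemma down_coeff_nonzero: "down_coeff (Suc r) \<noteq> 0"
proof -
  obtain a where a: "q = complex_of_real a" "a \<noteq> 0" using q_real q0 by (auto elim: Reals_cases)
  have aa: "a * a > 0" "inverse a * inverse a > 0"
    using a(2) by (auto simp: zero_less_mult_iff neq_iff)
  have "\<exists>x>0. q ^ r * down_coeff (Suc r) = complex_of_real x" for r
  proof (induction r)
    case (Suc r)
    then obtain x where x: "x > 0" "q ^ r * down_coeff (Suc r) = complex_of_real x" by auto
    have "q ^ Suc r * down_coeff (Suc (Suc r)) = q * q * (q ^ r * down_coeff (Suc r)) + (q * inverse q) ^ Suc r"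
      by (simp add: algebra_simps power_mult_distrib del: down_coeff.simps) (simp add: algebra_simps)
    also have "\<dots> = complex_of_real (a * a * x + 1)"
      unfolding x(2) using q0 by (simp add: a(1))
    finally show ?case using x(1) aa by (intro exI[of _ "a * a * x + 1"]) (simp add: add_pos_pos mult_pos_pos)
  qed (auto intro!: exI[of _ 1])
  from this[of r] show ?thesis using q0 by auto
qed

lemma up_coeff_nonzero: "r \<le> n \<Longrightarrow> up_coeff r (Suc n) \<noteq> 0"
proof (induction r arbitrary: n)
  case 0
  obtain a where a: "q = complex_of_real a" "a \<noteq> 0" using q_real q0 by (auto elim: Reals_cases)
  have aa: "inverse a * inverse a > 0"
    using a(2) by (auto simp: zero_less_mult_iff neq_iff)
  have "\<exists>x>0. up_coeff 0 (Suc n) = complex_of_real x" for n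
  proof (induction n)
    case (Suc n)
    then obtain x where x: "x > 0" "up_coeff 0 (Suc n) = complex_of_real x" by auto
    have "up_coeff 0 (Suc (Suc n)) = complex_of_real (inverse a * inverse a * x + 1)"
      by (subst up_coeff.simps(2), subst x(2)) (simp add: a(1))
    moreover have "inverse a * inverse a * x + 1 > 0" using mult_pos_pos[OF aa x(1)] by (simp add: add_pos_pos)
    ultimately show ?case by blast
  qed (auto intro!: exI[of _ 1])
  from this[of n] show ?case by auto
next
  case (Suc r)
  then obtain n' where "n = Suc n'" by (cases n) auto
  with Suc show ?case using q0 by simp
qed

lemma twisted_deriv_sorted_word_down:
  "r \<le> length I \<Longrightarrow> twisted_deriv q 1 0 (sorted_word I r) - scal (down_coeff r) (sorted_word I (r - 1)) \<in> short_span (length I)"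
proof (induction I r rule: sorted_word.induct)
  case (1 r)
  then show ?case by (simp add: short_span_zero)
next
  case (2 i I)
  from 2 have "twisted_deriv q 1 0 (sorted_word I 0) \<in> short_span (length I)" by simp
  then have "scal (inverse q) (vgen i True * twisted_deriv q 1 0 (sorted_word I 0)) \<in> short_span (Suc (length I))"
    by (intro short_span_scal short_span_vgen_mult)
  then show ?case by (simp add: twisted_deriv_mult weight_op_vgen twisted_deriv_vgen)
next
  case (3 i I r)
  let ?e = "twisted_deriv q 1 0 (sorted_word I r) - scal (down_coeff r) (sorted_word I (r - 1))"
  let ?s = "vgen i True * sorted_word I r - scal (inverse q ^ r) (sorted_word (i # I) r)"
  have e: "scal q (vgen i False * ?e) + ?s \<in> short_span (Suc (length I))"
    using 3 by (intro short_span_add short_span_scal short_span_vgen_mult vgen_sorted_word) auto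
  (* for r = 0 the truncated subtraction gives the wrong word, with coefficient 0 *)
  have s: "down_coeff r = 0 \<or> vgen i False * sorted_word I (r - Suc 0) = sorted_word (i # I) r"
    by (cases r) simp_all
  have "scal q (vgen i False * ?e) + ?s
      = twisted_deriv q 1 0 (sorted_word (i # I) (Suc r)) - scal (down_coeff (Suc r)) (sorted_word (i # I) r)"
    using s by (auto simp: twisted_deriv_mult weight_op_vgen twisted_deriv_vgen right_diff_distrib pm.scale_right_diff_distrib
        pm.scale_left_distrib simp del: sorted_word.simps(2))
  with e show ?case by simp
qed

lemma twisted_deriv_sorted_word_up:
  "r \<le> length I \<Longrightarrow> twisted_deriv q 0 1 (sorted_word I r) - scal (up_coeff r (length I)) (sorted_word I (Suc r)) \<in> short_span (length I)"
proof (induction I r rule: sorted_word.induct)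
  case (1 r)
  then show ?case by (simp add: short_span_zero)
next
  case (2 i I)
  let ?e = "twisted_deriv q 0 1 (sorted_word I 0) - scal (up_coeff 0 (length I)) (sorted_word I 1)"
  let ?s = "vgen i True * sorted_word I 1 - scal (inverse q ^ 1) (sorted_word (i # I) 1)"
  have s: "scal (up_coeff 0 (length I)) ?s \<in> short_span (Suc (length I))"
  proof (cases I)
    case Cons
    then show ?thesis by (intro short_span_scal vgen_sorted_word) auto
  qed (simp add: short_span_zero)
  then have "scal (inverse q) (vgen i True * ?e + scal (up_coeff 0 (length I)) ?s) \<in> short_span (Suc (length I))"
    using 2 by (intro short_span_add short_span_scal short_span_vgen_mult s) auto
  also have "scal (inverse q) (vgen i True * ?e + scal (up_coeff 0 (length I)) ?s)
      = twisted_deriv q 0 1 (sorted_word (i # I) 0) - scal (up_coeff 0 (Suc (length I))) (sorted_word (i # I) 1)"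
    by (simp add: twisted_deriv_mult weight_op_vgen twisted_deriv_vgen right_diff_distrib pm.scale_right_diff_distrib
        pm.scale_left_distrib algebra_simps)
  finally show ?case by simp
next
  case (3 i I r)
  let ?e = "twisted_deriv q 0 1 (sorted_word I r) - scal (up_coeff r (length I)) (sorted_word I (Suc r))"
  have "scal q (vgen i False * ?e) \<in> short_span (Suc (length I))"
    using 3 by (intro short_span_scal short_span_vgen_mult) auto
  also have "scal q (vgen i False * ?e)
      = twisted_deriv q 0 1 (sorted_word (i # I) (Suc r)) - scal (up_coeff (Suc r) (Suc (length I))) (sorted_word (i # I) (Suc (Suc r)))"
    by (simp add: twisted_deriv_mult weight_op_vgen twisted_deriv_vgen right_diff_distrib pm.scale_right_diff_distrib)
  finally show ?case by simp
qed

lemma word_deriv_short_span: "length u < n \<Longrightarrow> word_deriv q g h u \<in> short_span n"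
proof (induction u arbitrary: n)
  case (Cons a u)
  obtain i k where a: "a = (i, k)" by (cases a)
  obtain n' where n: "n = Suc n'" "length u < n'" using Cons.prems by (cases n) auto
  have "monom u \<in> short_span n'" using monom_short_span[OF minors_one n(2)] by simp
  then show ?case using Cons.IH[OF n(2)] unfolding n(1)
    by (auto simp: a intro!: short_span_add short_span_scal short_span_vgen_mult)
qed (simp add: short_span_zero)

lemma twisted_deriv_short_span: "x \<in> short_span n \<Longrightarrow> twisted_deriv q g h x \<in> short_span n"
  unfolding short_span_def[of n]
proof (rule short_span_linear_image[where f = "twisted_deriv q g h"])
  fix b :: "'i doublets" and u :: "('i \<times> bool) list"
  assume "b \<in> minors q" "length u < n"
  then have "b * word_deriv q g h u \<in> short_span n" by (intro short_span_minors_mult word_deriv_short_span)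
  then show "twisted_deriv q g h (b * monom u) \<in> pm.span (J \<union> {b * monom u | b u. b \<in> minors q \<and> length u < n})"
    using \<open>b \<in> minors q\<close> by (simp add: twisted_deriv_minors_mult q0 twisted_deriv_single short_span_def)
qed (auto intro!: pm.span_base D_J simp: short_span_def)

lemma twisted_deriv_down_up:
  assumes "b \<in> minors q" "length I = n" "r \<le> n" "r \<noteq> 0"
  shows "twisted_deriv q 0 1 (twisted_deriv q 1 0 (b * sorted_word I r)) - scal (down_coeff r * up_coeff (r - 1) n) (b * sorted_word I r) \<in> short_span n"
proof -
  let ?e = "twisted_deriv q 1 0 (sorted_word I r) - scal (down_coeff r) (sorted_word I (r - 1))"
  let ?f = "twisted_deriv q 0 1 (sorted_word I (r - 1)) - scal (up_coeff (r - 1) n) (sorted_word I r)"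
  have e: "?e \<in> short_span n" using twisted_deriv_sorted_word_down[of r I] assms by simp
  have f: "?f \<in> short_span n" using twisted_deriv_sorted_word_up[of "r - 1" I] assms by simp
  have "b * (twisted_deriv q 0 1 ?e + scal (down_coeff r) ?f) \<in> short_span n"
    by (intro short_span_minors_mult short_span_add short_span_scal twisted_deriv_short_span e f assms)
  also have "b * (twisted_deriv q 0 1 ?e + scal (down_coeff r) ?f)
    = twisted_deriv q 0 1 (twisted_deriv q 1 0 (b * sorted_word I r)) - scal (down_coeff r * up_coeff (r - 1) n) (b * sorted_word I r)"
    by (simp add: twisted_deriv_minors_mult[OF assms(1) q0] algebra_simps pm.scale_right_diff_distrib)
  finally show ?thesis .
qed

lemma twisted_deriv_up_down:
  assumes "b \<in> minors q" "length I = Suc n"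
  shows "twisted_deriv q 1 0 (twisted_deriv q 0 1 (b * sorted_word I 0)) - scal (up_coeff 0 (Suc n)) (b * sorted_word I 0) \<in> short_span (Suc n)"
proof -
  let ?e = "twisted_deriv q 0 1 (sorted_word I 0) - scal (up_coeff 0 (Suc n)) (sorted_word I 1)"
  let ?f = "twisted_deriv q 1 0 (sorted_word I 1) - scal 1 (sorted_word I 0)"
  have e: "?e \<in> short_span (Suc n)" using twisted_deriv_sorted_word_up[of 0 I] assms by simp
  have f: "?f \<in> short_span (Suc n)" using twisted_deriv_sorted_word_down[of 1 I] assms by simp
  have "b * (twisted_deriv q 1 0 ?e + scal (up_coeff 0 (Suc n)) ?f) \<in> short_span (Suc n)"
    by (intro short_span_minors_mult short_span_add short_span_scal twisted_deriv_short_span e f assms)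
  also have "b * (twisted_deriv q 1 0 ?e + scal (up_coeff 0 (Suc n)) ?f)
    = twisted_deriv q 1 0 (twisted_deriv q 0 1 (b * sorted_word I 0)) - scal (up_coeff 0 (Suc n)) (b * sorted_word I 0)"
    by (simp add: twisted_deriv_minors_mult[OF assms(1) q0] algebra_simps pm.scale_right_diff_distrib del: up_coeff.simps)
  finally show ?thesis .
qed

text \<open>A refinement of the filtration by length: in the top length only sorted words with at most \<open>r\<close> letters in column 1 are allowed.\<close>

definition filtration :: "nat \<Rightarrow> nat \<Rightarrow> 'i doublets set" where
  "filtration n r = pm.span (short_span n \<union> {b * sorted_word I s | b I s. b \<in> minors q \<and> length I = n \<and> s \<le> r})"

lemma short_span_filtration: "x \<in> short_span n \<Longrightarrow> x \<in> filtration n r"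
  unfolding filtration_def by (rule pm.span_base) auto

lemma sorted_word_filtration: "b \<in> minors q \<Longrightarrow> length I = n \<Longrightarrow> s \<le> r \<Longrightarrow> b * sorted_word I s \<in> filtration n r"
  unfolding filtration_def by (rule pm.span_base) auto

lemma filtration_diff: "x \<in> filtration n r \<Longrightarrow> y \<in> filtration n r \<Longrightarrow> x - y \<in> filtration n r"
  and filtration_scal: "x \<in> filtration n r \<Longrightarrow> scal c x \<in> filtration n r"
  and filtration_add: "x \<in> filtration n r \<Longrightarrow> y \<in> filtration n r \<Longrightarrow> x + y \<in> filtration n r"
  unfolding filtration_def by (auto intro: pm.span_diff pm.span_scale pm.span_add)

lemma column_span_sorted_word:
  assumes "x \<in> column_span k" "length I = n" "s \<le> n"
  shows "x * sorted_word I s \<in> filtration (Suc n) (Suc n)"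
  unfolding filtration_def
proof (rule span_linear_image[where f = "\<lambda>x. x * sorted_word I s", rotated 3])
  show "x \<in> pm.span (J \<union> {b * vgen i k | b i. b \<in> minors q})" using assms by (simp add: column_span_def)
  fix x assume "x \<in> J \<union> {b * vgen i k | b i. b \<in> minors q}"
  then consider "x \<in> J" | b i where "x = b * vgen i k" "b \<in> minors q" by auto
  then have "x * sorted_word I s \<in> filtration (Suc n) (Suc n)"
  proof cases
    case 1
    then show ?thesis by (simp add: short_span_filtration J_short_span J_right)
  next
    case (2 b i)
    show ?thesis
    proof (cases k)
      case False
      then have "x * sorted_word I s = b * sorted_word (i # I) (Suc s)" using 2 by (simp add: mult.assoc)
      then show ?thesis using assms 2 sorted_word_filtration[of b "i # I" "Suc n" "Suc s" "Suc n"] by simp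
    next
      case True
      have "b * (vgen i True * sorted_word I s - scal (inverse q ^ s) (sorted_word (i # I) s)) + scal (inverse q ^ s) (b * sorted_word (i # I) s)
          \<in> filtration (Suc n) (Suc n)"
        using assms 2 vgen_sorted_word[of s I] by (intro filtration_add filtration_scal sorted_word_filtration short_span_filtration short_span_minors_mult) auto
      then show ?thesis using 2 True by (simp add: algebra_simps)
    qed
  qed
  then show "x * sorted_word I s \<in> pm.span (short_span (Suc n) \<union> {b * sorted_word I s' | b I s'. b \<in> minors q \<and> length I = Suc n \<and> s' \<le> Suc n})"
    by (simp add: filtration_def)
qed (simp_all add: distrib_right)

lemma monom_filtration: "length u = n \<Longrightarrow> monom u \<in> filtration n n"
proof (induction u arbitrary: n)
  case Nil
  then show ?case using sorted_word_filtration[OF minors_one, of "[]" 0 0 0] by (simp add: single_empty)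
next
  case (Cons a u)
  obtain i k where a: "a = (i, k)" by (cases a)
  obtain m where m: "n = Suc m" "length u = m" using Cons.prems by (cases n) auto
  have "vgen i k * monom u \<in> filtration n n"
    unfolding filtration_def
  proof (rule span_linear_image[where f = "\<lambda>x. vgen i k * x", rotated 3])
    show "monom u \<in> pm.span (short_span m \<union> {b * sorted_word I s | b I s. b \<in> minors q \<and> length I = m \<and> s \<le> m})"
      using Cons.IH[OF m(2)] by (simp add: filtration_def)
    fix x assume x: "x \<in> short_span m \<union> {b * sorted_word I s | b I s. b \<in> minors q \<and> length I = m \<and> s \<le> m}"
    have "vgen i k * x \<in> filtration n n"
    proof (cases "x \<in> short_span m")
      case True
      then show ?thesis using m by (simp add: short_span_filtration short_span_vgen_mult)
    next
      case False
      then obtain b I s where "x = b * sorted_word I s" "b \<in> minors q" "length I = m" "s \<le> m" using x by auto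
      then show ?thesis using column_span_sorted_word[OF vgen_minors, of b I m s i k] m by (simp add: mult.assoc)
    qed
    then show "vgen i k * x \<in> pm.span (short_span n \<union> {b * sorted_word I s | b I s. b \<in> minors q \<and> length I = n \<and> s \<le> n})"
      by (simp add: filtration_def)
  qed (simp_all add: distrib_left)
  then show ?case by (simp add: a vgen_def flip: monom_Cons)
qed

lemma minors_mult_filtration: "x \<in> filtration n r \<Longrightarrow> b \<in> minors q \<Longrightarrow> b * x \<in> filtration n r"
  unfolding filtration_def
  by (rule span_linear_image[where f = "\<lambda>x. b * x"])
    (auto simp: distrib_left intro!: pm.span_base dest: short_span_minors_mult,
      metis minors.mult mult.assoc)

lemma short_span_Suc_filtration: "x \<in> short_span (Suc n) \<Longrightarrow> x \<in> filtration n n"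
  unfolding filtration_def
proof (rule short_span_linear_image[where f = "\<lambda>x. x"])
  fix b :: "'i doublets" and u :: "('i \<times> bool) list"
  assume b: "b \<in> minors q" and u: "length u < Suc n"
  have "b * monom u \<in> filtration n n"
  proof (cases "length u = n")
    case False
    then show ?thesis using u b by (intro short_span_filtration monom_short_span) auto
  qed (simp add: b minors_mult_filtration monom_filtration)
  then show "b * monom u \<in> pm.span (short_span n \<union> {b * sorted_word I s | b I s. b \<in> minors q \<and> length I = n \<and> s \<le> n})"
    by (simp add: filtration_def)
qed (auto intro!: pm.span_base J_short_span)

lemma ex_filtration: "\<exists>n. x \<in> short_span n"
proof (induction x rule: single_induct)
  case (add f g)
  then obtain m n where "f \<in> short_span m" "g \<in> short_span n" by auto
  then have "f + g \<in> short_span (max m n)" by (intro short_span_add) (auto elim: short_span_mono)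
  then show ?case ..
next
  case (single u c)
  have "scal c (1 * monom u) \<in> short_span (Suc (length u))" by (intro short_span_scal monom_short_span minors_one) auto
  then show ?case by auto
qed (auto intro: short_span_zero)

text \<open>Lowering followed by raising multiplies the leading words with \<open>r + 1\<close> letters in column 1 by a nonzero number and
kills \<open>f\<close>. So these words can be eliminated from \<open>f\<close>.\<close>

lemma invariant_filtration_step:
  assumes f: "f \<in> filtration n (Suc r)" and r: "Suc r \<le> n" and inv: "twisted_deriv q 1 0 f \<in> J"
  shows "f \<in> filtration n r"
proof -
  let ?c = "down_coeff (Suc r) * up_coeff r n"
  have "twisted_deriv q 0 1 (twisted_deriv q 1 0 f) - scal ?c f \<in> filtration n r"
    unfolding filtration_def
  proof (rule span_linear_image[where f = "\<lambda>f. twisted_deriv q 0 1 (twisted_deriv q 1 0 f) - scal ?c f", rotated 3])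
    show "f \<in> pm.span (short_span n \<union> {b * sorted_word I s | b I s. b \<in> minors q \<and> length I = n \<and> s \<le> Suc r})"
      using f by (simp add: filtration_def)
    fix x assume x: "x \<in> short_span n \<union> {b * sorted_word I s | b I s. b \<in> minors q \<and> length I = n \<and> s \<le> Suc r}"
    have "twisted_deriv q 0 1 (twisted_deriv q 1 0 x) - scal ?c x \<in> filtration n r"
    proof (cases "x \<in> short_span n")
      case True
      then show ?thesis by (intro short_span_filtration short_span_diff short_span_scal twisted_deriv_short_span)
    next
      case False
      then obtain b I s where bIs: "x = b * sorted_word I s" "b \<in> minors q" "length I = n" "s \<le> Suc r" using x by auto
      consider "s = Suc r" | "s \<le> r" "s \<noteq> 0" | "s = 0" using bIs(4) by linarith
      then show ?thesis
      proof cases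
        case 1
        then show ?thesis using twisted_deriv_down_up[of b I n "Suc r"] bIs r by (simp add: short_span_filtration)
      next
        case 2
        have x_in: "x \<in> filtration n r" using bIs 2 by (auto intro: sorted_word_filtration)
        have "twisted_deriv q 0 1 (twisted_deriv q 1 0 x) - scal (down_coeff s * up_coeff (s - 1) n) x \<in> filtration n r"
          unfolding bIs(1) by (rule short_span_filtration[OF twisted_deriv_down_up]) (use bIs 2 r in auto)
        from filtration_diff[OF filtration_add[OF this filtration_scal[OF x_in, of "down_coeff s * up_coeff (s - 1) n"]] filtration_scal[OF x_in, of ?c]]
        show ?thesis by simp
      next
        case 3
        then have "twisted_deriv q 1 0 x \<in> short_span n"
          using twisted_deriv_sorted_word_down[of 0 I] bIs by (simp add: twisted_deriv_minors_mult q0 short_span_minors_mult)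
        then show ?thesis using 3 bIs by (intro filtration_diff filtration_scal) (auto simp: short_span_filtration sorted_word_filtration twisted_deriv_short_span)
      qed
    qed
    then show "twisted_deriv q 0 1 (twisted_deriv q 1 0 x) - scal ?c x
      \<in> pm.span (short_span n \<union> {b * sorted_word I s | b I s. b \<in> minors q \<and> length I = n \<and> s \<le> r})"
      by (simp add: filtration_def)
  qed (simp_all add: pm.scale_right_distrib pm.scale_right_diff_distrib mult.commute)
  moreover have "twisted_deriv q 0 1 (twisted_deriv q 1 0 f) \<in> filtration n r" by (intro short_span_filtration J_short_span D_J inv)
  ultimately have "twisted_deriv q 0 1 (twisted_deriv q 1 0 f) - (twisted_deriv q 0 1 (twisted_deriv q 1 0 f) - scal ?c f) \<in> filtration n r"
    by (rule filtration_diff[rotated])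
  then have "scal ?c f \<in> filtration n r" by simp
  then have "scal (inverse ?c) (scal ?c f) \<in> filtration n r" by (rule filtration_scal)
  moreover obtain m where "n = Suc m" "r \<le> m" using r by (cases n) auto
  then have "?c \<noteq> 0" using down_coeff_nonzero[of r] up_coeff_nonzero[of r m] by (simp only: mult_eq_0_iff) blast
  then have "inverse ?c * ?c = 1" by (rule left_inverse)
  ultimately show ?thesis by (simp only: pm.scale_scale pm.scale_one)
qed

text \<open>Words without letters in column 1 are killed by lowering. For these raising is applied first.\<close>

lemma invariant_filtration_bottom:
  assumes f: "f \<in> filtration (Suc n) 0" and inv: "twisted_deriv q 0 1 f \<in> J"
  shows "f \<in> short_span (Suc n)"
proof -
  let ?c = "up_coeff 0 (Suc n)"
  have "twisted_deriv q 1 0 (twisted_deriv q 0 1 f) - scal ?c f \<in> short_span (Suc n)"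
    unfolding short_span_def[of "Suc n"]
  proof (rule span_linear_image[where f = "\<lambda>f. twisted_deriv q 1 0 (twisted_deriv q 0 1 f) - scal ?c f", rotated 3])
    show "f \<in> pm.span (short_span (Suc n) \<union> {b * sorted_word I s | b I s. b \<in> minors q \<and> length I = Suc n \<and> s \<le> 0})"
      using f by (simp add: filtration_def)
    fix x assume x: "x \<in> short_span (Suc n) \<union> {b * sorted_word I s | b I s. b \<in> minors q \<and> length I = Suc n \<and> s \<le> 0}"
    have "twisted_deriv q 1 0 (twisted_deriv q 0 1 x) - scal ?c x \<in> short_span (Suc n)"
    proof (cases "x \<in> short_span (Suc n)")
      case True
      then show ?thesis by (intro short_span_diff short_span_scal twisted_deriv_short_span)
    next
      case False
      then show ?thesis using x twisted_deriv_up_down by auto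
    qed
    then show "twisted_deriv q 1 0 (twisted_deriv q 0 1 x) - scal ?c x
      \<in> pm.span (J \<union> {b * monom u | b u. b \<in> minors q \<and> length u < Suc n})"
      by (simp add: short_span_def)
  qed (simp_all add: pm.scale_right_distrib pm.scale_right_diff_distrib mult.commute del: up_coeff.simps)
  moreover have "twisted_deriv q 1 0 (twisted_deriv q 0 1 f) \<in> short_span (Suc n)" by (intro J_short_span D_J inv)
  ultimately have "twisted_deriv q 1 0 (twisted_deriv q 0 1 f) - (twisted_deriv q 1 0 (twisted_deriv q 0 1 f) - scal ?c f) \<in> short_span (Suc n)"
    by (rule short_span_diff[rotated])
  then have "scal ?c f \<in> short_span (Suc n)" by (simp del: up_coeff.simps)
  then have "scal (inverse ?c) (scal ?c f) \<in> short_span (Suc n)" by (rule short_span_scal)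
  then show ?thesis using up_coeff_nonzero[of 0 n] by (simp del: up_coeff.simps)
qed

text \<open>The quantum first fundamental theorem of invariant theory, by descent: for each length the column 1 letters are eliminated
one at a time from above, then the remaining word, until only coefficients of the empty word are left.\<close>

theorem invariants_are_minors:
  assumes inv: "twisted_deriv q 1 0 f \<in> J" "twisted_deriv q 0 1 f \<in> J"
  shows "\<exists>b\<in>minors q. f - b \<in> J"
proof -
  have step: "f \<in> short_span (Suc n)" if "f \<in> short_span (Suc (Suc n))" for n
  proof -
    have "r \<le> Suc n \<Longrightarrow> f \<in> filtration (Suc n) (Suc n - r)" for r
    proof (induction r)
      case 0
      show ?case using short_span_Suc_filtration[OF that] by simp
    next
      case (Suc r)
      then show ?case
        using invariant_filtration_step[of f "Suc n" "Suc n - Suc r"] inv(1) by (simp add: Suc_diff_le)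
    qed
    from this[of "Suc n"] show ?thesis using invariant_filtration_bottom[of f n] inv(2) by simp
  qed
  obtain n where "f \<in> short_span n" using ex_filtration by auto
  then have "f \<in> short_span (Suc n)" by (rule short_span_mono) simp
  then have "f \<in> short_span 1" by (induction n) (auto dest: step)
  then show ?thesis
    unfolding short_span_def
  proof (induction rule: pm.span_induct_alt)
    case base
    show ?case using minors.const[of 0 q] by (intro bexI[of _ 0]) (auto simp: J_zero)
  next
    case (step c x y)
    then obtain b where b: "b \<in> minors q" "y - b \<in> J" by auto
    from step(1) obtain d where d: "d \<in> minors q" "x - d \<in> J"
    proof (cases "x \<in> J")
      case True
      then show ?thesis using that[of 0] minors.const[of 0 q] by simp
    next
      case False
      then show ?thesis using that[of x] step(1) by (auto simp: single_empty J_zero)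
    qed
    have "scal c (x - d) + (y - b) \<in> J" using b d by (intro J_add J_scal)
    then show ?case using b d
      by (intro bexI[of _ "scal c d + b"]) (auto simp: algebra_simps pm.scale_right_diff_distrib intro: minors.add minors_scal)
  qed
qed

end

section \<open>Monoid algebras and their quotients\<close>

lemma keys_induct [consumes 1, case_names zero add single]:
  fixes f :: "'a \<Rightarrow>\<^sub>0 complex"
  assumes "Poly_Mapping.keys f \<subseteq> C" and "P 0"
    and "\<And>f g. Poly_Mapping.keys f \<subseteq> C \<Longrightarrow> Poly_Mapping.keys g \<subseteq> C \<Longrightarrow> P f \<Longrightarrow> P g \<Longrightarrow> P (f + g)"
    and "\<And>u c. u \<in> C \<Longrightarrow> P (Poly_Mapping.single u c)"
  shows "P f"
  using assms(1)
proof (induction f rule: update_induct)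
  case const
  then show ?case using assms(2) by simp
next
  case (update f u c)
  have "Poly_Mapping.update u c f = f + Poly_Mapping.single u c"
    by (rule poly_mapping_eqI) (use update(1) in \<open>auto simp: lookup_update lookup_add lookup_single when_def in_keys_iff\<close>)
  moreover have "Poly_Mapping.keys f \<subseteq> C" "u \<in> C"
    using update(2,4) by (auto simp: keys_update)
  ultimately show ?case using assms(3)[of f "Poly_Mapping.single u c"] assms(4) update(3) by auto
qed

lemma keys_scal: "Poly_Mapping.keys (scal c f) \<subseteq> Poly_Mapping.keys f"
  by (auto simp: in_keys_iff)

lemma linext_keys:
  assumes "\<And>u. u \<in> Poly_Mapping.keys f \<Longrightarrow> Poly_Mapping.keys (\<phi> u) \<subseteq> C"
  shows "Poly_Mapping.keys (linext (\<lambda>c. scal (d c)) \<phi> f) \<subseteq> C"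
proof -
  have "finite U \<Longrightarrow> U \<subseteq> Poly_Mapping.keys f \<Longrightarrow>
      Poly_Mapping.keys (\<Sum>u\<in>U. scal (d (Poly_Mapping.lookup f u)) (\<phi> u)) \<subseteq> C" for U
  proof (induction U rule: finite_induct)
    case (insert u U)
    have "Poly_Mapping.keys (scal (d (Poly_Mapping.lookup f u)) (\<phi> u)) \<subseteq> C"
      using order_trans[OF keys_scal assms] insert.prems by blast
    moreover have "Poly_Mapping.keys (\<Sum>u\<in>U. scal (d (Poly_Mapping.lookup f u)) (\<phi> u)) \<subseteq> C"
      using insert by blast
    ultimately show ?case
      unfolding sum.insert[OF insert.hyps] by (intro order_trans[OF keys_add] Un_least)
  qed simp
  then show ?thesis by (simp add: linext_def)
qed

interpretation conj_space: vector_space "\<lambda>c. scal (cnj c) :: ('a \<Rightarrow>\<^sub>0 complex) \<Rightarrow> _"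
  by unfold_locales (simp_all add: pm.scale_right_distrib pm.scale_left_distrib)

lemma monoid_alg_simps [simp]:
  "carrier (monoid_alg M \<sigma>) = {f. Poly_Mapping.keys f \<subseteq> carrier M}"
  "zero (monoid_alg M \<sigma>) = 0"
  "add (monoid_alg M \<sigma>) = (+)"
  "one (monoid_alg M \<sigma>) = monom \<one>\<^bsub>M\<^esub>"
  "module.smult (monoid_alg M \<sigma>) = scal"
  by (simp_all add: monoid_alg_def scal_def fun_eq_iff)

text \<open>The multiplication of a monoid algebra as an iterated linear extension, which makes its bilinearity evident.\<close>

definition conv :: "('a, 'c) monoid_scheme \<Rightarrow> ('a \<Rightarrow>\<^sub>0 complex) \<Rightarrow> ('a \<Rightarrow>\<^sub>0 complex) \<Rightarrow> ('a \<Rightarrow>\<^sub>0 complex)" where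
  "conv M f g = linext scal (\<lambda>a. linext scal (\<lambda>b. monom (a \<otimes>\<^bsub>M\<^esub> b)) g) f"

lemma monoid_alg_mult [simp]: "mult (monoid_alg M \<sigma>) = conv M"
  by (simp add: monoid_alg_def conv_def linext_def fun_eq_iff pm.scale_sum_right)

lemma monoid_alg_star: "star (monoid_alg M \<sigma>) = linext (\<lambda>c. scal (cnj c)) \<sigma>"
  by (simp add: monoid_alg_def linext_def fun_eq_iff scal_def)

lemma conv_add_left: "conv M (f + f') g = conv M f g + conv M f' g"
  by (simp add: conv_def pm_linext_add)

lemma conv_add_right: "conv M f (g + g') = conv M f g + conv M f g'"
  unfolding conv_def
  by (induction f rule: single_induct)
    (simp_all add: pm_linext_add pm_linext_single pm.scale_right_distrib algebra_simps)

lemma conv_scal_left: "conv M (scal c f) g = scal c (conv M f g)"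
  by (simp add: conv_def pm_linext_scal)

lemma conv_scal_right: "conv M f (scal c g) = scal c (conv M f g)"
  unfolding conv_def
  by (induction f rule: single_induct)
    (simp_all add: pm_linext_add pm_linext_single pm_linext_scal pm.scale_right_distrib mult.commute)

lemma conv_zero [simp]: "conv M 0 g = 0" "conv M f 0 = 0"
  using conv_scal_left[of M 0 0 g] conv_scal_right[of M f 0 0] by simp_all

lemma conv_single [simp]:
  "conv M (Poly_Mapping.single a c) (Poly_Mapping.single b d) = Poly_Mapping.single (a \<otimes>\<^bsub>M\<^esub> b) (c * d)"
  by (simp add: conv_def pm_linext_single)

text \<open>The quotient algebra has the same ring operations as the quotient ring and differs only in its record type.\<close>

lemma ring_transfer:
  assumes R: "ring R" and "carrier S = carrier R" "mult S = mult R" "one S = one R" "zero S = zero R" "add S = add R"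
  shows "ring S"
proof -
  interpret ring R by fact
  show ?thesis
  proof (intro ringI abelian_groupI monoidI)
    fix x assume "x \<in> carrier S"
    then show "\<exists>y\<in>carrier S. y \<oplus>\<^bsub>S\<^esub> x = \<zero>\<^bsub>S\<^esub>"
      unfolding assms(2-) by (rule add.l_inv_ex)
  qed (simp_all only: assms(2-) add.m_closed zero_closed add.m_assoc l_zero m_closed one_closed m_assoc l_one r_one l_distr r_distr, rule a_comm)
qed

locale quot_monoid_alg = monoid M for M :: "('m, 'c) monoid_scheme" (structure) +
  fixes \<sigma> :: "'m \<Rightarrow> 'm \<Rightarrow>\<^sub>0 complex" and Q :: "('m \<Rightarrow>\<^sub>0 complex) set"
  assumes Q_carrier: "Q \<subseteq> carrier (monoid_alg M \<sigma>)"
begin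

abbreviation A where "A \<equiv> monoid_alg M \<sigma>"
abbreviation II where "II \<equiv> Idl\<^bsub>A\<^esub> Q"

lemma conv_keys:
  "Poly_Mapping.keys f \<subseteq> carrier M \<Longrightarrow> Poly_Mapping.keys g \<subseteq> carrier M \<Longrightarrow>
    Poly_Mapping.keys (conv M f g) \<subseteq> carrier M"
  unfolding conv_def by (intro linext_keys[where d = "\<lambda>c. c"]) auto

lemma conv_assoc:
  assumes x: "Poly_Mapping.keys x \<subseteq> carrier M" and y: "Poly_Mapping.keys y \<subseteq> carrier M"
    and z: "Poly_Mapping.keys z \<subseteq> carrier M"
  shows "conv M (conv M x y) z = conv M x (conv M y z)"
  using x
proof (induction x rule: keys_induct)
  case (single a c)
  note a = single
  show ?case using y
  proof (induction y rule: keys_induct)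
    case (single b d)
    note b = single
    show ?case using z
      by (induction z rule: keys_induct) (simp_all add: a b conv_add_right m_assoc mult.assoc)
  qed (simp_all add: conv_add_right conv_add_left)
qed (simp_all add: conv_add_left)

lemma conv_one:
  assumes "Poly_Mapping.keys x \<subseteq> carrier M"
  shows "conv M (monom \<one>) x = x" and "conv M x (monom \<one>) = x"
  using assms by (induction x rule: keys_induct) (simp_all add: conv_add_right conv_add_left)

lemma ring_A: "ring A"
proof (intro ringI abelian_groupI monoidI)
  fix x assume "x \<in> carrier A"
  then have x: "Poly_Mapping.keys x \<subseteq> carrier M" by simp
  have "scal (-1) x \<in> carrier A"
    unfolding monoid_alg_simps mem_Collect_eq by (rule order_trans[OF keys_scal x])
  moreover have "scal (-1) x \<oplus>\<^bsub>A\<^esub> x = \<zero>\<^bsub>A\<^esub>" by simp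
  ultimately show "\<exists>y\<in>carrier A. y \<oplus>\<^bsub>A\<^esub> x = \<zero>\<^bsub>A\<^esub>" by blast
next
  fix x y assume "x \<in> carrier A" "y \<in> carrier A"
  then have xy: "Poly_Mapping.keys x \<subseteq> carrier M" "Poly_Mapping.keys y \<subseteq> carrier M" by simp_all
  show "x \<otimes>\<^bsub>A\<^esub> y \<in> carrier A" using conv_keys[OF xy] by simp
  show "x \<oplus>\<^bsub>A\<^esub> y \<in> carrier A" using order_trans[OF keys_add Un_least[OF xy]] by simp
qed (simp_all add: conv_assoc conv_one conv_add_left conv_add_right add.assoc add.commute)

lemma a_inv_A: "x \<in> carrier A \<Longrightarrow> \<ominus>\<^bsub>A\<^esub> x = - x"
  using keys_scal[of "-1" x] by (intro abelian_group.minus_equality[OF ring.is_abelian_group[OF ring_A]]) auto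

lemma ideal_II: "ideal II A"
  by (rule ring.genideal_ideal[OF ring_A Q_carrier])

lemma II_base: "x \<in> Q \<Longrightarrow> x \<in> II"
  using ring.genideal_self[OF ring_A Q_carrier] by auto

lemma II_carrier: "x \<in> II \<Longrightarrow> Poly_Mapping.keys x \<subseteq> carrier M"
  using ideal.Icarr[OF ideal_II] by fastforce

lemma II_zero: "0 \<in> II"
  using additive_subgroup.zero_closed[OF ideal.axioms(1)[OF ideal_II]] by simp

lemma II_add: "x \<in> II \<Longrightarrow> y \<in> II \<Longrightarrow> x + y \<in> II"
  using additive_subgroup.a_closed[OF ideal.axioms(1)[OF ideal_II], of x y] by simp

lemma II_left: "x \<in> II \<Longrightarrow> Poly_Mapping.keys y \<subseteq> carrier M \<Longrightarrow> conv M y x \<in> II"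
  using ideal.I_l_closed[OF ideal_II, of x y] by simp

lemma II_right: "x \<in> II \<Longrightarrow> Poly_Mapping.keys y \<subseteq> carrier M \<Longrightarrow> conv M x y \<in> II"
  using ideal.I_r_closed[OF ideal_II, of x y] by simp

lemma II_scal: "x \<in> II \<Longrightarrow> scal c x \<in> II"
proof -
  assume x: "x \<in> II"
  then have "conv M (scal c (monom \<one>)) x \<in> II" by (intro II_left) simp_all
  moreover have "conv M (monom \<one>) x = x" using conv_one(1) ideal.Icarr[OF ideal_II x] by simp
  ultimately show ?thesis by (simp only: conv_scal_left)
qed

lemma II_diff: "x \<in> II \<Longrightarrow> y \<in> II \<Longrightarrow> x - y \<in> II"
  using II_add[OF _ II_scal[of y "-1"]] by simp

text \<open>The form in which ideals are recognised below: closure under multiplication by monomials suffices.\<close>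

lemma ideal_by_monomials:
  assumes sub: "N \<subseteq> carrier A" and zero: "0 \<in> N"
    and add: "\<And>x y. x \<in> N \<Longrightarrow> y \<in> N \<Longrightarrow> x + y \<in> N" and neg: "\<And>x. x \<in> N \<Longrightarrow> - x \<in> N"
    and l: "\<And>x a c. x \<in> N \<Longrightarrow> a \<in> carrier M \<Longrightarrow> conv M (Poly_Mapping.single a c) x \<in> N"
    and r: "\<And>x a c. x \<in> N \<Longrightarrow> a \<in> carrier M \<Longrightarrow> conv M x (Poly_Mapping.single a c) \<in> N"
  shows "ideal N A"
proof (rule idealI[OF ring_A])
  have inv: "\<ominus>\<^bsub>A\<^esub> x \<in> N" if x: "x \<in> N" for x
    using a_inv_A[OF subsetD[OF sub x]] neg[OF x] by metis
  show "subgroup N (add_monoid A)"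
  proof (rule group.subgroupI[OF abelian_group.a_group[OF ring.is_abelian_group[OF ring_A]]])
    show "N \<subseteq> carrier (add_monoid A)" using sub by simp
    show "N \<noteq> {}" using zero by auto
    show "inv\<^bsub>add_monoid A\<^esub> x \<in> N" if "x \<in> N" for x using inv[OF that] by (simp only: a_inv_def)
    show "x \<otimes>\<^bsub>add_monoid A\<^esub> y \<in> N" if "x \<in> N" "y \<in> N" for x y using add[OF that] by simp
  qed
  fix a x assume a: "a \<in> N" and x: "x \<in> carrier A"
  then have "Poly_Mapping.keys x \<subseteq> carrier M" by simp
  then have "conv M x a \<in> N \<and> conv M a x \<in> N"
  proof (induction x rule: keys_induct)
    case (add f g)
    then show ?case using assms(3) by (simp only: conv_add_left conv_add_right)
  qed (simp_all only: conv_zero zero l[OF a] r[OF a] simp_thms)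
  then show "x \<otimes>\<^bsub>A\<^esub> a \<in> N" "a \<otimes>\<^bsub>A\<^esub> x \<in> N" by simp_all
qed

lemma cls_def': "cls A Q x = (\<lambda>h. h + x) ` II"
  by (auto simp: cls_def a_r_coset_def r_coset_def)

lemma cls_eq_iff: "cls A Q x = cls A Q y \<longleftrightarrow> x - y \<in> II"
proof
  assume "cls A Q x = cls A Q y"
  then have "0 + x \<in> (\<lambda>h. h + y) ` II" unfolding cls_def' using II_zero by blast
  then show "x - y \<in> II" by auto
next
  assume xy: "x - y \<in> II"
  have "h + x \<in> (\<lambda>h. h + y) ` II" "h + y \<in> (\<lambda>h. h + x) ` II" if "h \<in> II" for h
  proof -
    have "h + x = (h + (x - y)) + y" "h + y = (h - (x - y)) + x" by simp_all
    then show "h + x \<in> (\<lambda>h. h + y) ` II" "h + y \<in> (\<lambda>h. h + x) ` II"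
      using II_add[OF that xy] II_diff[OF that xy] by (blast intro: rev_image_eqI)+
  qed
  then show "cls A Q x = cls A Q y" unfolding cls_def' by blast
qed

abbreviation B where "B \<equiv> quot_alg A Q"

lemma B_simps:
  "carrier B = cls A Q ` carrier A"
  "one B = cls A Q \<one>\<^bsub>A\<^esub>"
  by (auto simp: quot_alg_def Let_def FactRing_def A_RCOSETS_def RCOSETS_def cls_def a_r_coset_def)

lemma zero_B: "zero B = cls A Q 0"
  by (simp add: quot_alg_def Let_def FactRing_simps cls_def')

lemma mult_B: "x \<in> carrier A \<Longrightarrow> y \<in> carrier A \<Longrightarrow> cls A Q x \<otimes>\<^bsub>B\<^esub> cls A Q y = cls A Q (conv M x y)"
  using ideal.rcoset_mult_add[OF ideal_II, of x y] by (simp add: quot_alg_def Let_def FactRing_def cls_def)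

lemma add_B: "x \<in> carrier A \<Longrightarrow> y \<in> carrier A \<Longrightarrow> cls A Q x \<oplus>\<^bsub>B\<^esub> cls A Q y = cls A Q (x + y)"
  using ideal.a_rcos_sum[OF ideal_II, of x y] by (simp add: quot_alg_def Let_def FactRing_def cls_def)

text \<open>Operations acting on representatives are unions over a coset; they are single cosets if the ideal is preserved.\<close>

lemma UN_cls:
  assumes "\<And>y. y \<in> II \<Longrightarrow> f (y + x) - f x \<in> II"
  shows "(\<Union>a\<in>cls A Q x. cls A Q (f a)) = cls A Q (f x)"
proof -
  have "cls A Q (f a) = cls A Q (f x)" if "a \<in> cls A Q x" for a
    using that assms by (auto simp: cls_eq_iff cls_def'[of x])
  moreover have "cls A Q x \<noteq> {}" using II_zero by (auto simp: cls_def')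
  ultimately show ?thesis by blast
qed

lemma smult_B: "c \<odot>\<^bsub>B\<^esub> cls A Q x = cls A Q (scal c x)"
proof -
  have "c \<odot>\<^bsub>B\<^esub> cls A Q x = (\<Union>a\<in>cls A Q x. cls A Q (scal c a))"
    by (simp only: quot_alg_def Let_def module.select_convs star_alg.select_convs monoid_alg_simps)
  also have "\<dots> = cls A Q (scal c x)"
    by (rule UN_cls) (simp add: pm.scale_right_distrib II_scal)
  finally show ?thesis .
qed

lemma star_B:
  assumes "\<And>y. y \<in> II \<Longrightarrow> star A y \<in> II"
  shows "star B (cls A Q x) = cls A Q (star A x)"
proof -
  have "star B (cls A Q x) = (\<Union>a\<in>cls A Q x. cls A Q (star A a))"
    by (simp only: quot_alg_def Let_def module.select_convs star_alg.select_convs)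
  also have "\<dots> = cls A Q (star A x)"
  proof (rule UN_cls)
    fix y assume "y \<in> II"
    have "star A (y + x) = star A y + star A x"
      unfolding monoid_alg_star by (rule linext_add[OF conj_space.vector_space_axioms])
    then show "star A (y + x) - star A x \<in> II" using assms[OF \<open>y \<in> II\<close>] by (metis add_diff_cancel_right')
  qed
  finally show ?thesis .
qed

lemma ring_B: "ring B"
  by (rule ring_transfer[OF ideal.quotient_is_ring[OF ideal_II]]) (simp_all add: quot_alg_def Let_def)

end

section \<open>The R-matrix\<close>

lemma pair_sum_collapse:
  assumes "finite S" and f: "\<And>i j. f i j = (if P \<and> i = a \<and> j = b then x else (0::complex))"
  shows "(\<Sum>(i, j)\<in>S. f i j) = (if (a, b) \<in> S \<and> P then x else 0)"
proof -
  have "(\<Sum>(i, j)\<in>S. f i j) = (\<Sum>p\<in>S. if (a, b) = p then (if P then x else 0) else 0)"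
    unfolding f by (rule sum.cong) (auto split: prod.splits)
  then show ?thesis using assms(1) by (simp add: sum.delta')
qed

lemma finite_idx_pairs: "finite {(i, j). i \<in> {1..4::nat} \<and> j \<in> {1..4::nat} \<and> P i j}"
  by (rule finite_subset[of _ "{1..4} \<times> {1..4}"]) auto

text \<open>At each entry of \<open>R\<close> every one of the defining sums has at most one nonzero term.\<close>

lemma Rmat_closed:
  assumes "a \<in> {1..4}" "b \<in> {1..4}" "c \<in> {1..4}" "d \<in> {1..4}"
  shows "Rmat q a b c d =
    (if a = c \<and> b = d then if a = b then qpow q 1 else if a = 5 - b then qpow q (-1) else 1 else 0)
    + (if a = d \<and> b = c \<and> a > c then qpow q 1 - qpow q (-1) else 0)
    - (if b = 5 - a \<and> d = 5 - c \<and> a > c then (qpow q 1 - qpow q (-1)) * (qpow q (rho a - rho c) * eps a * eps c) else 0)"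
proof -
  have 1: "(\<Sum>i\<in>{1..4}. munit i i i i a b c d) = (if a = c \<and> b = d \<and> a = b then 1 else 0)"
    unfolding sum_idx using assms by (auto simp: munit_def dest!: idx_cases)
  have 2: "(\<Sum>i\<in>{1..4}. munit (5 - i) (5 - i) i i a b c d) = (if a = c \<and> b = d \<and> a = 5 - b then 1 else 0)"
    unfolding sum_idx using assms by (auto simp: munit_def dest!: idx_cases)
  have 3: "(\<Sum>(i, j) \<in> {(i, j). i \<in> {1..4} \<and> j \<in> {1..4} \<and> i \<noteq> j \<and> i \<noteq> 5 - j}. munit i i j j a b c d)
      = (if a = c \<and> b = d \<and> a \<noteq> b \<and> a \<noteq> 5 - b then 1 else 0)"
    by (rule trans[OF pair_sum_collapse[where P = "a = c \<and> b = d" and a = a and b = b and x = 1, OF finite_idx_pairs]])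
      (use assms in \<open>auto simp: munit_def\<close>)
  have 4: "(\<Sum>(i, j) \<in> {(i, j). i \<in> {1..4} \<and> j \<in> {1..4} \<and> i > j}. munit i j j i a b c d)
      = (if a = d \<and> b = c \<and> a > c then 1 else 0)"
    by (rule trans[OF pair_sum_collapse[where P = "a = d \<and> b = c" and a = a and b = c and x = 1, OF finite_idx_pairs]])
      (use assms in \<open>auto simp: munit_def\<close>)
  have 5: "(\<Sum>(i, j) \<in> {(i, j). i \<in> {1..4} \<and> j \<in> {1..4} \<and> i > j}.
      qpow q (rho i - rho j) * eps i * eps j * munit i j (5 - i) (5 - j) a b c d)
      = (if b = 5 - a \<and> d = 5 - c \<and> a > c then qpow q (rho a - rho c) * eps a * eps c else 0)"
    by (rule trans[OF pair_sum_collapse[where P = "b = 5 - a \<and> d = 5 - c" and a = a and b = c and x = "qpow q (rho a - rho c) * eps a * eps c", OF finite_idx_pairs]])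
      (use assms in \<open>auto simp: munit_def\<close>)
  have combine: "x * (if A \<and> B \<and> C then 1 else 0) + (if A \<and> B \<and> \<not> C \<and> \<not> D then 1 else 0)
      + y * (if A \<and> B \<and> D then 1 else 0) + z * (if E then 1 else 0) - z * (if F then w else 0)
    = (if A \<and> B then if C then x else if D then y else 1 else 0) + (if E then z else 0) - (if F then z * w else 0)"
    if "\<not> (C \<and> D)" for x y z w :: complex and A B C D E F
    using that by auto
  have "\<not> (a = b \<and> a = 5 - b)" by presburger
  then show ?thesis unfolding Rmat_def 1 2 3 4 5 by (rule combine)
qed

text \<open>The weights \<open>u\<^sub>i\<close> in terms of which the star sends \<open>T\<^sub>i\<^sup>j\<close> to the multiple by \<open>u\<^sub>i u\<^sub>j\<^sup>-\<^sup>1\<close> of the letter with indices \<open>5 - i\<close> and \<open>5 - j\<close>.\<close>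

definition uw :: "real \<Rightarrow> nat \<Rightarrow> complex" where
  "uw q i = qpow q (rho i) * eps i"

lemma uw_nonzero: "q \<noteq> 0 \<Longrightarrow> uw q i \<noteq> 0"
  by (simp add: uw_def qpow_def eps_def)

lemma uw_flip:
  assumes "q \<noteq> 0" "i \<in> {1..4}" shows "uw q (5 - i) = - inverse (uw q i)"
  using idx_cases[OF assms(2)] assms(1)
  by (elim disjE) (simp_all add: uw_def qpow_def eps_def rho_def power_int_minus)

text \<open>A nonzero entry of \<open>R\<close> either permutes the pair of indices or maps one pair \<open>(i, i')\<close> to another; the product of weights
is the same in the first case and equals \<open>-1\<close> for all such pairs in the second.\<close>

lemma Rmat_weight:
  assumes "q \<noteq> 0" "a \<in> {1..4}" "b \<in> {1..4}" "c \<in> {1..4}" "d \<in> {1..4}"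
  shows "Rmat q a b c d * (uw q c * uw q d) = Rmat q a b c d * (uw q a * uw q b)"
proof (cases "Rmat q a b c d = 0")
  case False
  then consider "a = c \<and> b = d" | "a = d \<and> b = c" | "b = 5 - a" "d = 5 - c"
    unfolding Rmat_closed[OF assms(2-)] by (auto split: if_splits)
  then have "uw q c * uw q d = uw q a * uw q b"
    by cases (use assms in \<open>auto simp: uw_flip uw_nonzero\<close>)
  then show ?thesis by simp
qed simp

text \<open>The symmetry of \<open>R\<close> under which the star reverses the order of factors in the relations.\<close>

lemma Rmat_flip:
  assumes "a \<in> {1..4}" "b \<in> {1..4}" "c \<in> {1..4}" "d \<in> {1..4}"
  shows "Rmat q (5 - b) (5 - a) (5 - d) (5 - c) = Rmat q a b c d"
proof -
  have f: "5 - i \<in> {1..4}" if "i \<in> {1..4}" for i :: nat using that by auto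
  have 1: "5 - b = 5 - d \<and> 5 - a = 5 - c \<longleftrightarrow> a = c \<and> b = d" "5 - b = 5 - a \<longleftrightarrow> a = b"
      "5 - b = 5 - (5 - a) \<longleftrightarrow> a = 5 - b"
      "5 - b = 5 - c \<and> 5 - a = 5 - d \<and> 5 - b > 5 - d \<longleftrightarrow> a = d \<and> b = c \<and> a > c"
      "5 - a = 5 - (5 - b) \<and> 5 - c = 5 - (5 - d) \<and> 5 - b > 5 - d \<longleftrightarrow> b = 5 - a \<and> d = 5 - c \<and> a > c"
    using assms by auto
  have 2: "(if b = 5 - a \<and> d = 5 - c \<and> a > c then x * (qpow q (rho (5 - b) - rho (5 - d)) * eps (5 - b) * eps (5 - d)) else 0)
      = (if b = 5 - a \<and> d = 5 - c \<and> a > c then x * (qpow q (rho a - rho c) * eps a * eps c) else 0)" for x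
    using assms by auto
  show ?thesis
    unfolding Rmat_closed[OF assms] Rmat_closed[OF f f f f, OF assms(2,1,4,3)] 1 2 ..
qed

section \<open>Free star-algebras\<close>

lemma word_monoid_simps [simp]:
  "carrier (word_monoid G) = lists G" "x \<otimes>\<^bsub>word_monoid G\<^esub> y = x @ y" "\<one>\<^bsub>word_monoid G\<^esub> = []"
  by (simp_all add: word_monoid_def)

lemma monoid_word_monoid: "monoid (word_monoid G)"
  by (rule monoidI) auto

lemma conv_word_monoid: "conv (word_monoid G) f g = f * g"
proof (induction f rule: single_induct)
  case (single u c)
  show ?case
    by (induction g rule: single_induct)
      (simp_all add: conv_add_right distrib_left mult_single plus_list_def)
qed (simp_all add: conv_add_left distrib_right)

definition free_star :: "('g \<Rightarrow> 'g list \<Rightarrow>\<^sub>0 complex) \<Rightarrow> ('g list \<Rightarrow>\<^sub>0 complex) \<Rightarrow> ('g list \<Rightarrow>\<^sub>0 complex)" where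
  "free_star s = linext (\<lambda>c. scal (cnj c)) (\<lambda>w. foldr (\<lambda>g f. f * s g) w 1)"

lemma free_star_alg_monoid_alg:
  "free_star_alg G s = monoid_alg (word_monoid G) (\<lambda>w. foldr (\<lambda>g f. f * s g) w 1)"
  unfolding free_star_alg_def monoid_alg_mult conv_word_monoid single_empty ..

lemma star_free_star_alg: "star (free_star_alg G s) = free_star s"
  by (simp add: free_star_alg_monoid_alg monoid_alg_star free_star_def)

lemma free_star_add: "free_star s (f + g) = free_star s f + free_star s g"
  unfolding free_star_def by (rule linext_add[OF conj_space.vector_space_axioms])

lemma free_star_diff: "free_star s (f - g) = free_star s f - free_star s g"
  unfolding free_star_def by (rule linext_diff[OF conj_space.vector_space_axioms])

lemma free_star_zero: "free_star s 0 = 0"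
  by (simp add: free_star_def)

lemma free_star_sum: "free_star s (sum f A) = (\<Sum>a\<in>A. free_star s (f a))"
  by (induction A rule: infinite_finite_induct) (simp_all add: free_star_zero free_star_add)

lemma free_star_single: "free_star s (Poly_Mapping.single w c) = scal (cnj c) (foldr (\<lambda>g f. f * s g) w 1)"
  unfolding free_star_def by (rule linext_single[OF conj_space.vector_space_axioms])

lemma free_star_letter: "free_star s (Poly_Mapping.single [g] c) = scal (cnj c) (s g)"
  by (simp add: free_star_single)

lemma free_star_scal: "free_star s (scal c f) = scal (cnj c) (free_star s f)"
  unfolding free_star_def by (rule linext_scal[OF conj_space.vector_space_axioms])

lemma foldr_star_append:
  "foldr (\<lambda>g f. f * s g) (u @ w) 1 = foldr (\<lambda>g f. f * s g) w 1 * foldr (\<lambda>g f. f * (s g :: 'a list \<Rightarrow>\<^sub>0 complex)) u 1"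
  by (induction u) (simp_all add: mult.assoc)

lemma free_star_mult: "free_star s (f * g) = free_star s g * free_star s f"
proof (induction f rule: single_induct)
  case (single u c)
  show ?case
  proof (induction g rule: single_induct)
    case (single w d)
    show ?case by (simp add: mult_single plus_list_def free_star_single foldr_star_append mult.commute del: foldr_append)
  qed (simp_all add: distrib_left distrib_right free_star_add free_star_zero)
qed (simp_all add: distrib_left distrib_right free_star_add free_star_zero)

lemma keys_sum_subset:
  assumes "\<And>a. a \<in> A \<Longrightarrow> Poly_Mapping.keys (f a :: 'a \<Rightarrow>\<^sub>0 complex) \<subseteq> C"
  shows "Poly_Mapping.keys (sum f A) \<subseteq> C"
  using assms
proof (induction A rule: infinite_finite_induct)
  case (insert a A)
  then show ?case
    unfolding sum.insert[OF insert.hyps] by (intro order_trans[OF keys_add] Un_least) auto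
qed auto

lemma keys_diff_subset:
  assumes "Poly_Mapping.keys f \<subseteq> C" "Poly_Mapping.keys (g :: 'a \<Rightarrow>\<^sub>0 complex) \<subseteq> C"
  shows "Poly_Mapping.keys (f - g) \<subseteq> C"
proof -
  have "f - g = f + scal (-1) g" by simp
  then show ?thesis using assms order_trans[OF keys_scal assms(2)] by (simp only:) (intro order_trans[OF keys_add] Un_least)
qed

lemma keys_single_subset: "(c \<noteq> 0 \<Longrightarrow> u \<in> C) \<Longrightarrow> Poly_Mapping.keys (Poly_Mapping.single u c) \<subseteq> C"
  by simp

lemma Sp_rels_keys:
  assumes "x \<in> Sp_rels q" shows "Poly_Mapping.keys x \<subseteq> lists ({1..4} \<times> {1..4})"
  using assms unfolding Sp_rels_def
  by (elim UnE CollectE exE conjE, simp_all only:)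
    (intro keys_sum_subset keys_diff_subset keys_single_subset, (simp; fail)+)+


section \<open>Star-invariance of the symplectic relations\<close>

abbreviation TT :: "nat \<Rightarrow> nat \<Rightarrow> (nat \<times> nat) list \<Rightarrow>\<^sub>0 complex" where
  "TT i j \<equiv> monom [(i, j)]"

definition Sp_word_star :: "real \<Rightarrow> (nat \<times> nat) list \<Rightarrow> (nat \<times> nat) list \<Rightarrow>\<^sub>0 complex" where
  "Sp_word_star q = (\<lambda>w. foldr (\<lambda>g f. f * (\<lambda>(i, j). antip q j i) g) w 1)"

interpretation SpA: quot_monoid_alg "word_monoid ({1..4::nat} \<times> {1..4::nat})" "Sp_word_star q" "Sp_rels q"
  for q :: real
proof (intro quot_monoid_alg.intro quot_monoid_alg_axioms.intro monoid_word_monoid subsetI)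
  show "x \<in> carrier (monoid_alg (word_monoid ({1..4::nat} \<times> {1..4::nat})) (Sp_word_star q))" if "x \<in> Sp_rels q" for x
    using Sp_rels_keys[OF that] by simp
qed

lemma Sp_free_monoid_alg: "Sp_free q = monoid_alg (word_monoid ({1..4} \<times> {1..4})) (Sp_word_star q)"
  unfolding Sp_free_def free_star_alg_monoid_alg Sp_word_star_def ..

definition Sp_ideal :: "real \<Rightarrow> ((nat \<times> nat) list \<Rightarrow>\<^sub>0 complex) set" where
  "Sp_ideal q = Idl\<^bsub>Sp_free q\<^esub> Sp_rels q"

abbreviation Sp_words :: "(nat \<times> nat) list set" where
  "Sp_words \<equiv> lists ({1..4} \<times> {1..4})"

lemmas Sp_ideal_add = SpA.II_add[folded Sp_free_monoid_alg Sp_ideal_def]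
  and Sp_ideal_diff = SpA.II_diff[folded Sp_free_monoid_alg Sp_ideal_def]
  and Sp_ideal_scal = SpA.II_scal[folded Sp_free_monoid_alg Sp_ideal_def]
  and Sp_ideal_zero = SpA.II_zero[folded Sp_free_monoid_alg Sp_ideal_def]
  and Sp_ideal_base = SpA.II_base[folded Sp_free_monoid_alg Sp_ideal_def]
  and Sp_ideal_left = SpA.II_left[folded Sp_free_monoid_alg Sp_ideal_def, unfolded conv_word_monoid word_monoid_simps]
  and Sp_ideal_right = SpA.II_right[folded Sp_free_monoid_alg Sp_ideal_def, unfolded conv_word_monoid word_monoid_simps]

abbreviation Sp_star :: "real \<Rightarrow> ((nat \<times> nat) list \<Rightarrow>\<^sub>0 complex) \<Rightarrow> ((nat \<times> nat) list \<Rightarrow>\<^sub>0 complex)" where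
  "Sp_star q \<equiv> free_star (\<lambda>(i, j). antip q j i)"

lemma star_Sp_free: "star (Sp_free q) = Sp_star q"
  by (simp add: Sp_free_def star_free_star_alg)

lemma Sp_star_T:
  assumes "q \<noteq> 0" "i \<in> {1..4}" "j \<in> {1..4}"
  shows "Sp_star q (TT i j) = scal (uw q i * inverse (uw q j)) (TT (5 - i) (5 - j))"
proof -
  have "- qpow q (rho (5 - j) + rho i) * eps j * eps (5 - i) = uw q i * inverse (uw q j)"
    using idx_cases[OF assms(2)] idx_cases[OF assms(3)] assms(1)
    by (elim disjE) (simp_all add: uw_def rho_def eps_def qpow_def power_int_minus field_simps power2_eq_square power3_eq_cube power4_eq_xxxx)
  then show ?thesis
    by (simp only: free_star_letter prod.case antip_explicit[OF assms(1,3,2)] scal_single complex_cnj_one mult_1 mult_1_right)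
qed

lemma sum_flip: "(\<Sum>m\<in>{1..4::nat}. f (5 - m)) = (\<Sum>m\<in>{1..4}. f m)"
  unfolding sum_idx by (simp add: add_ac)

lemma sum_flip2: "(\<Sum>m\<in>{1..4::nat}. \<Sum>n\<in>{1..4::nat}. f (5 - m) (5 - n)) = (\<Sum>m\<in>{1..4}. \<Sum>n\<in>{1..4}. f m n)"
  by (rule trans[OF sum_flip[of "\<lambda>m. \<Sum>n\<in>{1..4}. f m (5 - n)"] sum.cong[OF refl sum_flip]])

definition RTT :: "real \<Rightarrow> nat \<Rightarrow> nat \<Rightarrow> nat \<Rightarrow> nat \<Rightarrow> (nat \<times> nat) list \<Rightarrow>\<^sub>0 complex" where
  "RTT q a b c d = (\<Sum>m\<in>{1..4}. \<Sum>n\<in>{1..4}. scal (Rmat q a b m n) (TT m c * TT n d))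
    - (\<Sum>m\<in>{1..4}. \<Sum>n\<in>{1..4}. scal (Rmat q m n c d) (TT b n * TT a m))"

definition TS :: "real \<Rightarrow> nat \<Rightarrow> nat \<Rightarrow> (nat \<times> nat) list \<Rightarrow>\<^sub>0 complex" where
  "TS q i j = (\<Sum>k\<in>{1..4}. TT i k * Sp_star q (TT j k)) - of_bool (i = j)"

definition ST :: "real \<Rightarrow> nat \<Rightarrow> nat \<Rightarrow> (nat \<times> nat) list \<Rightarrow>\<^sub>0 complex" where
  "ST q i j = (\<Sum>k\<in>{1..4}. Sp_star q (TT k i) * TT k j) - of_bool (i = j)"

lemma Sp_star_real: "cnj (uw q i) = uw q i" "cnj (Rmat q a b c d) = Rmat q a b c d" "cnj (qpow q n) = qpow q n"
proof -
  have m: "cnj (munit i j k l a b c d) = munit i j k l a b c d" for i j k l a b c d by (simp add: munit_def)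
  have e: "cnj (eps i) = eps i" for i by (simp add: eps_def)
  show q: "cnj (qpow q n) = qpow q n" for n by (simp add: qpow_def)
  show "cnj (uw q i) = uw q i" by (simp add: uw_def q e)
  show "cnj (Rmat q a b c d) = Rmat q a b c d"
    by (simp add: Rmat_def q e m case_prod_unfold)
qed

lemma Sp_rels_eq:
  "Sp_rels q = {RTT q a b c d | a b c d. a \<in> {1..4} \<and> b \<in> {1..4} \<and> c \<in> {1..4} \<and> d \<in> {1..4}}
    \<union> {TS q i j | i j. i \<in> {1..4} \<and> j \<in> {1..4}} \<union> {ST q i j | i j. i \<in> {1..4} \<and> j \<in> {1..4}}"
proof -
  have 1: "(\<Sum>m\<in>{1..4}. \<Sum>n\<in>{1..4}. Poly_Mapping.single [(m, c), (n, d)] (Rmat q a b m n))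
       - (\<Sum>m\<in>{1..4}. \<Sum>n\<in>{1..4}. Poly_Mapping.single [(b, n), (a, m)] (Rmat q m n c d)) = RTT q a b c d" for a b c d
    by (simp add: RTT_def monom_mult plus_list_def)
  have st: "Sp_star q (TT j k) = (\<Sum>l\<in>{1..4}. \<Sum>m\<in>{1..4}. Poly_Mapping.single [(m, l)] (Cmat q k l * Cinv q m j))" for j k
    by (simp add: free_star_letter antip_def)
  have 2: "(\<Sum>k\<in>{1..4}. \<Sum>l\<in>{1..4}. \<Sum>m\<in>{1..4}.
         Poly_Mapping.single [(i, k), (m, l)] (Cmat q k l * Cinv q m j))
       - Poly_Mapping.single [] (of_bool (i = j)) = TS q i j" for i j
    unfolding TS_def st by (simp add: sum_distrib_left mult_single plus_list_def single_empty)
  have 3: "(\<Sum>k\<in>{1..4}. \<Sum>l\<in>{1..4}. \<Sum>m\<in>{1..4}.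
         Poly_Mapping.single [(l, k), (m, j)] (Cmat q i k * Cinv q l m))
       - Poly_Mapping.single [] (of_bool (i = j)) = ST q i j" for i j
  proof -
    have "(\<Sum>k\<in>{1..4}. \<Sum>l\<in>{1..4}. \<Sum>m\<in>{1..4}.
         Poly_Mapping.single [(l, k), (m, j)] (Cmat q i k * Cinv q l m))
      = (\<Sum>m\<in>{1..4}. \<Sum>k\<in>{1..4}. \<Sum>l\<in>{1..4}.
         Poly_Mapping.single [(l, k), (m, j)] (Cmat q i k * Cinv q l m))"
      by (rule trans[OF sum.cong[OF refl sum.swap] sum.swap])
    then show ?thesis
      unfolding ST_def st by (simp add: sum_distrib_right mult_single plus_list_def single_empty)
  qed
  show ?thesis unfolding Sp_rels_def 1 2 3 ..
qed

text \<open>The star reverses products and weights each letter; by \<open>Rmat_weight\<close> the weights of all terms of a relation agree, and \<open>Rmat_flip\<close> matches the coefficients.\<close>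

lemma Sp_star_RTT:
  assumes "q \<noteq> 0" "a \<in> {1..4}" "b \<in> {1..4}" "c \<in> {1..4}" "d \<in> {1..4}"
  shows "Sp_star q (RTT q a b c d)
    = scal (uw q a * uw q b * inverse (uw q c * uw q d)) (RTT q (5 - b) (5 - a) (5 - d) (5 - c))"
proof -
  let ?u = "uw q"
  let ?l = "?u a * ?u b * inverse (?u c * ?u d)"
  note st = Sp_star_T[OF assms(1)]
  have 1: "Sp_star q (scal (Rmat q a b m n) (TT m c * TT n d))
    = scal ?l (scal (Rmat q (5 - b) (5 - a) (5 - n) (5 - m)) (TT (5 - n) (5 - d) * TT (5 - m) (5 - c)))"
    if "m \<in> {1..4}" "n \<in> {1..4}" for m n
  proof -
    have "Rmat q a b m n * (?u m * inverse (?u c) * (?u n * inverse (?u d)))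
      = (Rmat q a b m n * (?u m * ?u n)) * inverse (?u c * ?u d)"
      by simp
    also have "\<dots> = ?l * Rmat q a b m n"
      unfolding Rmat_weight[OF assms(1-3) that] by simp
    finally show ?thesis
      unfolding Rmat_flip[OF assms(2,3) that]
      by (simp only: free_star_scal free_star_mult st[OF that(1) assms(4)] st[OF that(2) assms(5)] Sp_star_real
          scal_mult_left scal_mult_right pm.scale_scale)
  qed
  have 2: "Sp_star q (scal (Rmat q m n c d) (TT b n * TT a m))
    = scal ?l (scal (Rmat q (5 - n) (5 - m) (5 - d) (5 - c)) (TT (5 - a) (5 - m) * TT (5 - b) (5 - n)))"
    if "m \<in> {1..4}" "n \<in> {1..4}" for m n
  proof -
    have u: "?u m \<noteq> 0" "?u n \<noteq> 0" "?u c \<noteq> 0" "?u d \<noteq> 0" using assms(1) by (simp_all add: uw_nonzero)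
    have "Rmat q m n c d * inverse (?u m * ?u n) = Rmat q m n c d * inverse (?u c * ?u d)"
    proof -
      have "Rmat q m n c d * inverse (?u m * ?u n)
        = Rmat q m n c d * (?u c * ?u d) * inverse (?u c * ?u d) * inverse (?u m * ?u n)"
        using u by (simp add: field_simps)
      also have "\<dots> = Rmat q m n c d * inverse (?u c * ?u d)"
        unfolding Rmat_weight[OF assms(1) that assms(4,5)] using u by (simp add: field_simps)
      finally show ?thesis .
    qed
    then have "Rmat q m n c d * (?u b * inverse (?u n) * (?u a * inverse (?u m))) = ?l * Rmat q m n c d"
      by (simp add: mult_ac)
    then show ?thesis
      unfolding Rmat_flip[OF that assms(4,5)]
      by (simp only: free_star_scal free_star_mult st[OF assms(2) that(1)] st[OF assms(3) that(2)] Sp_star_real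
          scal_mult_left scal_mult_right pm.scale_scale)
  qed
  have "Sp_star q (RTT q a b c d) =
     (\<Sum>m\<in>{1..4}. \<Sum>n\<in>{1..4}. scal ?l (scal (Rmat q (5 - b) (5 - a) (5 - n) (5 - m)) (TT (5 - n) (5 - d) * TT (5 - m) (5 - c))))
     - (\<Sum>m\<in>{1..4}. \<Sum>n\<in>{1..4}. scal ?l (scal (Rmat q (5 - n) (5 - m) (5 - d) (5 - c)) (TT (5 - a) (5 - m) * TT (5 - b) (5 - n))))"
    unfolding RTT_def free_star_diff free_star_sum
    by (rule arg_cong2[where f = "(-)"]; rule sum.cong[OF refl], rule sum.cong[OF refl], erule (1) 1 2)
  also have "\<dots> = scal ?l (
     (\<Sum>m\<in>{1..4}. \<Sum>n\<in>{1..4}. scal (Rmat q (5 - b) (5 - a) n m) (TT n (5 - d) * TT m (5 - c)))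
     - (\<Sum>m\<in>{1..4}. \<Sum>n\<in>{1..4}. scal (Rmat q n m (5 - d) (5 - c)) (TT (5 - a) m * TT (5 - b) n)))"
    unfolding pm.scale_sum_right[symmetric] pm.scale_right_diff_distrib[symmetric]
      sum_flip2[of "\<lambda>m n. scal (Rmat q (5 - b) (5 - a) n m) (TT n (5 - d) * TT m (5 - c))"]
      sum_flip2[of "\<lambda>m n. scal (Rmat q n m (5 - d) (5 - c)) (TT (5 - a) m * TT (5 - b) n)"] ..
  also have "\<dots> = scal ?l (RTT q (5 - b) (5 - a) (5 - d) (5 - c))"
    unfolding RTT_def
    by (intro arg_cong2[where f = "(-)"] arg_cong[where f = "scal ?l"] sum.swap)
  finally show ?thesis .
qed

lemma Sp_star_one: "Sp_star q 1 = 1"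
  using free_star_single[of "\<lambda>(i, j). antip q j i" "[]" 1] by (simp add: single_empty)

lemma Sp_star_involutive:
  assumes "q \<noteq> 0" "i \<in> {1..4}" "j \<in> {1..4}"
  shows "Sp_star q (Sp_star q (TT i j)) = TT i j"
proof -
  have "5 - i \<in> {1..4}" "5 - j \<in> {1..4}" using assms by auto
  moreover have "5 - (5 - i) = i" "5 - (5 - j) = j" using assms by auto
  moreover have "uw q i \<noteq> 0" "uw q j \<noteq> 0" by (simp_all add: uw_nonzero assms)
  ultimately show ?thesis
    by (simp only: Sp_star_T[OF assms] free_star_scal Sp_star_T[OF assms(1)] Sp_star_real complex_cnj_mult complex_cnj_inverse
        pm.scale_scale uw_flip[OF assms(1,2)] uw_flip[OF assms(1,3)]) (simp add: field_simps)
qed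

lemma Sp_star_TS:
  assumes "q \<noteq> 0" "i \<in> {1..4}" "j \<in> {1..4}"
  shows "Sp_star q (TS q i j) = TS q j i"
proof -
  have "Sp_star q (TT i k * Sp_star q (TT j k)) = TT j k * Sp_star q (TT i k)" if "k \<in> {1..4}" for k
    by (simp only: free_star_mult Sp_star_involutive[OF assms(1,3) that])
  then show ?thesis
    by (auto simp: TS_def free_star_diff free_star_sum Sp_star_one free_star_zero intro!: sum.cong)
qed

lemma Sp_star_ST:
  assumes "q \<noteq> 0" "i \<in> {1..4}" "j \<in> {1..4}"
  shows "Sp_star q (ST q i j) = ST q j i"
proof -
  have "Sp_star q (Sp_star q (TT k i) * TT k j) = Sp_star q (TT k j) * TT k i" if "k \<in> {1..4}" for k
    by (simp only: free_star_mult Sp_star_involutive[OF assms(1) that assms(2)])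
  then show ?thesis
    by (auto simp: ST_def free_star_diff free_star_sum Sp_star_one free_star_zero intro!: sum.cong)
qed

lemma keys_times_lists:
  assumes "Poly_Mapping.keys f \<subseteq> lists G" "Poly_Mapping.keys (g :: 'a list \<Rightarrow>\<^sub>0 complex) \<subseteq> lists G"
  shows "Poly_Mapping.keys (f * g) \<subseteq> lists G"
proof -
  have "x \<in> lists G" if x: "x \<in> Poly_Mapping.keys (f * g)" for x
  proof -
    obtain a b where "a \<in> Poly_Mapping.keys f" "b \<in> Poly_Mapping.keys g" "x = a @ b"
      using subsetD[OF keys_mult x] by (auto simp: plus_list_def)
    then show ?thesis using subsetD[OF assms(1)] subsetD[OF assms(2)] by simp
  qed
  then show ?thesis by (rule subsetI)
qed

lemma antip_keys:
  assumes "i \<in> {1..4}" "j \<in> {1..4}"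
  shows "Poly_Mapping.keys (antip q i j) \<subseteq> Sp_words"
  unfolding antip_def by (intro keys_sum_subset keys_single_subset) auto

lemma Sp_star_keys:
  assumes "Poly_Mapping.keys f \<subseteq> Sp_words"
  shows "Poly_Mapping.keys (Sp_star q f) \<subseteq> Sp_words"
proof -
  have "set w \<subseteq> {1..4} \<times> {1..4} \<Longrightarrow> Poly_Mapping.keys (foldr (\<lambda>g f. f * (case g of (i, j) \<Rightarrow> antip q j i)) w 1) \<subseteq> Sp_words" for w
  proof (induction w)
    case (Cons a w)
    then show ?case
      using keys_times_lists[OF _ antip_keys] by (cases a) auto
  qed (simp add: zero_list_def)
  then show ?thesis
    unfolding free_star_def by (intro linext_keys) (use assms in auto)
qed

text \<open>Without this the star of a coset would not be a coset, and the elements \<open>x\<^sub>i\<^sup>*\<close> would not be the classes of the expected words.\<close>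

lemma Sp_star_ideal:
  assumes "q \<noteq> 0" "x \<in> Sp_ideal q"
  shows "Sp_star q x \<in> Sp_ideal q"
proof -
  let ?N = "{x. Poly_Mapping.keys x \<subseteq> Sp_words \<and> Sp_star q x \<in> Sp_ideal q}"
  have neg: "Sp_star q (- x) = scal (-1) (Sp_star q x)" for x
    using free_star_scal[of "\<lambda>(i, j). antip q j i" "-1" x] by simp
  have "ideal ?N (monoid_alg (word_monoid ({1..4} \<times> {1..4})) (Sp_word_star q))"
  proof (rule SpA.ideal_by_monomials[unfolded conv_word_monoid])
    fix x assume "x \<in> ?N"
    then have x: "Poly_Mapping.keys x \<subseteq> Sp_words" "Sp_star q x \<in> Sp_ideal q" by auto
    show "- x \<in> ?N" using x(1) Sp_ideal_scal[OF x(2), of "-1"] by (simp add: neg)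
    show "x + y \<in> ?N" if "y \<in> ?N" for y
      using that x order_trans[OF keys_add Un_least[OF x(1)]] by (simp add: free_star_add Sp_ideal_add)
    fix a :: "(nat \<times> nat) list" and c :: complex assume "a \<in> carrier (word_monoid ({1..4} \<times> {1..4}))"
    then have a: "Poly_Mapping.keys (Poly_Mapping.single a c) \<subseteq> Sp_words" by simp
    show "Poly_Mapping.single a c * x \<in> ?N"
      using keys_times_lists[OF a x(1)] Sp_ideal_right[OF x(2) Sp_star_keys[OF a]] by (simp only: free_star_mult mem_Collect_eq)
    show "x * Poly_Mapping.single a c \<in> ?N"
      using keys_times_lists[OF x(1) a] Sp_ideal_left[OF x(2) Sp_star_keys[OF a]] by (simp only: free_star_mult mem_Collect_eq)
  qed (auto simp: free_star_zero Sp_ideal_zero)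
  moreover have "Sp_rels q \<subseteq> ?N"
  proof
    fix x assume x: "x \<in> Sp_rels q"
    have flip: "5 - i \<in> {1..4}" if "i \<in> {1..4::nat}" for i using that by auto
    from x have "Sp_star q x \<in> Sp_ideal q"
      unfolding Sp_rels_eq
    proof (elim UnE CollectE exE conjE)
      fix a b c d :: nat assume i: "a \<in> {1..4}" "b \<in> {1..4}" "c \<in> {1..4}" "d \<in> {1..4}" and "x = RTT q a b c d"
      then show ?thesis
        using Sp_star_RTT[OF assms(1) i] flip[OF i(1)] flip[OF i(2)] flip[OF i(3)] flip[OF i(4)]
        by (simp only:) (rule Sp_ideal_scal, rule Sp_ideal_base, unfold Sp_rels_eq, blast)
    next
      fix i j :: nat assume i: "i \<in> {1..4}" "j \<in> {1..4}" and "x = TS q i j"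
      then show ?thesis using Sp_star_TS[OF assms(1) i]
        by (simp only:) (rule Sp_ideal_base, unfold Sp_rels_eq, blast)
    next
      fix i j :: nat assume i: "i \<in> {1..4}" "j \<in> {1..4}" and "x = ST q i j"
      then show ?thesis using Sp_star_ST[OF assms(1) i]
        by (simp only:) (rule Sp_ideal_base, unfold Sp_rels_eq, blast)
    qed
    then show "x \<in> ?N" using Sp_rels_keys[OF x] by simp
  qed
  ultimately have "Sp_ideal q \<subseteq> ?N"
    unfolding Sp_ideal_def Sp_free_monoid_alg by (rule ring.genideal_minimal[OF SpA.ring_A])
  then show ?thesis using assms(2) by blast
qed

section \<open>Exchange relations between the doublets\<close>

text \<open>The entries of \<open>v\<close> as scalar multiples of letters \<open>T\<^sub>i\<^sup>j\<close> with \<open>j = 1\<close> or \<open>j = 4\<close>. Rows outside the range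
\<open>1, \<dots>, 4\<close> are sent to \<open>0\<close>, which makes all relations below valid for arbitrary row indices.\<close>

definition vT :: "real \<Rightarrow> nat \<times> bool \<Rightarrow> (nat \<times> nat) list \<Rightarrow>\<^sub>0 complex" where
  "vT q = (\<lambda>(i, k).
     if i = 1 then if k then scal (qpow q (-2)) (TT 2 4) else scal (qpow q (-3)) (TT 1 4)
     else if i = 2 then if k then scal (- qpow q 3) (TT 4 1) else scal (qpow q 2) (TT 3 1)
     else if i = 3 then if k then scal (- 1) (TT 4 4) else scal (qpow q (-1)) (TT 3 4)
     else if i = 4 then if k then scal (- qpow q 1) (TT 2 1) else scal (- 1) (TT 1 1)
     else 0)"

definition ev :: "real \<Rightarrow> nat doublets \<Rightarrow> (nat \<times> nat) list \<Rightarrow>\<^sub>0 complex" where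
  "ev q = linext scal (\<lambda>u. prod_list (map (vT q) u))"

lemma ev_add [simp]: "ev q (x + y) = ev q x + ev q y"
  by (simp add: ev_def pm_linext_add)

lemma ev_diff [simp]: "ev q (x - y) = ev q x - ev q y"
  by (simp add: ev_def pm_linext_diff)

lemma ev_scal [simp]: "ev q (scal c x) = scal c (ev q x)"
  by (simp add: ev_def pm_linext_scal)

lemma ev_zero [simp]: "ev q 0 = 0"
  by (simp add: ev_def)

lemma ev_single: "ev q (Poly_Mapping.single u c) = scal c (prod_list (map (vT q) u))"
  by (simp add: ev_def pm_linext_single)

lemma ev_one [simp]: "ev q 1 = 1"
  using ev_single[of q "[]" 1] by (simp add: single_empty)

lemma ev_mult [simp]: "ev q (x * y) = ev q x * ev q y"
proof (induction x rule: single_induct)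
  case (single u c)
  show ?case
    by (induction y rule: single_induct)
      (simp_all add: mult_single plus_list_def ev_single distrib_left mult.commute)
qed (simp_all add: distrib_right)

lemma ev_vgen [simp]: "ev q (vgen i k) = vT q (i, k)"
  by (simp add: vgen_def ev_single)

lemma vT_keys: "Poly_Mapping.keys (vT q p) \<subseteq> Sp_words"
  by (cases p) (simp add: vT_def)

lemma ev_keys: "Poly_Mapping.keys (ev q f) \<subseteq> Sp_words"
  unfolding ev_def
proof (rule linext_keys)
  fix u :: "(nat \<times> bool) list"
  show "Poly_Mapping.keys (prod_list (map (vT q) u)) \<subseteq> Sp_words"
  proof (induction u)
    case (Cons a u)
    then show ?case unfolding list.map prod_list.Cons by (intro keys_times_lists vT_keys)
  qed (simp add: zero_list_def)
qed

definition vrel_ideal :: "real \<Rightarrow> nat doublets set" where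
  "vrel_ideal q = {f. ev q f \<in> Sp_ideal q}"

lemma doublet_ideal_vrel_ideal: "q \<noteq> 0 \<Longrightarrow> doublet_ideal (complex_of_real q) (vrel_ideal q)"
  by unfold_locales (auto simp: vrel_ideal_def Sp_ideal_zero intro: Sp_ideal_add Sp_ideal_left[OF _ ev_keys] Sp_ideal_right[OF _ ev_keys])

text \<open>For these pairs of columns the column indices are not mixed by \<open>R\<close>, so that the relation expresses \<open>T\<^sub>b\<^sup>d T\<^sub>a\<^sup>c\<close> through
products with columns \<open>c, d\<close> in this order. All other columns drop out, and the relation concerns the sphere alone.\<close>

lemma RTT_columns:
  assumes i: "a \<in> {1..4}" "b \<in> {1..4}"
    and cd: "c = d \<and> d \<in> {1, 4} \<and> r = qpow q 1 \<or> c = 4 \<and> d = 1 \<and> r = qpow q (-1)"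
  shows "RTT q a b c d = (\<Sum>m\<in>{1..4}. \<Sum>n\<in>{1..4}. scal (Rmat q a b m n) (TT m c * TT n d))
    - scal r (TT b d * TT a c)"
proof -
  have cd': "c \<in> {1..4}" "d \<in> {1..4}" using cd by auto
  have R: "Rmat q m n c d = (if m = c \<and> n = d then r else 0)" if "m \<in> {1..4}" "n \<in> {1..4}" for m n
    unfolding Rmat_closed[OF that cd'] using idx_cases[OF that(1)] idx_cases[OF that(2)] cd
    by (elim disjE conjE insertE emptyE; simp)
  have "(\<Sum>m\<in>{1..4}. \<Sum>n\<in>{1..4}. scal (Rmat q m n c d) (TT b n * TT a m))
    = (\<Sum>m\<in>{1..4}. \<Sum>n\<in>{1..4}. if m = c then if n = d then scal r (TT b n * TT a m) else 0 else 0)"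
    by (rule sum.cong[OF refl], rule sum.cong[OF refl]) (simp only: R, simp)
  also have "\<dots> = (\<Sum>m\<in>{1..4}. if m = c then \<Sum>n\<in>{1..4}. if n = d then scal r (TT b n * TT a m) else 0 else 0)"
    by (rule sum.cong) auto
  also have "\<dots> = scal r (TT b d * TT a c)"
    using cd' by (simp only: sum.delta finite_atLeastAtMost if_True)
  finally show ?thesis unfolding RTT_def by simp
qed

lemma RTT_ideal:
  assumes "a \<in> {1..4}" "b \<in> {1..4}" "c \<in> {1..4}" "d \<in> {1..4}"
  shows "RTT q a b c d \<in> Sp_ideal q"
  by (rule Sp_ideal_base) (unfold Sp_rels_eq, use assms in blast)


lemma bool_pair_cases:
  "f True True \<in> S \<Longrightarrow> f True False \<in> S \<Longrightarrow> f False True \<in> S \<Longrightarrow> f False False \<in> S \<Longrightarrow> f r s \<in> S"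
  by (cases r; cases s) simp_all

text \<open>Each exchange relation is a multiple of one relation between columns 1 and 4; the following lemmas
give its indices and the factor, and compare coefficients of words.\<close>

lemma vrel_ideal_by_RTT:
  assumes abcd: "a \<in> {1..4} \<and> b \<in> {1..4} \<and> (c = d \<and> d \<in> {1, 4} \<and> r = qpow q 1 \<or> c = 4 \<and> d = 1 \<and> r = qpow q (-1))"
    and x: "\<And>u. Poly_Mapping.lookup (ev q x) u = Poly_Mapping.lookup (scal e
      ((\<Sum>m\<in>{1..4}. \<Sum>n\<in>{1..4}. scal (Rmat q a b m n) (TT m c * TT n d)) - scal r (TT b d * TT a c))) u"
  shows "x \<in> vrel_ideal q"
proof -
  have "c \<in> {1..4}" "d \<in> {1..4}" using abcd by auto
  then have "RTT q a b c d \<in> Sp_ideal q" using abcd by (intro RTT_ideal) simp_all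
  from Sp_ideal_scal[OF this, of e] show ?thesis
    using poly_mapping_eqI[OF x] RTT_columns[of a b c d r q] abcd by (simp only: vrel_ideal_def mem_Collect_eq)
qed

lemmas exchange_simps = sum_idx Rmat_closed rho_def eps_def qpow_def vT_def minor_def skew_def exchange_defect_def
  power_int_minus lookup_add lookup_minus lookup_single when_def mult_single plus_list_def

lemmas exchange_norm = exchange_simps field_simps eval_nat_numeral

lemma minor_diag_1: "q \<noteq> 0 \<Longrightarrow> minor (complex_of_real q) 1 1 \<in> vrel_ideal q"
  by (rule vrel_ideal_by_RTT[of 1 2 4 4 "qpow q 1" q _ "qpow q (- 5)"], simp,
       simp add: exchange_simps, auto simp: exchange_norm)

lemma minor_diag_2: "q \<noteq> 0 \<Longrightarrow> minor (complex_of_real q) 2 2 \<in> vrel_ideal q"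
  by (rule vrel_ideal_by_RTT[of 3 4 1 1 "qpow q 1" q _ "- qpow q 5"], simp,
       simp add: exchange_simps, auto simp: exchange_norm)

lemma minor_diag_3: "q \<noteq> 0 \<Longrightarrow> minor (complex_of_real q) 3 3 \<in> vrel_ideal q"
  by (rule vrel_ideal_by_RTT[of 3 4 4 4 "qpow q 1" q _ "- qpow q (- 1)"], simp,
       simp add: exchange_simps, auto simp: exchange_norm)

lemma minor_diag_4: "q \<noteq> 0 \<Longrightarrow> minor (complex_of_real q) 4 4 \<in> vrel_ideal q"
  by (rule vrel_ideal_by_RTT[of 1 2 1 1 "qpow q 1" q _ "qpow q 1"], simp,
       simp add: exchange_simps, auto simp: exchange_norm)

lemma exchange_21:
  assumes q_nz: "q \<noteq> 0" and Q: "Q = complex_of_real q"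
  shows "exchange_defect Q 1 0 0 2 1 1 1 r s \<in> vrel_ideal q"
  unfolding Q
  by (rule bool_pair_cases,
      (rule vrel_ideal_by_RTT[of 2 4 4 1 "qpow q (- 1)" q _ "qpow q 2"], simp,
       simp add: exchange_simps q_nz, auto simp: exchange_norm q_nz),
      (rule vrel_ideal_by_RTT[of 1 4 4 1 "qpow q (- 1)" q _ "qpow q 1"], simp,
       simp add: exchange_simps q_nz, auto simp: exchange_norm q_nz),
      (rule vrel_ideal_by_RTT[of 2 3 4 1 "qpow q (- 1)" q _ "- qpow q 1"], simp,
       simp add: exchange_simps q_nz, auto simp: exchange_norm q_nz),
      (rule vrel_ideal_by_RTT[of 1 3 4 1 "qpow q (- 1)" q _ "- qpow q 0"], simp,
       simp add: exchange_simps q_nz, auto simp: exchange_norm q_nz))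

lemma exchange_31:
  assumes q_nz: "q \<noteq> 0" and Q: "Q = complex_of_real q"
  shows "exchange_defect Q (inverse Q ^ 2) 0 0 3 1 1 1 r s \<in> vrel_ideal q"
  unfolding Q
  by (rule bool_pair_cases,
      (rule vrel_ideal_by_RTT[of 2 4 4 4 "qpow q 1" q _ "qpow q (- 3)"], simp,
       simp add: exchange_simps q_nz, auto simp: exchange_norm q_nz),
      (rule vrel_ideal_by_RTT[of 1 4 4 4 "qpow q 1" q _ "qpow q (- 4)"], simp,
       simp add: exchange_simps q_nz, auto simp: exchange_norm q_nz),
      (rule vrel_ideal_by_RTT[of 2 3 4 4 "qpow q 1" q _ "- qpow q (- 4)"], simp,
       simp add: exchange_simps q_nz, auto simp: exchange_norm q_nz),
      (rule vrel_ideal_by_RTT[of 1 3 4 4 "qpow q 1" q _ "- qpow q (- 5)"], simp,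
       simp add: exchange_simps q_nz, auto simp: exchange_norm q_nz))

lemma exchange_41:
  assumes q_nz: "q \<noteq> 0" and Q: "Q = complex_of_real q"
  shows "exchange_defect Q Q 0 0 4 1 1 1 r s \<in> vrel_ideal q"
  unfolding Q
  by (rule bool_pair_cases,
      (rule vrel_ideal_by_RTT[of 2 2 4 1 "qpow q (- 1)" q _ "qpow q 0"], simp,
       simp add: exchange_simps q_nz, auto simp: exchange_norm q_nz),
      (rule vrel_ideal_by_RTT[of 1 2 4 1 "qpow q (- 1)" q _ "qpow q (- 1)"], simp,
       simp add: exchange_simps q_nz, auto simp: exchange_norm q_nz),
      (rule vrel_ideal_by_RTT[of 2 1 4 1 "qpow q (- 1)" q _ "qpow q (- 1)"], simp,
       simp add: exchange_simps q_nz, auto simp: exchange_norm q_nz),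
      (rule vrel_ideal_by_RTT[of 1 1 4 1 "qpow q (- 1)" q _ "qpow q (- 2)"], simp,
       simp add: exchange_simps q_nz, auto simp: exchange_norm q_nz))

lemma exchange_23:
  assumes q_nz: "q \<noteq> 0" and Q: "Q = complex_of_real q"
  shows "exchange_defect Q Q 0 0 2 3 1 1 r s \<in> vrel_ideal q"
  unfolding Q
  by (rule bool_pair_cases,
      (rule vrel_ideal_by_RTT[of 4 4 4 1 "qpow q (- 1)" q _ "- qpow q 4"], simp,
       simp add: exchange_simps q_nz, auto simp: exchange_norm q_nz),
      (rule vrel_ideal_by_RTT[of 3 4 4 1 "qpow q (- 1)" q _ "qpow q 3"], simp,
       simp add: exchange_simps q_nz, auto simp: exchange_norm q_nz),
      (rule vrel_ideal_by_RTT[of 4 3 4 1 "qpow q (- 1)" q _ "qpow q 3"], simp,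
       simp add: exchange_simps q_nz, auto simp: exchange_norm q_nz),
      (rule vrel_ideal_by_RTT[of 3 3 4 1 "qpow q (- 1)" q _ "- qpow q 2"], simp,
       simp add: exchange_simps q_nz, auto simp: exchange_norm q_nz))

lemma exchange_24:
  assumes q_nz: "q \<noteq> 0" and Q: "Q = complex_of_real q"
  shows "exchange_defect Q (inverse Q ^ 2) 0 0 2 4 1 1 r s \<in> vrel_ideal q"
  unfolding Q
  by (rule bool_pair_cases,
      (rule vrel_ideal_by_RTT[of 2 4 1 1 "qpow q 1" q _ "- qpow q 3"], simp,
       simp add: exchange_simps q_nz, auto simp: exchange_norm q_nz),
      (rule vrel_ideal_by_RTT[of 1 4 1 1 "qpow q 1" q _ "- qpow q 2"], simp,
       simp add: exchange_simps q_nz, auto simp: exchange_norm q_nz),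
      (rule vrel_ideal_by_RTT[of 2 3 1 1 "qpow q 1" q _ "qpow q 2"], simp,
       simp add: exchange_simps q_nz, auto simp: exchange_norm q_nz),
      (rule vrel_ideal_by_RTT[of 1 3 1 1 "qpow q 1" q _ "qpow q 1"], simp,
       simp add: exchange_simps q_nz, auto simp: exchange_norm q_nz))

text \<open>The only pair of rows with a correction term: the rows come from letters \<open>T\<^sub>1\<^sup>1, T\<^sub>2\<^sup>1\<close> and
\<open>T\<^sub>3\<^sup>4, T\<^sub>4\<^sup>4\<close>, for which the last two sums in \<open>R\<close> contribute products of rows 1 and 2.\<close>

lemma exchange_43:
  assumes q_nz: "q \<noteq> 0" and Q: "Q = complex_of_real q"
  shows "exchange_defect Q 1 (1 - Q ^ 2) ((1 - Q ^ 2) * inverse Q ^ 4) 4 3 1 2 r s \<in> vrel_ideal q"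
  unfolding Q
  by (rule bool_pair_cases,
      (rule vrel_ideal_by_RTT[of 4 2 4 1 "qpow q (- 1)" q _ "- qpow q 2"], simp,
       simp add: exchange_simps q_nz, auto simp: exchange_norm q_nz),
      (rule vrel_ideal_by_RTT[of 3 2 4 1 "qpow q (- 1)" q _ "qpow q 1"], simp,
       simp add: exchange_simps q_nz, auto simp: exchange_norm q_nz),
      (rule vrel_ideal_by_RTT[of 4 1 4 1 "qpow q (- 1)" q _ "- qpow q 1"], simp,
       simp add: exchange_simps q_nz, auto simp: exchange_norm q_nz),
      (rule vrel_ideal_by_RTT[of 3 1 4 1 "qpow q (- 1)" q _ "qpow q 0"], simp,
       simp add: exchange_simps q_nz, auto simp: exchange_norm q_nz))

lemma vgen_out_of_range: "i \<notin> {1..4} \<Longrightarrow> vgen i k \<in> vrel_ideal q"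
  by (auto simp: vrel_ideal_def vT_def Sp_ideal_zero)

text \<open>The pair \<open>(4, 3)\<close> depends on \<open>(1, 2)\<close>, which is therefore settled first.\<close>

lemma passes_vrel_ideal:
  assumes q_nz: "q \<noteq> 0"
  shows "doublet_ideal.passes (complex_of_real q) (vrel_ideal q) j l"
proof -
  let ?Q = "complex_of_real q"
  interpret doublet_ideal ?Q "vrel_ideal q" by (rule doublet_ideal_vrel_ideal[OF q_nz])
  have Q: "?Q \<noteq> 0" "inverse ?Q ^ 2 \<noteq> 0" "(1::complex) \<noteq> 0" using q_nz by auto
  have d: "passes 1 1" "passes 2 2" "passes 3 3" "passes 4 4"
    by (rule passes_mod[OF minor_diag_1[OF q_nz]] passes_mod[OF minor_diag_2[OF q_nz]]
        passes_mod[OF minor_diag_3[OF q_nz]] passes_mod[OF minor_diag_4[OF q_nz]])+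
  note 21 = passes_exchange[OF Q(3) d(1) exchange_21[OF q_nz refl]]
    and 31 = passes_exchange[OF Q(2) d(1) exchange_31[OF q_nz refl]]
    and 41 = passes_exchange[OF Q(1) d(1) exchange_41[OF q_nz refl]]
    and 23 = passes_exchange[OF Q(1) d(1) exchange_23[OF q_nz refl]]
    and 24 = passes_exchange[OF Q(2) d(1) exchange_24[OF q_nz refl]]
  note 43 = passes_exchange[OF Q(3) 21(1) exchange_43[OF q_nz refl]]
  show ?thesis
  proof (cases "j \<in> {1..4} \<and> l \<in> {1..4}")
    case True
    then show ?thesis
      using idx_cases[of j] idx_cases[of l] d 21 31 41 23 24 43 by blast
  next
    case False
    have "vgen j r * vgen l s \<in> vrel_ideal q" for r s
      using False vgen_out_of_range[of j r q] vgen_out_of_range[of l s q] by (blast intro: J_left J_right)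
    then have "minor ?Q j l \<in> vrel_ideal q"
      unfolding minor_def by (intro J_diff J_scal)
    then show ?thesis by (rule passes_mod)
  qed
qed


section \<open>The quantum spheres in coordinates\<close>

abbreviation Sp_cls :: "real \<Rightarrow> ((nat \<times> nat) list \<Rightarrow>\<^sub>0 complex) \<Rightarrow> sp_elem" where
  "Sp_cls q \<equiv> cls (Sp_free q) (Sp_rels q)"

lemmas Sp_cls_eq_iff = SpA.cls_eq_iff[folded Sp_free_monoid_alg Sp_ideal_def]

lemma Sp_cls_mult:
  "Poly_Mapping.keys x \<subseteq> Sp_words \<Longrightarrow> Poly_Mapping.keys y \<subseteq> Sp_words \<Longrightarrow>
    Sp_cls q x \<otimes>\<^bsub>A_Sp q\<^esub> Sp_cls q y = Sp_cls q (x * y)"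
  using SpA.mult_B[where x = x and y = y and q = q] by (simp add: A_Sp_def Sp_free_monoid_alg conv_word_monoid)

lemma Sp_cls_add:
  "Poly_Mapping.keys x \<subseteq> Sp_words \<Longrightarrow> Poly_Mapping.keys y \<subseteq> Sp_words \<Longrightarrow>
    Sp_cls q x \<oplus>\<^bsub>A_Sp q\<^esub> Sp_cls q y = Sp_cls q (x + y)"
  using SpA.add_B[where x = x and y = y and q = q] by (simp add: A_Sp_def Sp_free_monoid_alg)

lemma Sp_cls_smult: "c \<odot>\<^bsub>A_Sp q\<^esub> Sp_cls q x = Sp_cls q (scal c x)"
  using SpA.smult_B[where c = c and x = x and q = q] by (simp add: A_Sp_def Sp_free_monoid_alg)

lemma Sp_cls_one: "\<one>\<^bsub>A_Sp q\<^esub> = Sp_cls q 1"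
  using SpA.B_simps(2)[where q = q] by (simp add: A_Sp_def Sp_free_monoid_alg single_empty)

lemma Sp_cls_star: "q \<noteq> 0 \<Longrightarrow> star (A_Sp q) (Sp_cls q x) = Sp_cls q (Sp_star q x)"
  unfolding A_Sp_def
  by (rule SpA.star_B[where q = q, folded Sp_free_monoid_alg Sp_ideal_def, unfolded star_Sp_free]) (rule Sp_star_ideal)

lemma ring_A_Sp: "ring (A_Sp q)"
  using SpA.ring_B[where q = q] by (simp add: A_Sp_def Sp_free_monoid_alg)

lemma carrier_A_Sp: "carrier (A_Sp q) = Sp_cls q ` {x. Poly_Mapping.keys x \<subseteq> Sp_words}"
  using SpA.B_simps(1)[where q = q] by (simp add: A_Sp_def Sp_free_monoid_alg)

lemma A_S7_simps [simp]:
  "mult (A_S7 q) = mult (A_Sp q)" "add (A_S7 q) = add (A_Sp q)" "one (A_S7 q) = one (A_Sp q)"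
  "module.smult (A_S7 q) = module.smult (A_Sp q)" "star (A_S7 q) = star (A_Sp q)" "zero (A_S7 q) = zero (A_Sp q)"
  by (simp_all add: A_S7_def subalg_def)

lemma xgen_cls: "xgen q i = Sp_cls q (TT i 4)"
  by (simp add: xgen_def Tgen_def)

lemma xbar_cls:
  assumes "q \<noteq> 0" "i \<in> {1..4}"
  shows "xbar q i = Sp_cls q (scal (uw q i * inverse (uw q 4)) (TT (5 - i) 1))"
  using Sp_star_T[OF assms, of 4] by (simp add: xbar_def xgen_cls Sp_cls_star assms(1))

lemma vmat_cls:
  assumes q0: "q \<noteq> 0" and i: "i \<in> {1..4}"
  shows "vmat q i 1 = Sp_cls q (vT q (i, False))" "vmat q i 2 = Sp_cls q (vT q (i, True))"
  using idx_cases[OF i]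
  by (auto simp: vmat_def Let_def xgen_cls xbar_cls q0 Sp_cls_smult vT_def uw_def rho_def eps_def qpow_def
      power_int_minus field_simps eval_nat_numeral)

text \<open>The conjugate of row \<open>j\<close> of \<open>v\<close> is, up to the skew form and a scalar, its row \<open>partner j\<close>. This is what turns the entries of \<open>v v\<^sup>*\<close> into minors.\<close>

definition partner :: "nat \<Rightarrow> nat" where
  "partner j = (if j = 1 then 2 else if j = 2 then 1 else if j = 3 then 4 else 3)"

definition pscale :: "real \<Rightarrow> nat \<Rightarrow> complex" where
  "pscale q j = (if j = 1 then qpow q (-2) else if j = 2 then - qpow q 1 else if j = 3 then - qpow q (-1) else 1)"

lemma pscale_nonzero: "q \<noteq> 0 \<Longrightarrow> pscale q j \<noteq> 0"
  by (simp add: pscale_def qpow_def)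

lemma free_star_minus: "free_star s (- x) = - free_star s x"
  using free_star_scal[of s "-1" x] by simp

lemma Sp_star_single:
  assumes "q \<noteq> 0" "i \<in> {1..4}" "j \<in> {1..4}"
  shows "Sp_star q (Poly_Mapping.single [(i, j)] c)
    = Poly_Mapping.single [(5 - i, 5 - j)] (cnj c * (uw q i * inverse (uw q j)))"
  unfolding single_conv_scal[of "[(i, j)]" c] by (simp only: free_star_scal Sp_star_T[OF assms]) simp

lemma Sp_star_vT:
  assumes q0: "q \<noteq> 0" and j: "j \<in> {1..4}"
  shows "Sp_star q (vT q (j, False)) = scal (pscale q j) (vT q (partner j, True))"
    and "Sp_star q (vT q (j, True)) = scal (- complex_of_real q * pscale q j) (vT q (partner j, False))"
  using idx_cases[OF j]
  by (auto simp: vT_def free_star_minus Sp_star_single single_uminus uw_def rho_def eps_def qpow_def power_int_minus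
      partner_def pscale_def q0 field_simps eval_nat_numeral)

lemma pmat_cls:
  assumes q0: "q \<noteq> 0" and i: "i \<in> {1..4}" and j: "j \<in> {1..4}"
  shows "pmat q i j = Sp_cls q (ev q (scal (pscale q j) (minor (complex_of_real q) i (partner j))))"
proof -
  have k: "Poly_Mapping.keys (scal c (vT q p)) \<subseteq> Sp_words" for c p
    by (rule order_trans[OF keys_scal vT_keys])
  have "pmat q i j = Sp_cls q (vT q (i, False) * scal (pscale q j) (vT q (partner j, True))
      + vT q (i, True) * scal (- complex_of_real q * pscale q j) (vT q (partner j, False)))"
    unfolding pmat_def A_S7_simps vmat_cls[OF q0 i] vmat_cls[OF q0 j] Sp_cls_star[OF q0] Sp_star_vT[OF q0 j]
    by (simp only: Sp_cls_mult[OF vT_keys k] Sp_cls_add[OF keys_times_lists keys_times_lists, OF vT_keys k vT_keys k])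
  also have "\<dots> = Sp_cls q (ev q (scal (pscale q j) (minor (complex_of_real q) i (partner j))))"
    by (simp add: minor_def pm.scale_right_diff_distrib mult.commute)
  finally show ?thesis .
qed

text \<open>Functionals on an algebra of cosets are evaluated on chosen representatives.\<close>

definition rep :: "'a set \<Rightarrow> 'a" where
  "rep X = (SOME x. x \<in> X)"

context quot_monoid_alg
begin

lemma cls_rep:
  assumes "a \<in> carrier B"
  shows "cls A Q (rep a) = a" and "rep a \<in> carrier A"
proof -
  obtain x where x: "a = cls A Q x" "x \<in> carrier A" using assms by (auto simp only: B_simps)
  have "x \<in> a" using II_zero unfolding x(1) cls_def' by (intro image_eqI[of _ _ 0]) simp_all
  then have "rep a \<in> a" unfolding rep_def by (rule someI)
  then obtain h where h: "h \<in> II" "rep a = h + x" unfolding x(1) cls_def' by blast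
  then show "cls A Q (rep a) = a" unfolding x(1) cls_eq_iff by simp
  have "Poly_Mapping.keys (h + x) \<subseteq> carrier M"
    using x(2) II_carrier[OF h(1)] by (intro order_trans[OF keys_add] Un_least) simp_all
  then show "rep a \<in> carrier A" using h(2) by simp
qed

end

section \<open>A triangular representation of quantum SU(2)\<close>

definition SU_word_star :: "su_gen list \<Rightarrow> su_gen list \<Rightarrow>\<^sub>0 complex" where
  "SU_word_star = (\<lambda>w. foldr (\<lambda>g f. f * Poly_Mapping.single [su_bar g] 1) w 1)"

interpretation SUA: quot_monoid_alg "word_monoid (UNIV :: su_gen set)" SU_word_star "SU_rels q"
  for q :: real
  by (intro quot_monoid_alg.intro quot_monoid_alg_axioms.intro monoid_word_monoid) simp

lemma SU_free_monoid_alg: "SU_free = monoid_alg (word_monoid UNIV) SU_word_star"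
  unfolding SU_free_def free_star_alg_monoid_alg SU_word_star_def ..

abbreviation SU_cls :: "real \<Rightarrow> (su_gen list \<Rightarrow>\<^sub>0 complex) \<Rightarrow> su_elem" where
  "SU_cls q \<equiv> cls SU_free (SU_rels q)"

lemma SU_cls_mult: "SU_cls q x \<otimes>\<^bsub>A_SU q\<^esub> SU_cls q y = SU_cls q (x * y)"
  using SUA.mult_B[where x = x and y = y and q = q] by (simp add: A_SU_def SU_free_monoid_alg conv_word_monoid)

lemma SU_cls_add: "SU_cls q x \<oplus>\<^bsub>A_SU q\<^esub> SU_cls q y = SU_cls q (x + y)"
  using SUA.add_B[where x = x and y = y and q = q] by (simp add: A_SU_def SU_free_monoid_alg)

lemma SU_cls_smult: "c \<odot>\<^bsub>A_SU q\<^esub> SU_cls q x = SU_cls q (scal c x)"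
  using SUA.smult_B[where c = c and x = x and q = q] by (simp add: A_SU_def SU_free_monoid_alg)

lemma SU_cls_one: "\<one>\<^bsub>A_SU q\<^esub> = SU_cls q 1"
  using SUA.B_simps(2)[where q = q] by (simp add: A_SU_def SU_free_monoid_alg single_empty)

lemma ring_A_SU: "ring (A_SU q)"
  using SUA.ring_B[where q = q] by (simp add: A_SU_def SU_free_monoid_alg)

lemma carrier_A_SU: "carrier (A_SU q) = range (SU_cls q)"
  using SUA.B_simps(1)[where q = q] by (simp add: A_SU_def SU_free_monoid_alg)

lemma SU_cls_carrier [simp]: "SU_cls q x \<in> carrier (A_SU q)"
  by (simp add: carrier_A_SU)

text \<open>A representation by upper triangular \<open>2 \<times> 2\<close> matrices, with rows and columns indexed by \<open>bool\<close>: \<open>\<alpha>\<close> is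
diagonal with entries \<open>q\<close> and \<open>1\<close>, and \<open>\<gamma>\<close> and its conjugate are strictly triangular, so that their product vanishes and
\<open>\<alpha>\<close> is inverse to its conjugate. The relation \<open>\<alpha>\<gamma> = q\<gamma>\<alpha>\<close> forces the ratio of the diagonal entries; the second
one is chosen to be \<open>1\<close>, which makes the corresponding character trivial.\<close>

fun su_rep_gen :: "complex \<Rightarrow> complex \<Rightarrow> complex \<Rightarrow> su_gen \<Rightarrow> bool \<Rightarrow> bool \<Rightarrow> complex" where
  "su_rep_gen q g h Al r s = (if r = s then if r then 1 else q else 0)"
| "su_rep_gen q g h AlBar r s = (if r = s then if r then 1 else inverse q else 0)"
| "su_rep_gen q g h Ga r s = (if \<not> r \<and> s then g else 0)"
| "su_rep_gen q g h GaBar r s = (if \<not> r \<and> s then - inverse q * h else 0)"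

fun su_rep_word :: "complex \<Rightarrow> complex \<Rightarrow> complex \<Rightarrow> su_gen list \<Rightarrow> bool \<Rightarrow> bool \<Rightarrow> complex" where
  "su_rep_word q g h [] r s = of_bool (r = s)"
| "su_rep_word q g h (x # u) r s = su_rep_gen q g h x r False * su_rep_word q g h u False s + su_rep_gen q g h x r True * su_rep_word q g h u True s"

interpretation cspace: vector_space "(*) :: complex \<Rightarrow> complex \<Rightarrow> complex"
  by unfold_locales (simp_all add: algebra_simps)

definition su_rep :: "complex \<Rightarrow> complex \<Rightarrow> complex \<Rightarrow> bool \<Rightarrow> bool \<Rightarrow> (su_gen list \<Rightarrow>\<^sub>0 complex) \<Rightarrow> complex" where
  "su_rep q g h r s = linext (*) (\<lambda>u. su_rep_word q g h u r s)"

lemma su_rep_add: "su_rep q g h r s (x + y) = su_rep q g h r s x + su_rep q g h r s y"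
  unfolding su_rep_def by (rule linext_add[OF cspace.vector_space_axioms])

lemma su_rep_diff: "su_rep q g h r s (x - y) = su_rep q g h r s x - su_rep q g h r s y"
  unfolding su_rep_def by (rule linext_diff[OF cspace.vector_space_axioms])

lemma su_rep_scal: "su_rep q g h r s (scal c x) = c * su_rep q g h r s x"
  unfolding su_rep_def by (rule linext_scal[OF cspace.vector_space_axioms])

lemma su_rep_single: "su_rep q g h r s (Poly_Mapping.single u c) = c * su_rep_word q g h u r s"
  unfolding su_rep_def by (rule linext_single[OF cspace.vector_space_axioms])

lemma su_rep_zero: "su_rep q g h r s 0 = 0"
  by (simp add: su_rep_def)

lemma su_rep_one: "su_rep q g h r s 1 = of_bool (r = s)"
  using su_rep_single[of q g h r s "[]" 1] by (simp add: single_empty)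

lemma su_rep_word_append:
  "su_rep_word q g h (u @ w) r s = su_rep_word q g h u r False * su_rep_word q g h w False s + su_rep_word q g h u r True * su_rep_word q g h w True s"
proof (induction u arbitrary: r)
  case Nil
  show ?case by (cases r) simp_all
next
  case (Cons x u)
  show ?case unfolding append_Cons su_rep_word.simps Cons.IH
    by (simp only: distrib_left distrib_right mult.assoc add_ac)
qed

lemma su_rep_mult:
  "su_rep q g h r s (x * y) = su_rep q g h r False x * su_rep q g h False s y + su_rep q g h r True x * su_rep q g h True s y"
proof (induction x rule: single_induct)
  case zero
  show ?case by (simp add: su_rep_zero)
next
  case (add x x')
  then show ?case by (simp only: distrib_right su_rep_add add_ac)
next
  case (single u c)
  show ?case
  proof (induction y rule: single_induct)
    case zero
    show ?case by (simp add: su_rep_zero)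
  next
    case (add y y')
    then show ?case by (simp only: distrib_left su_rep_add add_ac)
  next
    case (single w d)
    show ?case by (simp only: mult_single plus_list_def su_rep_single su_rep_word_append distrib_left mult_ac)
  qed
qed

lemma su_rep_rels:
  assumes q0: "q \<noteq> 0" and x: "x \<in> SU_rels q"
  shows "su_rep (complex_of_real q) g h r s x = 0"
proof -
  have "star SU_free = free_star (\<lambda>g. Poly_Mapping.single [su_bar g] 1)"
    by (simp add: SU_free_def star_free_star_alg)
  then show ?thesis
    using x q0 unfolding SU_rels_def SU_rels0_def
    by (cases r; cases s)
      (auto simp: free_star_add free_star_diff free_star_single mult_single plus_list_def zero_list_def
        su_rep_add su_rep_diff su_rep_single su_rep_one qpow_def)
qed

lemma su_rep_ideal:
  assumes q0: "q \<noteq> 0" and x: "x \<in> Idl\<^bsub>SU_free\<^esub> SU_rels q"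
  shows "su_rep (complex_of_real q) g h r s x = 0"
proof -
  let ?p = "su_rep (complex_of_real q) g h"
  let ?N = "{x. \<forall>r s. ?p r s x = 0}"
  have "ideal ?N (SUA.A :: _ star_alg)"
  proof (rule SUA.ideal_by_monomials[unfolded conv_word_monoid])
    show "- x \<in> ?N" if "x \<in> ?N" for x
      using that su_rep_scal[of _ g h _ _ "-1" x] by simp
  qed (auto simp: su_rep_zero su_rep_add su_rep_mult)
  moreover have "SU_rels q \<subseteq> ?N" using su_rep_rels[OF q0] by blast
  ultimately have "SUA.II q \<subseteq> ?N" by (rule ring.genideal_minimal[OF SUA.ring_A])
  from subsetD[OF this x[unfolded SU_free_monoid_alg]] show ?thesis by simp
qed

definition su_rep_cls :: "real \<Rightarrow> complex \<Rightarrow> complex \<Rightarrow> bool \<Rightarrow> bool \<Rightarrow> su_elem \<Rightarrow> complex" where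
  "su_rep_cls q g h r s b = su_rep (complex_of_real q) g h r s (rep b)"

lemma su_rep_cls_cls:
  assumes q0: "q \<noteq> 0"
  shows "su_rep_cls q g h r s (SU_cls q x) = su_rep (complex_of_real q) g h r s x"
proof -
  have "SU_cls q (rep (SU_cls q x)) = SU_cls q x"
    by (rule SUA.cls_rep(1)[where q = q, folded SU_free_monoid_alg, folded A_SU_def]) (rule SU_cls_carrier)
  then have "rep (SU_cls q x) - x \<in> Idl\<^bsub>SU_free\<^esub> SU_rels q"
    by (rule SUA.cls_eq_iff[where q = q, folded SU_free_monoid_alg, THEN iffD1])
  from su_rep_ideal[OF q0 this, of g h r s] show ?thesis by (simp add: su_rep_cls_def su_rep_diff)
qed

section \<open>Words in the doublets as elements of the 7-sphere\<close>

lemma vT_gen: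
  assumes q0: "q \<noteq> 0"
  shows "Sp_cls q (vT q (i, k)) \<in> carrier (A_S7 q)"
proof -
  let ?G = "gen_subalg (A_Sp q) (xgen q ` {1..4} \<union> xbar q ` {1..4})"
  have x: "c \<odot>\<^bsub>A_Sp q\<^esub> xgen q i \<in> ?G" "c \<odot>\<^bsub>A_Sp q\<^esub> xbar q i \<in> ?G" if "i \<in> {1..4}" for i c
    by (rule gen_subalg.smult, rule gen_subalg.gen, use that in blast)+
  show ?thesis
  proof (cases "i \<in> {1..4}")
    case True
    have "vmat q i 1 \<in> ?G" "vmat q i 2 \<in> ?G"
      using idx_cases[OF True] by (auto simp: vmat_def Let_def intro!: x[simplified])
    then show ?thesis using vmat_cls[OF q0 True] by (cases k) (simp_all add: A_S7_def subalg_def)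
  next
    case False
    then have "vT q (i, k) = 0" by (auto simp: vT_def)
    moreover have "0 \<odot>\<^bsub>A_Sp q\<^esub> \<one>\<^bsub>A_Sp q\<^esub> \<in> ?G" by (intro gen_subalg.smult gen_subalg.one)
    ultimately show ?thesis by (simp add: A_S7_def subalg_def Sp_cls_one Sp_cls_smult)
  qed
qed

lemma ev_gen:
  assumes q0: "q \<noteq> 0"
  shows "Sp_cls q (ev q f) \<in> carrier (A_S7 q)"
proof -
  have c: "carrier (A_S7 q) = gen_subalg (A_Sp q) (xgen q ` {1..4} \<union> xbar q ` {1..4})"
    by (simp add: A_S7_def subalg_def)
  have sm: "Sp_cls q (scal e x) \<in> carrier (A_S7 q)" if "Sp_cls q x \<in> carrier (A_S7 q)" for e x
    using that unfolding c Sp_cls_smult[symmetric] by (rule gen_subalg.smult)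
  have one: "Sp_cls q 1 \<in> carrier (A_S7 q)" unfolding c Sp_cls_one[symmetric] by (rule gen_subalg.one)
  show ?thesis
  proof (induction f rule: single_induct)
    case zero
    show ?case using sm[OF one, of 0] by simp
  next
    case (add f g)
    then show ?case unfolding ev_add c Sp_cls_add[OF ev_keys ev_keys, symmetric] by (rule gen_subalg.add)
  next
    case (single u e)
    have "Sp_cls q (ev q (monom u)) \<in> carrier (A_S7 q)"
    proof (induction u)
      case Nil
      show ?case using one by (simp add: single_empty)
    next
      case (Cons p u)
      have "ev q (monom (p # u)) = vT q p * ev q (monom u)" by (simp add: ev_single)
      then show ?case
        using Cons vT_gen[OF q0, of "fst p" "snd p"]
        unfolding c by (simp only: Sp_cls_mult[OF vT_keys ev_keys, symmetric] prod.collapse) (rule gen_subalg.mult)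
    qed
    from sm[OF this, of e] show ?case by (simp add: ev_single)
  qed
qed

lemma ev_minus [simp]: "ev q (- x) = - ev q x"
  using ev_scal[of q "-1" x] by simp

lemma S7_gens:
  assumes q0: "q \<noteq> 0" and i: "i \<in> {1..4}"
  shows "\<exists>f. xgen q i = Sp_cls q (ev q f)" "\<exists>f. xbar q i = Sp_cls q (ev q f)"
proof -
  let ?x = "\<lambda>i. if i = 1 then scal (qpow q 3) (vgen (1::nat) False) else if i = 2 then scal (qpow q 2) (vgen 1 True)
    else if i = 3 then scal (qpow q 1) (vgen 3 False) else scal (-1) (vgen 3 True)"
  let ?y = "\<lambda>i. if i = 1 then scal (qpow q 1) (vgen (2::nat) True) else if i = 2 then scal (- qpow q 1) (vgen 2 False)
    else if i = 3 then scal (-1) (vgen 4 True) else scal (-1) (vgen 4 False)"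
  have "TT i 4 = ev q (?x i)"
    using idx_cases[OF i] q0
    by (elim disjE) (simp_all add: vT_def qpow_def power_int_minus single_uminus)
  from arg_cong[OF this, of "Sp_cls q"] show "\<exists>f. xgen q i = Sp_cls q (ev q f)" unfolding xgen_cls by (rule exI)
  have "scal (uw q i * inverse (uw q 4)) (TT (5 - i) 1) = ev q (?y i)"
    using idx_cases[OF i] q0
    by (elim disjE) (simp_all add: vT_def qpow_def power_int_minus uw_def rho_def eps_def single_uminus
        divide_simps flip: power_add power_Suc, simp add: power2_eq_square)
  from arg_cong[OF this, of "Sp_cls q"] show "\<exists>f. xbar q i = Sp_cls q (ev q f)" unfolding xbar_cls[OF q0 i] by (rule exI)
qed

lemma S7_carrier:
  assumes q0: "q \<noteq> 0"
  shows "carrier (A_S7 q) = range (\<lambda>f. Sp_cls q (ev q f))"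
proof (intro equalityI subsetI)
  fix a assume "a \<in> carrier (A_S7 q)"
  then have "a \<in> gen_subalg (A_Sp q) (xgen q ` {1..4} \<union> xbar q ` {1..4})"
    by (simp add: A_S7_def subalg_def)
  then have "\<exists>f. a = Sp_cls q (ev q f)"
  proof induction
    case (gen s)
    then show ?case using S7_gens[OF q0] by blast
  next
    case one
    show ?case by (intro exI[of _ 1]) (simp add: Sp_cls_one)
  next
    case (add a b)
    then obtain f g where "a = Sp_cls q (ev q f)" "b = Sp_cls q (ev q g)" by blast
    then show ?case by (intro exI[of _ "f + g"]) (simp add: Sp_cls_add[OF ev_keys ev_keys])
  next
    case (mult a b)
    then obtain f g where "a = Sp_cls q (ev q f)" "b = Sp_cls q (ev q g)" by blast
    then show ?case by (intro exI[of _ "f * g"]) (simp add: Sp_cls_mult[OF ev_keys ev_keys])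
  next
    case (smult a c)
    then obtain f where "a = Sp_cls q (ev q f)" by blast
    then show ?case by (intro exI[of _ "scal c f"]) (simp add: Sp_cls_smult)
  qed
  then show "a \<in> range (\<lambda>f. Sp_cls q (ev q f))" by blast
next
  fix a assume "a \<in> range (\<lambda>f. Sp_cls q (ev q f))"
  then show "a \<in> carrier (A_S7 q)" using ev_gen[OF q0] by blast
qed

lemmas Sp_cls_rep = SpA.cls_rep[folded Sp_free_monoid_alg, folded A_Sp_def]

lemma carrier_S7_Sp: "q \<noteq> 0 \<Longrightarrow> a \<in> carrier (A_S7 q) \<Longrightarrow> a \<in> carrier (A_Sp q)"
  unfolding S7_carrier carrier_A_Sp using ev_keys by blast

lemma rep_keys:
  assumes "q \<noteq> 0" "a \<in> carrier (A_S7 q)"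
  shows "Poly_Mapping.keys (rep a) \<subseteq> Sp_words"
  using Sp_cls_rep(2)[OF carrier_S7_Sp[OF assms]] by (simp add: Sp_free_monoid_alg)

lemma rep_Sp_cls:
  assumes "q \<noteq> 0"
  shows "rep (Sp_cls q (ev q f)) - ev q f \<in> Sp_ideal q"
  using Sp_cls_rep(1)[OF carrier_S7_Sp[OF assms ev_gen[OF assms]]] by (simp only: Sp_cls_eq_iff)

lemma monoid_S7:
  assumes q0: "q \<noteq> 0" shows "monoid (A_S7 q)"
proof (rule monoidI)
  interpret ring "A_Sp q" by (rule ring_A_Sp)
  note c = carrier_S7_Sp[OF q0]
  show "x \<otimes>\<^bsub>A_S7 q\<^esub> y \<in> carrier (A_S7 q)" if "x \<in> carrier (A_S7 q)" "y \<in> carrier (A_S7 q)" for x y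
    using that by (auto simp: A_S7_def subalg_def intro: gen_subalg.mult)
  show "\<one>\<^bsub>A_S7 q\<^esub> \<in> carrier (A_S7 q)" by (simp add: A_S7_def subalg_def gen_subalg.one)
qed (simp_all add: carrier_S7_Sp[OF q0] monoid.m_assoc[OF ring.is_monoid[OF ring_A_Sp]]
      monoid.l_one[OF ring.is_monoid[OF ring_A_Sp]] monoid.r_one[OF ring.is_monoid[OF ring_A_Sp]])


section \<open>Functionals on the tensor product\<close>

abbreviation pair_monoid :: "real \<Rightarrow> (sp_elem \<times> su_elem) monoid" where
  "pair_monoid q \<equiv> A_S7 q \<times>\<times> A_SU q"

abbreviation pair_rels :: "real \<Rightarrow> (sp_elem \<times> su_elem \<Rightarrow>\<^sub>0 complex) set" where
  "pair_rels q \<equiv> bilinear_rels (A_S7 q) (A_SU q)"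

lemma S7_closed:
  assumes "a \<in> carrier (A_S7 q)" "b \<in> carrier (A_S7 q)"
  shows "a \<oplus>\<^bsub>A_Sp q\<^esub> b \<in> carrier (A_S7 q)" "a \<otimes>\<^bsub>A_Sp q\<^esub> b \<in> carrier (A_S7 q)" "c \<odot>\<^bsub>A_Sp q\<^esub> a \<in> carrier (A_S7 q)"
  using assms by (simp_all add: A_S7_def subalg_def gen_subalg.add gen_subalg.mult gen_subalg.smult)

lemma SU_closed:
  assumes "a \<in> carrier (A_SU q)" "b \<in> carrier (A_SU q)"
  shows "a \<oplus>\<^bsub>A_SU q\<^esub> b \<in> carrier (A_SU q)" "a \<otimes>\<^bsub>A_SU q\<^esub> b \<in> carrier (A_SU q)" "c \<odot>\<^bsub>A_SU q\<^esub> a \<in> carrier (A_SU q)"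
  using assms by (auto simp: carrier_A_SU SU_cls_add SU_cls_mult SU_cls_smult)

lemma pair_rels_keys:
  assumes "x \<in> pair_rels q" shows "Poly_Mapping.keys x \<subseteq> carrier (A_S7 q) \<times> carrier (A_SU q)"
  using assms unfolding bilinear_rels_def
  by (elim UnE CollectE exE conjE, simp_all only: A_S7_simps)
    (intro keys_diff_subset keys_single_subset SigmaI S7_closed SU_closed; assumption)+

locale quantum_sphere =
  fixes q :: real
  assumes q0: "q \<noteq> 0"
begin

sublocale P: quot_monoid_alg "pair_monoid q" "\<lambda>(a, b). Poly_Mapping.single (star (A_S7 q) a, star (A_SU q) b) 1" "pair_rels q"
proof (intro quot_monoid_alg.intro quot_monoid_alg_axioms.intro subsetI)
  show "monoid (pair_monoid q)"
    by (intro DirProd_monoid monoid_S7[OF q0] ring.is_monoid[OF ring_A_SU])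
qed (use pair_rels_keys in auto)

lemma pair_alg_P: "pair_alg (A_S7 q) (A_SU q) = P.A"
  unfolding pair_alg_def ..

abbreviation pair_cls :: "(sp_elem \<times> su_elem \<Rightarrow>\<^sub>0 complex) \<Rightarrow> (sp_elem \<times> su_elem \<Rightarrow>\<^sub>0 complex) set" where
  "pair_cls \<equiv> cls (pair_alg (A_S7 q) (A_SU q)) (pair_rels q)"

abbreviation pairs where "pairs \<equiv> carrier (A_S7 q) \<times> carrier (A_SU q)"

text \<open>The map \<open>id \<otimes> \<pi>\<^sub>r\<^sub>s\<close>, where \<open>\<pi>\<^sub>r\<^sub>s\<close> is a matrix coefficient of the triangular representation. It is defined on
formal combinations of pairs, with values in the free algebra modulo the symplectic relations.\<close>

definition Psi :: "complex \<Rightarrow> complex \<Rightarrow> bool \<Rightarrow> bool \<Rightarrow> (sp_elem \<times> su_elem \<Rightarrow>\<^sub>0 complex) \<Rightarrow> (nat \<times> nat) list \<Rightarrow>\<^sub>0 complex" where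
  "Psi g h r s = linext scal (\<lambda>(a, b). scal (su_rep_cls q g h r s b) (rep a))"

lemma Psi_add: "Psi g h r s (x + y) = Psi g h r s x + Psi g h r s y"
  and Psi_diff: "Psi g h r s (x - y) = Psi g h r s x - Psi g h r s y"
  and Psi_scal: "Psi g h r s (scal c x) = scal c (Psi g h r s x)"
  and Psi_zero: "Psi g h r s 0 = 0"
  and Psi_single: "Psi g h r s (Poly_Mapping.single (a, b) c) = scal (c * su_rep_cls q g h r s b) (rep a)"
  by (simp_all add: Psi_def pm_linext_add pm_linext_diff pm_linext_scal pm_linext_single)

lemma Psi_keys:
  assumes "Poly_Mapping.keys x \<subseteq> pairs"
  shows "Poly_Mapping.keys (Psi g h r s x) \<subseteq> Sp_words"
  unfolding Psi_def
proof (rule linext_keys)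
  fix p assume "p \<in> Poly_Mapping.keys x"
  then obtain a b where "p = (a, b)" "a \<in> carrier (A_S7 q)" using assms by auto
  then show "Poly_Mapping.keys (case p of (a, b) \<Rightarrow> scal (su_rep_cls q g h r s b) (rep a)) \<subseteq> Sp_words"
    by (simp only: prod.case) (rule order_trans[OF keys_scal rep_keys[OF q0]])
qed

lemma su_rep_cls_mult:
  assumes "b \<in> carrier (A_SU q)" "d \<in> carrier (A_SU q)"
  shows "su_rep_cls q g h r s (b \<otimes>\<^bsub>A_SU q\<^esub> d)
    = su_rep_cls q g h r False b * su_rep_cls q g h False s d + su_rep_cls q g h r True b * su_rep_cls q g h True s d"
  using assms by (auto simp: carrier_A_SU SU_cls_mult su_rep_cls_cls[OF q0] su_rep_mult)

lemma rep_mult: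
  assumes "a \<in> carrier (A_S7 q)" "b \<in> carrier (A_S7 q)"
  shows "rep (a \<otimes>\<^bsub>A_Sp q\<^esub> b) - rep a * rep b \<in> Sp_ideal q"
proof -
  have "Sp_cls q (rep (a \<otimes>\<^bsub>A_Sp q\<^esub> b)) = a \<otimes>\<^bsub>A_Sp q\<^esub> b"
    by (rule Sp_cls_rep(1)[OF carrier_S7_Sp[OF q0 S7_closed(2)[OF assms]]])
  also have "\<dots> = Sp_cls q (rep a) \<otimes>\<^bsub>A_Sp q\<^esub> Sp_cls q (rep b)"
    by (simp only: Sp_cls_rep(1)[OF carrier_S7_Sp[OF q0 assms(1)]] Sp_cls_rep(1)[OF carrier_S7_Sp[OF q0 assms(2)]])
  also have "\<dots> = Sp_cls q (rep a * rep b)"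
    by (rule Sp_cls_mult[OF rep_keys[OF q0 assms(1)] rep_keys[OF q0 assms(2)]])
  finally show ?thesis by (simp only: Sp_cls_eq_iff)
qed

lemma rep_add:
  assumes "a \<in> carrier (A_S7 q)" "b \<in> carrier (A_S7 q)"
  shows "rep (a \<oplus>\<^bsub>A_Sp q\<^esub> b) - rep a - rep b \<in> Sp_ideal q"
proof -
  have "Sp_cls q (rep (a \<oplus>\<^bsub>A_Sp q\<^esub> b)) = a \<oplus>\<^bsub>A_Sp q\<^esub> b"
    by (rule Sp_cls_rep(1)[OF carrier_S7_Sp[OF q0 S7_closed(1)[OF assms]]])
  also have "\<dots> = Sp_cls q (rep a) \<oplus>\<^bsub>A_Sp q\<^esub> Sp_cls q (rep b)"
    by (simp only: Sp_cls_rep(1)[OF carrier_S7_Sp[OF q0 assms(1)]] Sp_cls_rep(1)[OF carrier_S7_Sp[OF q0 assms(2)]])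
  also have "\<dots> = Sp_cls q (rep a + rep b)"
    by (rule Sp_cls_add[OF rep_keys[OF q0 assms(1)] rep_keys[OF q0 assms(2)]])
  finally show ?thesis by (simp only: Sp_cls_eq_iff diff_diff_eq)
qed

lemma rep_smult:
  assumes "a \<in> carrier (A_S7 q)"
  shows "rep (c \<odot>\<^bsub>A_Sp q\<^esub> a) - scal c (rep a) \<in> Sp_ideal q"
proof -
  have "Sp_cls q (rep (c \<odot>\<^bsub>A_Sp q\<^esub> a)) = c \<odot>\<^bsub>A_Sp q\<^esub> Sp_cls q (rep a)"
    by (simp only: Sp_cls_rep(1)[OF carrier_S7_Sp[OF q0 S7_closed(3)[OF assms assms]]] Sp_cls_rep(1)[OF carrier_S7_Sp[OF q0 assms]])
  then show ?thesis by (simp only: Sp_cls_smult Sp_cls_eq_iff)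
qed

text \<open>The matrix \<open>(Psi r s)\<close> is multiplicative, as \<open>\<pi>\<close> is a representation; in particular the elements on which it vanishes form an ideal.\<close>

lemma Psi_mult:
  assumes x: "Poly_Mapping.keys x \<subseteq> pairs" and y: "Poly_Mapping.keys y \<subseteq> pairs"
  shows "Psi g h r s (conv (pair_monoid q) x y)
    - (Psi g h r False x * Psi g h False s y + Psi g h r True x * Psi g h True s y) \<in> Sp_ideal q"
  using x
proof (induction x rule: keys_induct)
  case zero
  show ?case by (simp add: Psi_zero Sp_ideal_zero)
next
  case (add x x')
  show ?case using Sp_ideal_add[OF add(3,4)]
    by (simp only: conv_add_left Psi_add distrib_right diff_conv_add_uminus minus_add_distrib add_ac)
next
  case (single p c)
  note p = single
  show ?case using y
  proof (induction y rule: keys_induct)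
    case zero
    show ?case by (simp add: Psi_zero Sp_ideal_zero)
  next
    case (add y y')
    show ?case using Sp_ideal_add[OF add(3,4)]
      by (simp only: conv_add_right Psi_add distrib_left diff_conv_add_uminus minus_add_distrib add_ac)
  next
    case (single p' d)
    obtain a b where ab: "p = (a, b)" "a \<in> carrier (A_S7 q)" "b \<in> carrier (A_SU q)" using p by auto
    obtain a' b' where ab': "p' = (a', b')" "a' \<in> carrier (A_S7 q)" "b' \<in> carrier (A_SU q)" using single by auto
    let ?z = "\<lambda>t. c * d * (su_rep_cls q g h r t b * su_rep_cls q g h t s b')"
    have "scal (?z False + ?z True) (rep (a \<otimes>\<^bsub>A_Sp q\<^esub> a') - rep a * rep a') \<in> Sp_ideal q"
      by (rule Sp_ideal_scal[OF rep_mult[OF ab(2) ab'(2)]])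
    also have "scal (?z False + ?z True) (rep (a \<otimes>\<^bsub>A_Sp q\<^esub> a') - rep a * rep a')
      = scal (c * d * (su_rep_cls q g h r False b * su_rep_cls q g h False s b' + su_rep_cls q g h r True b * su_rep_cls q g h True s b'))
          (rep (a \<otimes>\<^bsub>A_Sp q\<^esub> a'))
        - (scal (c * su_rep_cls q g h r False b) (rep a) * scal (d * su_rep_cls q g h False s b') (rep a')
          + scal (c * su_rep_cls q g h r True b) (rep a) * scal (d * su_rep_cls q g h True s b') (rep a'))"
      by (simp only: pm.scale_right_diff_distrib distrib_left pm.scale_left_distrib scal_mult_left scal_mult_right
          pm.scale_scale mult_ac)
    finally show ?case
      unfolding ab(1) ab'(1) by (simp only: conv_single mult_DirProd A_S7_simps Psi_single su_rep_cls_mult[OF ab(3) ab'(3)])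
  qed
qed

lemma su_rep_cls_add:
  assumes "b \<in> carrier (A_SU q)" "d \<in> carrier (A_SU q)"
  shows "su_rep_cls q g h r s (b \<oplus>\<^bsub>A_SU q\<^esub> d) = su_rep_cls q g h r s b + su_rep_cls q g h r s d"
  using assms by (auto simp: carrier_A_SU SU_cls_add su_rep_cls_cls[OF q0] su_rep_add)

lemma su_rep_cls_smult:
  assumes "b \<in> carrier (A_SU q)"
  shows "su_rep_cls q g h r s (c \<odot>\<^bsub>A_SU q\<^esub> b) = c * su_rep_cls q g h r s b"
  using assms by (auto simp: carrier_A_SU SU_cls_smult su_rep_cls_cls[OF q0] su_rep_scal)

lemma Psi_rels:
  assumes "x \<in> pair_rels q" shows "Psi g h r s x \<in> Sp_ideal q"
  using assms unfolding bilinear_rels_def A_S7_simps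
proof (elim UnE CollectE exE conjE)
  fix a a' b assume x: "x = monom (a \<oplus>\<^bsub>A_Sp q\<^esub> a', b) - monom (a, b) - monom (a', b)"
    and a: "a \<in> carrier (A_S7 q)" "a' \<in> carrier (A_S7 q)"
  have "scal (su_rep_cls q g h r s b) (rep (a \<oplus>\<^bsub>A_Sp q\<^esub> a') - rep a - rep a') \<in> Sp_ideal q"
    by (rule Sp_ideal_scal[OF rep_add[OF a]])
  then show ?thesis unfolding x by (simp add: Psi_diff Psi_single pm.scale_right_diff_distrib)
next
  fix a b b' assume x: "x = monom (a, b \<oplus>\<^bsub>A_SU q\<^esub> b') - monom (a, b) - monom (a, b')"
    and b: "b \<in> carrier (A_SU q)" "b' \<in> carrier (A_SU q)"
  show ?thesis unfolding x by (simp add: Psi_diff Psi_single su_rep_cls_add[OF b] pm.scale_left_distrib Sp_ideal_zero)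
next
  fix c a b assume x: "x = monom (c \<odot>\<^bsub>A_Sp q\<^esub> a, b) - Poly_Mapping.single (a, b) c"
    and a: "a \<in> carrier (A_S7 q)"
  have "scal (su_rep_cls q g h r s b) (rep (c \<odot>\<^bsub>A_Sp q\<^esub> a) - scal c (rep a)) \<in> Sp_ideal q"
    by (rule Sp_ideal_scal[OF rep_smult[OF a]])
  then show ?thesis unfolding x by (simp add: Psi_diff Psi_single pm.scale_right_diff_distrib mult.commute)
next
  fix c a b assume x: "x = monom (a, c \<odot>\<^bsub>A_SU q\<^esub> b) - Poly_Mapping.single (a, b) c"
    and b: "b \<in> carrier (A_SU q)"
  show ?thesis unfolding x by (simp add: Psi_diff Psi_single su_rep_cls_smult[OF b] Sp_ideal_zero)
qed

text \<open>Hence the functionals are well defined on the tensor product.\<close>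

lemma Psi_ideal:
  assumes "x \<in> P.II" shows "Psi g h r s x \<in> Sp_ideal q"
proof -
  let ?N = "{x. Poly_Mapping.keys x \<subseteq> pairs \<and> (\<forall>r s. Psi g h r s x \<in> Sp_ideal q)}"
  have "ideal ?N P.A"
  proof (rule P.ideal_by_monomials)
    fix x assume "x \<in> ?N"
    then have x: "Poly_Mapping.keys x \<subseteq> pairs" "\<And>r s. Psi g h r s x \<in> Sp_ideal q" by auto
    show "- x \<in> ?N" using x(1) Sp_ideal_scal[OF x(2), of "-1"] Psi_scal[of g h _ _ "-1" x] by simp
    show "x + y \<in> ?N" if "y \<in> ?N" for y
      using that x order_trans[OF keys_add Un_least[OF x(1)]] by (simp add: Psi_add Sp_ideal_add)
    fix p and c :: complex assume "p \<in> carrier (pair_monoid q)"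
    then have p: "Poly_Mapping.keys (Poly_Mapping.single p c) \<subseteq> pairs" by simp
    let ?p = "Poly_Mapping.single p c"
    have "Psi g h r s (conv (pair_monoid q) ?p x) \<in> Sp_ideal q" for r s
    proof -
      have "(Psi g h r s (conv (pair_monoid q) ?p x) - (Psi g h r False ?p * Psi g h False s x + Psi g h r True ?p * Psi g h True s x))
         + (Psi g h r False ?p * Psi g h False s x + Psi g h r True ?p * Psi g h True s x) \<in> Sp_ideal q"
        by (rule Sp_ideal_add[OF Psi_mult[OF p x(1)] Sp_ideal_add[OF Sp_ideal_left[OF x(2) Psi_keys[OF p]] Sp_ideal_left[OF x(2) Psi_keys[OF p]]]])
      then show ?thesis by (simp only: diff_add_cancel)
    qed
    then show "conv (pair_monoid q) ?p x \<in> ?N" using P.conv_keys[of ?p x] p x(1) by simp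
    have "Psi g h r s (conv (pair_monoid q) x ?p) \<in> Sp_ideal q" for r s
    proof -
      have "(Psi g h r s (conv (pair_monoid q) x ?p) - (Psi g h r False x * Psi g h False s ?p + Psi g h r True x * Psi g h True s ?p))
         + (Psi g h r False x * Psi g h False s ?p + Psi g h r True x * Psi g h True s ?p) \<in> Sp_ideal q"
        by (rule Sp_ideal_add[OF Psi_mult[OF x(1) p] Sp_ideal_add[OF Sp_ideal_right[OF x(2) Psi_keys[OF p]] Sp_ideal_right[OF x(2) Psi_keys[OF p]]]])
      then show ?thesis by (simp only: diff_add_cancel)
    qed
    then show "conv (pair_monoid q) x ?p \<in> ?N" using P.conv_keys[of x ?p] p x(1) by simp
  qed (auto simp: Psi_zero Sp_ideal_zero)
  moreover have "pair_rels q \<subseteq> ?N" using pair_rels_keys Psi_rels by blast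
  ultimately have "P.II \<subseteq> ?N" by (rule ring.genideal_minimal[OF P.ring_A])
  from subsetD[OF this assms] show ?thesis by simp
qed

end


section \<open>The coaction\<close>

text \<open>The triangular matrix of operators that the coaction induces through the triangular representation.\<close>

definition Theta :: "complex \<Rightarrow> complex \<Rightarrow> complex \<Rightarrow> bool \<Rightarrow> bool \<Rightarrow> nat doublets \<Rightarrow> nat doublets" where
  "Theta q g h r s f = (if r then if s then f else 0 else if s then twisted_deriv q g h f else weight_op q f)"

lemma Theta_mult:
  "Theta q g h r s (x * y) = Theta q g h r False x * Theta q g h False s y + Theta q g h r True x * Theta q g h True s y"
  by (simp add: Theta_def weight_op_mult twisted_deriv_mult)

lemma Theta_add: "Theta q g h r s (x + y) = Theta q g h r s x + Theta q g h r s y"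
  by (simp add: Theta_def)

lemma Theta_scal: "Theta q g h r s (scal c x) = scal c (Theta q g h r s x)"
  by (simp add: Theta_def)

lemma Theta_one: "Theta q g h r s 1 = of_bool (r = s)"
  by (simp add: Theta_def)

lemma Theta_vgen:
  "Theta q g h r s (vgen i k) = scal (if r = s then if r then 1 else if k then inverse q else q else 0) (vgen i k)
    + scal (if \<not> r \<and> s then if k then h else g else 0) (vgen i (\<not> k))"
  by (simp add: Theta_def weight_op_vgen twisted_deriv_vgen)

lemma su_SU_cls: "su q x = SU_cls q (monom [x])"
  by (simp add: su_def)

lemma umat_SU_cls:
  "umat q 1 1 = SU_cls q (monom [Al])" "umat q 2 1 = SU_cls q (monom [Ga])"
  "umat q 1 2 = SU_cls q (scal (- complex_of_real q) (monom [GaBar]))" "umat q 2 2 = SU_cls q (monom [AlBar])"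
  unfolding umat_def su_SU_cls SU_cls_smult by (simp_all add: qpow_def)

lemma SU_ideal_base: "x \<in> SU_rels q \<Longrightarrow> x \<in> Idl\<^bsub>SU_free\<^esub> SU_rels q"
  unfolding SU_free_monoid_alg by (rule SUA.II_base)

text \<open>The contraction of \<open>u \<otimes> u\<close> with the skew form is the skew form; the second equation says that the
quantum determinant is \<open>1\<close>.\<close>

lemma SU_det:
  fixes q :: real
  defines "Q \<equiv> complex_of_real q"
  shows "umat q 1 1 \<otimes>\<^bsub>A_SU q\<^esub> umat q 1 2 \<oplus>\<^bsub>A_SU q\<^esub> (- Q) \<odot>\<^bsub>A_SU q\<^esub> (umat q 1 2 \<otimes>\<^bsub>A_SU q\<^esub> umat q 1 1) = 0 \<odot>\<^bsub>A_SU q\<^esub> \<one>\<^bsub>A_SU q\<^esub>"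
    and "umat q 1 1 \<otimes>\<^bsub>A_SU q\<^esub> umat q 2 2 \<oplus>\<^bsub>A_SU q\<^esub> (- Q) \<odot>\<^bsub>A_SU q\<^esub> (umat q 1 2 \<otimes>\<^bsub>A_SU q\<^esub> umat q 2 1) = 1 \<odot>\<^bsub>A_SU q\<^esub> \<one>\<^bsub>A_SU q\<^esub>"
    and "umat q 2 1 \<otimes>\<^bsub>A_SU q\<^esub> umat q 1 2 \<oplus>\<^bsub>A_SU q\<^esub> (- Q) \<odot>\<^bsub>A_SU q\<^esub> (umat q 2 2 \<otimes>\<^bsub>A_SU q\<^esub> umat q 1 1) = (- Q) \<odot>\<^bsub>A_SU q\<^esub> \<one>\<^bsub>A_SU q\<^esub>"
    and "umat q 2 1 \<otimes>\<^bsub>A_SU q\<^esub> umat q 2 2 \<oplus>\<^bsub>A_SU q\<^esub> (- Q) \<odot>\<^bsub>A_SU q\<^esub> (umat q 2 2 \<otimes>\<^bsub>A_SU q\<^esub> umat q 2 1) = 0 \<odot>\<^bsub>A_SU q\<^esub> \<one>\<^bsub>A_SU q\<^esub>"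
proof -
  let ?I = "Idl\<^bsub>SU_free\<^esub> SU_rels q"
  have eqI: "SU_cls q x = SU_cls q y" if "x - y \<in> ?I" for x y
    using that SUA.cls_eq_iff[where q = q, folded SU_free_monoid_alg] by blast
  have add: "x + y \<in> ?I" if "x \<in> ?I" "y \<in> ?I" for x y
    using SUA.II_add[where q = q, folded SU_free_monoid_alg] that by blast
  have scl: "scal c x \<in> ?I" if "x \<in> ?I" for x c
    using SUA.II_scal[where q = q, folded SU_free_monoid_alg] that by blast
  have st: "star SU_free = free_star (\<lambda>g. Poly_Mapping.single [su_bar g] 1)"
    by (simp add: SU_free_def star_free_star_alg)
  have r2: "Poly_Mapping.single [Al, GaBar] 1 - Poly_Mapping.single [GaBar, Al] Q \<in> SU_rels0 q"
    and r3: "Poly_Mapping.single [Ga, GaBar] 1 - Poly_Mapping.single [GaBar, Ga] 1 \<in> SU_rels0 q"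
    and r4: "Poly_Mapping.single [Al, AlBar] 1 + Poly_Mapping.single [GaBar, Ga] (Q ^ 2) - Poly_Mapping.single [] 1 \<in> SU_rels0 q"
    and r5: "Poly_Mapping.single [AlBar, Al] 1 + Poly_Mapping.single [GaBar, Ga] 1 - Poly_Mapping.single [] 1 \<in> SU_rels0 q"
    by (simp_all add: SU_rels0_def qpow_def Q_def)
  have base: "x \<in> ?I" if "x \<in> SU_rels0 q" for x
    by (rule SU_ideal_base) (use that in \<open>simp add: SU_rels_def\<close>)
  have s2: "Poly_Mapping.single [Ga, AlBar] 1 - Poly_Mapping.single [AlBar, Ga] Q \<in> ?I"
  proof -
    have "star SU_free (Poly_Mapping.single [Al, GaBar] 1 - Poly_Mapping.single [GaBar, Al] Q)
      = Poly_Mapping.single [Ga, AlBar] 1 - Poly_Mapping.single [AlBar, Ga] Q"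
      by (simp add: st free_star_diff free_star_single mult_single plus_list_def Q_def)
    then show ?thesis using imageI[OF r2, of "star SU_free"] by (intro SU_ideal_base) (simp add: SU_rels_def)
  qed
  note ops = umat_SU_cls SU_cls_mult SU_cls_smult SU_cls_add SU_cls_one Q_def[symmetric]
  have w: "monom [x] * monom [y] = monom [x, y]" for x y :: su_gen
    by (simp add: mult_single plus_list_def)
  show "umat q 1 1 \<otimes>\<^bsub>A_SU q\<^esub> umat q 1 2 \<oplus>\<^bsub>A_SU q\<^esub> (- Q) \<odot>\<^bsub>A_SU q\<^esub> (umat q 1 2 \<otimes>\<^bsub>A_SU q\<^esub> umat q 1 1) = 0 \<odot>\<^bsub>A_SU q\<^esub> \<one>\<^bsub>A_SU q\<^esub>"
    unfolding ops
  proof (rule eqI)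
    have "scal (- Q) (Poly_Mapping.single [Al, GaBar] 1 - Poly_Mapping.single [GaBar, Al] Q) \<in> ?I"
      by (rule scl[OF base[OF r2]])
    also have "scal (- Q) (Poly_Mapping.single [Al, GaBar] 1 - Poly_Mapping.single [GaBar, Al] Q)
      = monom [Al] * scal (- Q) (monom [GaBar]) + scal (- Q) (scal (- Q) (monom [GaBar]) * monom [Al]) - scal 0 1"
      by (simp only: scal_mult_left scal_mult_right w pm.scale_scale pm.scale_right_diff_distrib) (simp add: single_uminus)
    finally show "monom [Al] * scal (- Q) (monom [GaBar]) + scal (- Q) (scal (- Q) (monom [GaBar]) * monom [Al]) - scal 0 1 \<in> ?I" .
  qed
  show "umat q 1 1 \<otimes>\<^bsub>A_SU q\<^esub> umat q 2 2 \<oplus>\<^bsub>A_SU q\<^esub> (- Q) \<odot>\<^bsub>A_SU q\<^esub> (umat q 1 2 \<otimes>\<^bsub>A_SU q\<^esub> umat q 2 1) = 1 \<odot>\<^bsub>A_SU q\<^esub> \<one>\<^bsub>A_SU q\<^esub>"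
    unfolding ops
  proof (rule eqI)
    have "Poly_Mapping.single [Al, AlBar] 1 + Poly_Mapping.single [GaBar, Ga] (Q ^ 2) - Poly_Mapping.single [] 1
      = monom [Al] * monom [AlBar] + scal (- Q) (scal (- Q) (monom [GaBar]) * monom [Ga]) - scal 1 1"
      by (simp only: scal_mult_left scal_mult_right w pm.scale_scale) (simp add: single_empty power2_eq_square)
    then show "monom [Al] * monom [AlBar] + scal (- Q) (scal (- Q) (monom [GaBar]) * monom [Ga]) - scal 1 1 \<in> ?I"
      using base[OF r4] by (simp only:)
  qed
  show "umat q 2 1 \<otimes>\<^bsub>A_SU q\<^esub> umat q 1 2 \<oplus>\<^bsub>A_SU q\<^esub> (- Q) \<odot>\<^bsub>A_SU q\<^esub> (umat q 2 2 \<otimes>\<^bsub>A_SU q\<^esub> umat q 1 1) = (- Q) \<odot>\<^bsub>A_SU q\<^esub> \<one>\<^bsub>A_SU q\<^esub>"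
    unfolding ops
  proof (rule eqI)
    have "scal (- Q) ((Poly_Mapping.single [AlBar, Al] 1 + Poly_Mapping.single [GaBar, Ga] 1 - Poly_Mapping.single [] 1)
        + (Poly_Mapping.single [Ga, GaBar] 1 - Poly_Mapping.single [GaBar, Ga] 1)) \<in> ?I"
      by (rule scl[OF add[OF base[OF r5] base[OF r3]]])
    also have "scal (- Q) ((Poly_Mapping.single [AlBar, Al] 1 + Poly_Mapping.single [GaBar, Ga] 1 - Poly_Mapping.single [] 1)
        + (Poly_Mapping.single [Ga, GaBar] 1 - Poly_Mapping.single [GaBar, Ga] 1))
      = monom [Ga] * scal (- Q) (monom [GaBar]) + scal (- Q) (monom [AlBar] * monom [Al]) - scal (- Q) 1"
      unfolding scal_mult_right w single_empty
      by (simp only: pm.scale_right_diff_distrib pm.scale_right_distrib) (simp only: algebra_simps)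
    finally show "monom [Ga] * scal (- Q) (monom [GaBar]) + scal (- Q) (monom [AlBar] * monom [Al]) - scal (- Q) 1 \<in> ?I" .
  qed
  show "umat q 2 1 \<otimes>\<^bsub>A_SU q\<^esub> umat q 2 2 \<oplus>\<^bsub>A_SU q\<^esub> (- Q) \<odot>\<^bsub>A_SU q\<^esub> (umat q 2 2 \<otimes>\<^bsub>A_SU q\<^esub> umat q 2 1) = 0 \<odot>\<^bsub>A_SU q\<^esub> \<one>\<^bsub>A_SU q\<^esub>"
    unfolding ops
  proof (rule eqI)
    have "Poly_Mapping.single [Ga, AlBar] 1 - Poly_Mapping.single [AlBar, Ga] Q
      = monom [Ga] * monom [AlBar] + scal (- Q) (monom [AlBar] * monom [Ga]) - scal 0 1"
      by (simp add: w single_uminus)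
    then show "monom [Ga] * monom [AlBar] + scal (- Q) (monom [AlBar] * monom [Ga]) - scal 0 1 \<in> ?I"
      using s2 by (simp only:)
  qed
qed

locale sphere_coaction = quantum_sphere +
  fixes \<delta> :: "sp_elem \<Rightarrow> (sp_elem \<times> su_elem \<Rightarrow>\<^sub>0 complex) set"
  assumes coaction: "is_right_coaction q \<delta>"
begin

abbreviation "tensors \<equiv> tensor_alg (A_S7 q) (A_SU q)"

lemma tensors_B: "tensors = quot_alg P.A (pair_rels q)"
  unfolding tensor_alg_def pair_alg_P ..

lemma pair_cls_mult: "Poly_Mapping.keys x \<subseteq> pairs \<Longrightarrow> Poly_Mapping.keys y \<subseteq> pairs \<Longrightarrow>
    pair_cls x \<otimes>\<^bsub>tensors\<^esub> pair_cls y = pair_cls (conv (pair_monoid q) x y)"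
  using P.mult_B[of x y] unfolding tensors_B pair_alg_P by simp

lemma pair_cls_add: "Poly_Mapping.keys x \<subseteq> pairs \<Longrightarrow> Poly_Mapping.keys y \<subseteq> pairs \<Longrightarrow>
    pair_cls x \<oplus>\<^bsub>tensors\<^esub> pair_cls y = pair_cls (x + y)"
  using P.add_B[of x y] unfolding tensors_B pair_alg_P by simp

lemma pair_cls_smult: "c \<odot>\<^bsub>tensors\<^esub> pair_cls x = pair_cls (scal c x)"
  using P.smult_B[of c x] unfolding tensors_B pair_alg_P .

lemma pair_cls_one: "\<one>\<^bsub>tensors\<^esub> = pair_cls (monom (\<one>\<^bsub>A_Sp q\<^esub>, \<one>\<^bsub>A_SU q\<^esub>))"
  using P.B_simps(2) unfolding tensors_B pair_alg_P by simp

lemma pair_cls_eq_iff: "pair_cls x = pair_cls y \<longleftrightarrow> x - y \<in> P.II"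
  using P.cls_eq_iff unfolding pair_alg_P .

lemma tensor_pair_cls: "tensor (A_S7 q) (A_SU q) a b = pair_cls (monom (a, b))"
  by (simp add: tensor_def)

lemma one_SU_carrier: "\<one>\<^bsub>A_SU q\<^esub> \<in> carrier (A_SU q)"
  by (simp add: SU_cls_one)

lemma delta_hom:
  assumes "a \<in> carrier (A_S7 q)" "b \<in> carrier (A_S7 q)"
  shows "\<delta> (a \<oplus>\<^bsub>A_Sp q\<^esub> b) = \<delta> a \<oplus>\<^bsub>tensors\<^esub> \<delta> b" "\<delta> (a \<otimes>\<^bsub>A_Sp q\<^esub> b) = \<delta> a \<otimes>\<^bsub>tensors\<^esub> \<delta> b"
    "\<delta> (c \<odot>\<^bsub>A_Sp q\<^esub> a) = c \<odot>\<^bsub>tensors\<^esub> \<delta> a" "\<delta> \<one>\<^bsub>A_Sp q\<^esub> = \<one>\<^bsub>tensors\<^esub>"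
proof -
  have r: "\<delta> \<in> ring_hom (A_S7 q) tensors"
    and s: "\<And>c a. a \<in> carrier (A_S7 q) \<Longrightarrow> \<delta> (c \<odot>\<^bsub>A_S7 q\<^esub> a) = c \<odot>\<^bsub>tensors\<^esub> \<delta> a"
    using coaction unfolding is_right_coaction_def star_alg_hom_def by auto
  show "\<delta> (a \<oplus>\<^bsub>A_Sp q\<^esub> b) = \<delta> a \<oplus>\<^bsub>tensors\<^esub> \<delta> b" "\<delta> (a \<otimes>\<^bsub>A_Sp q\<^esub> b) = \<delta> a \<otimes>\<^bsub>tensors\<^esub> \<delta> b"
    "\<delta> (c \<odot>\<^bsub>A_Sp q\<^esub> a) = c \<odot>\<^bsub>tensors\<^esub> \<delta> a" "\<delta> \<one>\<^bsub>A_Sp q\<^esub> = \<one>\<^bsub>tensors\<^esub>"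
    using ring_hom_add[OF r assms] ring_hom_mult[OF r assms] ring_hom_one[OF r] s[OF assms(1)]
    by (simp_all only: A_S7_simps)
qed

abbreviation vcls where "vcls i k \<equiv> Sp_cls q (vT q (i, k))"

lemma delta_V:
  assumes i: "i \<in> {1..4}"
  shows "\<delta> (vcls i k) = pair_cls (monom (vcls i False, umat q 1 (if k then 2 else 1)) + monom (vcls i True, umat q 2 (if k then 2 else 1)))"
proof -
  have u: "umat q a b \<in> carrier (A_SU q)" if "a \<in> {1, 2}" "b \<in> {1, 2}" for a b
    using that umat_SU_cls[of q] by auto
  have k: "Poly_Mapping.keys (monom (vcls i r, umat q a b)) \<subseteq> pairs" if "a \<in> {1, 2}" "b \<in> {1, 2}" for r a b
    using that by (simp add: u vT_gen[OF q0])
  have "\<forall>j\<in>{1..2}. \<delta> (vmat q i j) =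
        tensor (A_S7 q) (A_SU q) (vmat q i 1) (umat q 1 j) \<oplus>\<^bsub>tensors\<^esub> tensor (A_S7 q) (A_SU q) (vmat q i 2) (umat q 2 j)"
    using coaction i unfolding is_right_coaction_def by blast
  then have "\<delta> (vmat q i j) = pair_cls (monom (vcls i False, umat q 1 j) + monom (vcls i True, umat q 2 j))" if "j \<in> {1, 2}" for j
    using that pair_cls_add[OF k k, of 1 j 2 j False True] unfolding tensor_pair_cls vmat_cls[OF q0 i] by auto
  from this[of 1] this[of 2] show ?thesis
    unfolding vmat_cls[OF q0 i] by (cases k) simp_all
qed

text \<open>A combination of pairs \<open>y\<close> that represents the coaction on the word polynomial \<open>f\<close> and has the expected
functionals. The latter are multiplicative, so it suffices to find \<open>y\<close> for the generators.\<close>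

definition represents :: "complex \<Rightarrow> complex \<Rightarrow> nat doublets \<Rightarrow> (sp_elem \<times> su_elem \<Rightarrow>\<^sub>0 complex) \<Rightarrow> bool" where
  "represents g h f y \<longleftrightarrow> Poly_Mapping.keys y \<subseteq> pairs \<and> \<delta> (Sp_cls q (ev q f)) = pair_cls y \<and>
     (\<forall>r s. Psi g h r s y - ev q (Theta (complex_of_real q) g h r s f) \<in> Sp_ideal q)"

lemma represents_add:
  assumes "represents g h f x" "represents g h f' y"
  shows "represents g h (f + f') (x + y)"
proof -
  note xy = assms[unfolded represents_def]
  have "\<delta> (Sp_cls q (ev q (f + f'))) = pair_cls (x + y)"
    using xy delta_hom(1)[OF ev_gen[OF q0, of f] ev_gen[OF q0, of f']]
    by (simp add: Sp_cls_add[OF ev_keys ev_keys] pair_cls_add)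
  moreover have "Psi g h r s (x + y) - ev q (Theta (complex_of_real q) g h r s (f + f')) \<in> Sp_ideal q" for r s
    using Sp_ideal_add[of "Psi g h r s x - ev q (Theta (complex_of_real q) g h r s f)" q
        "Psi g h r s y - ev q (Theta (complex_of_real q) g h r s f')"] xy
    by (simp add: Psi_add Theta_add add_diff_add)
  ultimately show ?thesis
    using xy order_trans[OF keys_add Un_least] unfolding represents_def by blast
qed

lemma represents_scal:
  assumes "represents g h f x"
  shows "represents g h (scal c f) (scal c x)"
proof -
  note x = assms[unfolded represents_def]
  have "\<delta> (Sp_cls q (ev q (scal c f))) = pair_cls (scal c x)"
    using x delta_hom(3)[OF ev_gen[OF q0, of f] ev_gen[OF q0, of f]]
    by (simp add: Sp_cls_smult pair_cls_smult)
  moreover have "Psi g h r s (scal c x) - ev q (Theta (complex_of_real q) g h r s (scal c f)) \<in> Sp_ideal q" for r s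
    using Sp_ideal_scal[of "Psi g h r s x - ev q (Theta (complex_of_real q) g h r s f)" q c] x
    by (simp add: Psi_scal Theta_scal pm.scale_right_diff_distrib)
  ultimately show ?thesis
    using x order_trans[OF keys_scal] unfolding represents_def by blast
qed

lemma represents_one: "represents g h 1 (monom (\<one>\<^bsub>A_Sp q\<^esub>, \<one>\<^bsub>A_SU q\<^esub>))"
proof -
  have one: "\<one>\<^bsub>A_Sp q\<^esub> = Sp_cls q (ev q 1)" by (simp add: Sp_cls_one)
  have p: "su_rep_cls q g h r s \<one>\<^bsub>A_SU q\<^esub> = of_bool (r = s)" for r s
    by (simp add: SU_cls_one su_rep_cls_cls[OF q0] su_rep_one)
  have "Psi g h r s (monom (\<one>\<^bsub>A_Sp q\<^esub>, \<one>\<^bsub>A_SU q\<^esub>)) - ev q (Theta (complex_of_real q) g h r s 1) \<in> Sp_ideal q" for r s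
    using rep_Sp_cls[OF q0, of 1] unfolding one
    by (cases "r = s") (simp_all add: Psi_single p Theta_one Sp_ideal_zero)
  moreover have "\<delta> (Sp_cls q (ev q 1)) = pair_cls (monom (\<one>\<^bsub>A_Sp q\<^esub>, \<one>\<^bsub>A_SU q\<^esub>))"
    using delta_hom(4)[OF ev_gen[OF q0, of 1] ev_gen[OF q0, of 1]] by (simp add: Sp_cls_one pair_cls_one)
  ultimately show ?thesis
    using ev_gen[OF q0, of 1] one_SU_carrier unfolding represents_def by (simp add: Sp_cls_one)
qed

lemma represents_zero: "represents g h 0 0"
  using represents_scal[OF represents_one, of g h 0] by simp

lemma represents_mult:
  assumes "represents g h f x" "represents g h f' y"
  shows "represents g h (f * f') (conv (pair_monoid q) x y)"
proof -
  note x = assms(1)[unfolded represents_def] and y = assms(2)[unfolded represents_def]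
  let ?Q = "complex_of_real q"
  have kx: "Poly_Mapping.keys x \<subseteq> pairs" and ky: "Poly_Mapping.keys y \<subseteq> pairs" using x y by auto
  have "\<delta> (Sp_cls q (ev q (f * f'))) = pair_cls (conv (pair_monoid q) x y)"
    using x y delta_hom(2)[OF ev_gen[OF q0, of f] ev_gen[OF q0, of f']]
    by (simp add: Sp_cls_mult[OF ev_keys ev_keys] pair_cls_mult)
  moreover have "Psi g h r s (conv (pair_monoid q) x y) - ev q (Theta ?Q g h r s (f * f')) \<in> Sp_ideal q" for r s
  proof -
    have d: "Psi g h r t x * Psi g h t s y - ev q (Theta ?Q g h r t f) * ev q (Theta ?Q g h t s f') \<in> Sp_ideal q" for t
    proof -
      have "(Psi g h r t x - ev q (Theta ?Q g h r t f)) * Psi g h t s y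
        + ev q (Theta ?Q g h r t f) * (Psi g h t s y - ev q (Theta ?Q g h t s f')) \<in> Sp_ideal q"
        using x y by (intro Sp_ideal_add Sp_ideal_right[OF _ Psi_keys[OF ky]] Sp_ideal_left[OF _ ev_keys]) blast+
      then show ?thesis by (simp add: left_diff_distrib right_diff_distrib)
    qed
    have "(Psi g h r s (conv (pair_monoid q) x y) - (Psi g h r False x * Psi g h False s y + Psi g h r True x * Psi g h True s y))
      + ((Psi g h r False x * Psi g h False s y - ev q (Theta ?Q g h r False f) * ev q (Theta ?Q g h False s f'))
      + (Psi g h r True x * Psi g h True s y - ev q (Theta ?Q g h r True f) * ev q (Theta ?Q g h True s f'))) \<in> Sp_ideal q"
      by (rule Sp_ideal_add[OF Psi_mult[OF kx ky] Sp_ideal_add[OF d d]])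
    then show ?thesis by (simp add: Theta_mult algebra_simps)
  qed
  ultimately show ?thesis
    using P.conv_keys[of x y] kx ky unfolding represents_def by simp
qed

lemma represents_vgen: "\<exists>y. represents g h (vgen i k) y"
proof (cases "i \<in> {1..4}")
  case True
  let ?j = "if k then 2 else 1"
  let ?y = "monom (vcls i False, umat q 1 ?j) + monom (vcls i True, umat q 2 ?j)"
  have u: "umat q a ?j \<in> carrier (A_SU q)" if "a \<in> {1, 2}" for a
    using that umat_SU_cls[of q] by auto
  have "Poly_Mapping.keys ?y \<subseteq> pairs"
    by (intro order_trans[OF keys_add] Un_least keys_single_subset) (simp_all add: vT_gen[OF q0] u del: One_nat_def)
  moreover have "\<delta> (Sp_cls q (ev q (vgen i k))) = pair_cls ?y"
    using delta_V[OF True, of k] by simp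
  moreover have "Psi g h r s ?y - ev q (Theta (complex_of_real q) g h r s (vgen i k)) \<in> Sp_ideal q" for r s
  proof -
    let ?d = "\<lambda>l. rep (vcls i l) - vT q (i, l)"
    have d: "?d l \<in> Sp_ideal q" for l using rep_Sp_cls[OF q0, of "vgen i l"] by simp
    have "scal (su_rep_cls q g h r s (umat q 1 ?j)) (?d False) + scal (su_rep_cls q g h r s (umat q 2 ?j)) (?d True) \<in> Sp_ideal q"
      by (intro Sp_ideal_add Sp_ideal_scal d)
    also have "scal (su_rep_cls q g h r s (umat q 1 ?j)) (?d False) + scal (su_rep_cls q g h r s (umat q 2 ?j)) (?d True)
      = Psi g h r s ?y - ev q (Theta (complex_of_real q) g h r s (vgen i k))"
    proof (cases k)
      case True
      have c1: "su_rep_cls q g h r s (umat q 1 2) = (if \<not> r \<and> s then h else 0)"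
        unfolding umat_SU_cls su_rep_cls_cls[OF q0] su_rep_scal su_rep_single using q0 by simp
      have c2: "su_rep_cls q g h r s (umat q 2 2) = (if r = s then if r then 1 else inverse (complex_of_real q) else 0)"
        unfolding umat_SU_cls su_rep_cls_cls[OF q0] su_rep_single by (cases r; cases s) simp_all
      show ?thesis
        using True by (simp add: Psi_add Psi_single Theta_vgen c1 c2 pm.scale_right_diff_distrib del: One_nat_def)
    next
      case False
      have c1: "su_rep_cls q g h r s (umat q 2 1) = (if \<not> r \<and> s then g else 0)"
        unfolding umat_SU_cls su_rep_cls_cls[OF q0] su_rep_single by (cases r; cases s) simp_all
      have c2: "su_rep_cls q g h r s (umat q 1 1) = (if r = s then if r then 1 else complex_of_real q else 0)"
        unfolding umat_SU_cls su_rep_cls_cls[OF q0] su_rep_single by (cases r; cases s) simp_all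
      show ?thesis
        using False by (simp add: Psi_add Psi_single Theta_vgen c1 c2 pm.scale_right_diff_distrib del: One_nat_def)
    qed
    finally show ?thesis .
  qed
  ultimately show ?thesis unfolding represents_def by blast
next
  case False
  then have "vT q (i, l) = 0" for l by (auto simp: vT_def)
  then have "represents g h (vgen i k) 0"
    using represents_zero[of g h] unfolding represents_def by (simp add: Theta_vgen Psi_zero Sp_ideal_zero)
  then show ?thesis by blast
qed

lemma ex_represents: "\<exists>y. represents g h f y"
proof (induction f rule: single_induct)
  case (single u c)
  have "\<exists>y. represents g h (monom u) y"
  proof (induction u)
    case Nil
    show ?case using represents_one by (auto simp: single_empty)
  next
    case (Cons p u)
    then show ?case
      using represents_vgen[of g h "fst p" "snd p"] represents_mult[of g h "vgen (fst p) (snd p)" _ "monom u"]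
      by (subst monom_Cons) (auto simp: vgen_def)
  qed
  then show ?case using represents_scal[of g h "monom u" _ c] by auto
qed (use represents_zero represents_add in blast)+

text \<open>The off-diagonal functional is a twisted derivative of \<open>f\<close> on one side; on \<open>f \<otimes> 1\<close> it vanishes, as \<open>\<pi>(1)\<close> is the identity matrix.\<close>

lemma coinvariant_twisted_deriv:
  assumes "\<delta> (Sp_cls q (ev q f)) = tensor (A_S7 q) (A_SU q) (Sp_cls q (ev q f)) \<one>\<^bsub>A_SU q\<^esub>"
  shows "twisted_deriv (complex_of_real q) g h f \<in> vrel_ideal q"
proof -
  obtain y where y: "represents g h f y" using ex_represents by blast
  then have "pair_cls y = pair_cls (monom (Sp_cls q (ev q f), \<one>\<^bsub>A_SU q\<^esub>))"
    using assms unfolding represents_def tensor_pair_cls by metis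
  then have "y - monom (Sp_cls q (ev q f), \<one>\<^bsub>A_SU q\<^esub>) \<in> P.II"
    by (simp only: pair_cls_eq_iff)
  from Psi_ideal[OF this, of g h False True] have "Psi g h False True y \<in> Sp_ideal q"
    by (simp add: Psi_diff Psi_single SU_cls_one su_rep_cls_cls[OF q0] su_rep_one)
  from Sp_ideal_diff[OF this] y
  have "Psi g h False True y - (Psi g h False True y - ev q (Theta (complex_of_real q) g h False True f)) \<in> Sp_ideal q"
    unfolding represents_def by blast
  then show ?thesis by (simp add: vrel_ideal_def Theta_def)
qed

text \<open>The derivations descend to the 7-sphere because the coaction is a map on it: a relation and \<open>0\<close> have the same image.\<close>

lemma twisted_deriv_vrel_ideal:
  assumes "f \<in> vrel_ideal q" shows "twisted_deriv (complex_of_real q) g h f \<in> vrel_ideal q"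
proof -
  obtain y where y: "represents g h f y" using ex_represents by blast
  have "Sp_cls q (ev q f) = Sp_cls q (ev q 0)" using assms by (simp add: Sp_cls_eq_iff vrel_ideal_def)
  then have "y - 0 \<in> P.II"
    using y represents_zero[of g h] unfolding represents_def by (metis pair_cls_eq_iff)
  from Psi_ideal[OF this, of g h False True] have "Psi g h False True y \<in> Sp_ideal q" by simp
  from Sp_ideal_diff[OF this] y
  have "Psi g h False True y - (Psi g h False True y - ev q (Theta (complex_of_real q) g h False True f)) \<in> Sp_ideal q"
    unfolding represents_def by blast
  then show ?thesis by (simp add: vrel_ideal_def Theta_def)
qed

sublocale fft: doublet_fft "complex_of_real q" "vrel_ideal q"
proof (intro doublet_fft.intro doublet_fft_axioms.intro doublet_ideal_vrel_ideal[OF q0])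
qed (simp_all add: passes_vrel_ideal[OF q0] twisted_deriv_vrel_ideal)

lemma coinvariant_in_minors:
  assumes "\<delta> (Sp_cls q (ev q f)) = tensor (A_S7 q) (A_SU q) (Sp_cls q (ev q f)) \<one>\<^bsub>A_SU q\<^esub>"
  shows "\<exists>b\<in>minors (complex_of_real q). Sp_cls q (ev q f) = Sp_cls q (ev q b)"
proof -
  obtain b where "b \<in> minors (complex_of_real q)" "f - b \<in> vrel_ideal q"
    using fft.invariants_are_minors coinvariant_twisted_deriv[OF assms] by blast
  then show ?thesis by (intro bexI[of _ b]) (simp_all add: Sp_cls_eq_iff vrel_ideal_def)
qed

abbreviation coinvariant :: "sp_elem \<Rightarrow> bool" where
  "coinvariant a \<equiv> \<delta> a = pair_cls (monom (a, \<one>\<^bsub>A_SU q\<^esub>))"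

lemma rels_P:
  assumes a: "a \<in> carrier (A_S7 q)" "a' \<in> carrier (A_S7 q)" and b: "b \<in> carrier (A_SU q)" "b' \<in> carrier (A_SU q)"
  shows "monom (a \<oplus>\<^bsub>A_Sp q\<^esub> a', b) - monom (a, b) - monom (a', b) \<in> P.II"
    and "monom (a, b \<oplus>\<^bsub>A_SU q\<^esub> b') - monom (a, b) - monom (a, b') \<in> P.II"
    and "monom (c \<odot>\<^bsub>A_Sp q\<^esub> a, b) - scal c (monom (a, b)) \<in> P.II"
    and "monom (a, c \<odot>\<^bsub>A_SU q\<^esub> b) - scal c (monom (a, b)) \<in> P.II"
  by (rule P.II_base; unfold bilinear_rels_def A_S7_simps scal_single mult_1_right; use assms in blast)+

lemma coinvariant_add:
  assumes "a \<in> carrier (A_S7 q)" "b \<in> carrier (A_S7 q)" "coinvariant a" "coinvariant b"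
  shows "coinvariant (a \<oplus>\<^bsub>A_Sp q\<^esub> b)"
proof -
  have "\<delta> (a \<oplus>\<^bsub>A_Sp q\<^esub> b) = pair_cls (monom (a, \<one>\<^bsub>A_SU q\<^esub>) + monom (b, \<one>\<^bsub>A_SU q\<^esub>))"
    using assms one_SU_carrier by (simp add: delta_hom(1) pair_cls_add)
  also have "\<dots> = pair_cls (monom (a \<oplus>\<^bsub>A_Sp q\<^esub> b, \<one>\<^bsub>A_SU q\<^esub>))"
    unfolding pair_cls_eq_iff
    using P.II_diff[OF P.II_zero rels_P(1)[OF assms(1,2) one_SU_carrier one_SU_carrier]] by (simp add: algebra_simps)
  finally show ?thesis .
qed

lemma coinvariant_mult:
  assumes "a \<in> carrier (A_S7 q)" "b \<in> carrier (A_S7 q)" "coinvariant a" "coinvariant b"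
  shows "coinvariant (a \<otimes>\<^bsub>A_Sp q\<^esub> b)"
proof -
  have "\<one>\<^bsub>A_SU q\<^esub> \<otimes>\<^bsub>A_SU q\<^esub> \<one>\<^bsub>A_SU q\<^esub> = \<one>\<^bsub>A_SU q\<^esub>" by (simp add: SU_cls_one SU_cls_mult)
  then show ?thesis
    using assms one_SU_carrier by (simp add: delta_hom(2) pair_cls_mult)
qed

lemma coinvariant_smult:
  assumes "a \<in> carrier (A_S7 q)" "coinvariant a"
  shows "coinvariant (c \<odot>\<^bsub>A_Sp q\<^esub> a)"
proof -
  have "\<delta> (c \<odot>\<^bsub>A_Sp q\<^esub> a) = pair_cls (scal c (monom (a, \<one>\<^bsub>A_SU q\<^esub>)))"
    using assms by (simp add: delta_hom(3)[OF assms(1) assms(1)] pair_cls_smult)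
  also have "\<dots> = pair_cls (monom (c \<odot>\<^bsub>A_Sp q\<^esub> a, \<one>\<^bsub>A_SU q\<^esub>))"
    unfolding pair_cls_eq_iff
    using P.II_scal[OF rels_P(3)[OF assms(1,1) one_SU_carrier one_SU_carrier], of "-1" c] by simp
  finally show ?thesis .
qed

lemma coinvariant_one: "coinvariant \<one>\<^bsub>A_Sp q\<^esub>"
  using delta_hom(4)[OF ev_gen[OF q0, of 1] ev_gen[OF q0, of 1]] by (simp add: pair_cls_one)

text \<open>The coaction of \<open>m\<^sub>i\<^sub>j\<close> has four terms \<open>v\<^sub>i\<^sub>k v\<^sub>j\<^sub>l \<otimes> (u\<^sub>k\<^sub>1 u\<^sub>l\<^sub>2 - q u\<^sub>k\<^sub>2 u\<^sub>l\<^sub>1)\<close>, and the second factors are the entries of the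
skew form.\<close>

lemma coinvariant_minor:
  assumes i: "i \<in> {1..4}" and j: "j \<in> {1..4}"
  shows "coinvariant (Sp_cls q (ev q (minor (complex_of_real q) i j)))"
proof -
  let ?Q = "complex_of_real q"
  let ?one = "\<one>\<^bsub>A_SU q\<^esub>"
  define W where "W k l = vcls i k \<otimes>\<^bsub>A_Sp q\<^esub> vcls j l" for k l
  define U where "U k l = umat q (if k then 2 else 1) (if l then 2 else 1)" for k l
  have Vc: "vcls i k \<in> carrier (A_S7 q)" for i k by (rule vT_gen[OF q0])
  have Wc: "W k l \<in> carrier (A_S7 q)" for k l unfolding W_def by (rule S7_closed(2)[OF Vc Vc])
  have Uc: "U k l \<in> carrier (A_SU q)" for k l
    unfolding U_def using umat_SU_cls[of q] by (cases k; cases l) auto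
  have dV: "\<delta> (vcls i k) = pair_cls (monom (vcls i False, U False k) + monom (vcls i True, U True k))" if "i \<in> {1..4}" for i k
    unfolding U_def using delta_V[OF that, of k] by simp
  have kV: "Poly_Mapping.keys (monom (vcls i False, U False k) + monom (vcls i True, U True k)) \<subseteq> pairs" for i k
    by (intro order_trans[OF keys_add] Un_least keys_single_subset) (simp_all only: mem_Times_iff fst_conv snd_conv Vc Uc)
  define Z where "Z k l = monom (W k l, U k False \<otimes>\<^bsub>A_SU q\<^esub> U l True)
    + scal (- ?Q) (monom (W k l, U k True \<otimes>\<^bsub>A_SU q\<^esub> U l False))" for k l
  define e where "e k l = (if k = l then 0 else if l then 1 else - ?Q)" for k l :: bool
  (* the term with v_ik v_jl, evaluated by the determinant relations in the second tensor factor *)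
  have Z: "Z k l - scal (e k l) (monom (W k l, ?one)) \<in> P.II" for k l
  proof -
    let ?s = "U k False \<otimes>\<^bsub>A_SU q\<^esub> U l True" and ?t = "U k True \<otimes>\<^bsub>A_SU q\<^esub> U l False"
    have det: "?s \<oplus>\<^bsub>A_SU q\<^esub> (- ?Q) \<odot>\<^bsub>A_SU q\<^esub> ?t = e k l \<odot>\<^bsub>A_SU q\<^esub> ?one"
      unfolding U_def e_def using SU_det[of q] by (cases k; cases l) simp_all
    have sc: "?s \<in> carrier (A_SU q)" and tc: "?t \<in> carrier (A_SU q)" by (rule SU_closed(2)[OF Uc Uc])+
    note r1 = rels_P(4)[OF Wc[of k l] Wc[of k l] tc tc, of "- ?Q"]
    note r2 = rels_P(2)[OF Wc[of k l] Wc[of k l] sc SU_closed(3)[OF tc tc, of "- ?Q"], unfolded det]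
    note r3 = rels_P(4)[OF Wc[of k l] Wc[of k l] one_SU_carrier one_SU_carrier, of "e k l"]
    let ?B = "(monom (W k l, e k l \<odot>\<^bsub>A_SU q\<^esub> ?one) - scal (e k l) (monom (W k l, ?one)))
      - (monom (W k l, e k l \<odot>\<^bsub>A_SU q\<^esub> ?one) - monom (W k l, ?s) - monom (W k l, (- ?Q) \<odot>\<^bsub>A_SU q\<^esub> ?t))
      - (monom (W k l, (- ?Q) \<odot>\<^bsub>A_SU q\<^esub> ?t) - scal (- ?Q) (monom (W k l, ?t)))"
    have "?B \<in> P.II"
      by (rule P.II_diff[OF P.II_diff[OF r3 r2] r1])
    also have "?B = Z k l - scal (e k l) (monom (W k l, ?one))"
      unfolding Z_def by (simp only: diff_conv_add_uminus minus_add_distrib minus_minus add_ac) simp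
    finally show ?thesis .
  qed
  have m: "Sp_cls q (ev q (minor ?Q i j)) = W False True \<oplus>\<^bsub>A_Sp q\<^esub> (- ?Q) \<odot>\<^bsub>A_Sp q\<^esub> W True False"
  proof -
    have "ev q (minor ?Q i j) = vT q (i, False) * vT q (j, True) + scal (- ?Q) (vT q (i, True) * vT q (j, False))"
      by (simp add: minor_def)
    then show ?thesis
      unfolding W_def by (simp only: Sp_cls_mult[OF vT_keys vT_keys] Sp_cls_smult
          Sp_cls_add[OF keys_times_lists order_trans[OF keys_scal keys_times_lists], OF vT_keys vT_keys vT_keys vT_keys])
  qed
  let ?m = "W False True \<oplus>\<^bsub>A_Sp q\<^esub> (- ?Q) \<odot>\<^bsub>A_Sp q\<^esub> W True False"
  let ?X = "Z False False + Z False True + Z True False + Z True True"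
  have dW: "\<delta> (W k l) = pair_cls (monom (W False False, U False k \<otimes>\<^bsub>A_SU q\<^esub> U False l) + monom (W False True, U False k \<otimes>\<^bsub>A_SU q\<^esub> U True l)
      + monom (W True False, U True k \<otimes>\<^bsub>A_SU q\<^esub> U False l) + monom (W True True, U True k \<otimes>\<^bsub>A_SU q\<^esub> U True l))" for k l
    unfolding W_def delta_hom(2)[OF Vc Vc] dV[OF i] dV[OF j] pair_cls_mult[OF kV kV]
    by (simp only: conv_add_left conv_add_right conv_single mult_DirProd A_S7_simps mult_1_right add_ac)
  have kW: "Poly_Mapping.keys (monom (W False False, U False k \<otimes>\<^bsub>A_SU q\<^esub> U False l) + monom (W False True, U False k \<otimes>\<^bsub>A_SU q\<^esub> U True l)
      + monom (W True False, U True k \<otimes>\<^bsub>A_SU q\<^esub> U False l) + monom (W True True, U True k \<otimes>\<^bsub>A_SU q\<^esub> U True l)) \<subseteq> pairs" for k l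
    by (intro order_trans[OF keys_add] Un_least keys_single_subset) (simp_all only: mem_Times_iff fst_conv snd_conv Wc SU_closed(2)[OF Uc Uc])
  have "\<delta> ?m = pair_cls ?X"
    unfolding delta_hom(1)[OF Wc S7_closed(3)[OF Wc Wc]] delta_hom(3)[OF Wc Wc] dW pair_cls_smult
      pair_cls_add[OF kW order_trans[OF keys_scal kW]]
    unfolding Z_def pm.scale_right_distrib by (simp only: add_ac)
  also have "\<dots> = pair_cls (monom (?m, ?one))"
    unfolding pair_cls_eq_iff
  proof -
    note r1 = rels_P(1)[OF Wc[of False True] S7_closed(3)[OF Wc Wc, of "- ?Q" True False] one_SU_carrier one_SU_carrier]
    note r2 = rels_P(3)[OF Wc[of True False] Wc[of True False] one_SU_carrier one_SU_carrier, of "- ?Q"]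
    have "(Z False False - scal (e False False) (monom (W False False, ?one)))
      + (Z False True - scal (e False True) (monom (W False True, ?one)))
      + (Z True False - scal (e True False) (monom (W True False, ?one)))
      + (Z True True - scal (e True True) (monom (W True True, ?one)))
      - (monom (?m, ?one) - monom (W False True, ?one) - monom ((- ?Q) \<odot>\<^bsub>A_Sp q\<^esub> W True False, ?one))
      - (monom ((- ?Q) \<odot>\<^bsub>A_Sp q\<^esub> W True False, ?one) - scal (- ?Q) (monom (W True False, ?one))) \<in> P.II"
      by (intro P.II_diff P.II_add Z r1 r2)
    then show "?X - monom (?m, ?one) \<in> P.II"
      by (simp add: e_def algebra_simps del: scal_single)
  qed
  finally show ?thesis unfolding m .
qed

lemma partner_range: "j \<in> {1..4} \<Longrightarrow> partner j \<in> {1..4}"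
  by (simp add: partner_def)

lemma S4_carrier_coinvariant:
  assumes "a \<in> carrier (A_S4 q)"
  shows "a \<in> carrier (A_S7 q) \<and> coinvariant a"
proof -
  have "a \<in> gen_subalg (A_S7 q) {pmat q i j | i j. i \<in> {1..4} \<and> j \<in> {1..4}}"
    using assms by (simp add: A_S4_def subalg_def)
  then show ?thesis
  proof induction
    case (gen s)
    then obtain i j where ij: "i \<in> {1..4}" "j \<in> {1..4}" and s: "s = pmat q i j" by blast
    have "s = pscale q j \<odot>\<^bsub>A_Sp q\<^esub> Sp_cls q (ev q (minor (complex_of_real q) i (partner j)))"
      unfolding s pmat_cls[OF q0 ij] Sp_cls_smult by simp
    then show ?case
      using coinvariant_smult[OF ev_gen[OF q0] coinvariant_minor[OF ij(1) partner_range[OF ij(2)]]]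
        S7_closed(3)[OF ev_gen[OF q0] ev_gen[OF q0]] by simp
  next
    case one
    show ?case using coinvariant_one ev_gen[OF q0, of 1] by (simp add: Sp_cls_one)
  next
    case (add a b)
    then show ?case using coinvariant_add S7_closed(1) by simp
  next
    case (mult a b)
    then show ?case using coinvariant_mult S7_closed(2) by simp
  next
    case (smult a c)
    then show ?case using coinvariant_smult S7_closed(3)[of a q a] by simp
  qed
qed

text \<open>As \<open>partner\<close> is an involution and the scalars do not vanish, every minor is a multiple of an entry of \<open>p\<close>.\<close>

lemma minors_S4:
  assumes "b \<in> minors (complex_of_real q)"
  shows "Sp_cls q (ev q b) \<in> carrier (A_S4 q)"
proof -
  let ?G = "gen_subalg (A_S7 q) {pmat q i j | i j. i \<in> {1..4} \<and> j \<in> {1..4}}"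
  note sm = gen_subalg.smult[where A = "A_S7 q", unfolded A_S7_simps]
  from assms have "Sp_cls q (ev q b) \<in> ?G"
  proof induction
    case (const c)
    show ?case
      using sm[OF gen_subalg.one[where A = "A_S7 q"], where c = c] by (simp add: Sp_cls_one Sp_cls_smult)
  next
    case (minor i j)
    show ?case
    proof (cases "i \<in> {1..4} \<and> j \<in> {1..4}")
      case True
      have pp: "partner (partner j) = j" using True idx_cases[of j] by (auto simp: partner_def)
      have "pmat q i (partner j) \<in> ?G" using True partner_range by (intro gen_subalg.gen) blast
      from sm[OF this, where c = "inverse (pscale q (partner j))"] show ?thesis
        using True partner_range[of j]
        by (simp only: pmat_cls[OF q0] pp Sp_cls_smult ev_scal pm.scale_scale left_inverse[OF pscale_nonzero[OF q0]] pm.scale_one)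
    next
      case False
      then have "vT q (i, k) = 0 \<or> vT q (j, l) = 0" for k l by (auto simp: vT_def)
      then have "ev q (minor (complex_of_real q) i j) = 0"
        by (simp add: minor_def) (metis mult_eq_0_iff mult_zero_left mult_zero_right pm.scale_zero_right)
      then show ?thesis
        using sm[OF gen_subalg.one[where A = "A_S7 q"], where c = 0] by (simp add: Sp_cls_one Sp_cls_smult)
    qed
  next
    case (add x y)
    then show ?case
      using gen_subalg.add[where A = "A_S7 q", unfolded A_S7_simps] by (simp flip: Sp_cls_add[OF ev_keys ev_keys])
  next
    case (mult x y)
    then show ?case
      using gen_subalg.mult[where A = "A_S7 q", unfolded A_S7_simps] by (simp flip: Sp_cls_mult[OF ev_keys ev_keys])
  qed
  then show ?thesis by (simp add: A_S4_def subalg_def)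
qed

theorem carrier_S4_eq_coinvariants:
  "carrier (A_S4 q) = {f \<in> carrier (A_S7 q). \<delta> f = tensor (A_S7 q) (A_SU q) f \<one>\<^bsub>A_SU q\<^esub>}"
proof (intro equalityI subsetI)
  fix a assume "a \<in> carrier (A_S4 q)"
  then show "a \<in> {f \<in> carrier (A_S7 q). \<delta> f = tensor (A_S7 q) (A_SU q) f \<one>\<^bsub>A_SU q\<^esub>}"
    using S4_carrier_coinvariant unfolding tensor_pair_cls by blast
next
  fix a assume "a \<in> {f \<in> carrier (A_S7 q). \<delta> f = tensor (A_S7 q) (A_SU q) f \<one>\<^bsub>A_SU q\<^esub>}"
  then obtain f where f: "a = Sp_cls q (ev q f)" "\<delta> a = tensor (A_S7 q) (A_SU q) a \<one>\<^bsub>A_SU q\<^esub>"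
    unfolding S7_carrier[OF q0] by blast
  then show "a \<in> carrier (A_S4 q)"
    using coinvariant_in_minors[of f] minors_S4 by auto
qed

end

theorem proposition5:
  fixes q :: real
    and \<delta>\<^sub>R :: "sp_elem \<Rightarrow> (sp_elem \<times> su_elem \<Rightarrow>\<^sub>0 complex) set"
  assumes "q \<noteq> 0"
    and "is_right_coaction q \<delta>\<^sub>R"
  shows "carrier (A_S4 q) =
    {f \<in> carrier (A_S7 q). \<delta>\<^sub>R f = tensor (A_S7 q) (A_SU q) f \<one>\<^bsub>A_SU q\<^esub>}"
proof -
  interpret sphere_coaction q \<delta>\<^sub>R
    by (intro sphere_coaction.intro quantum_sphere.intro sphere_coaction_axioms.intro assms)
  show ?thesis by (rule carrier_S4_eq_coinvariants)
qed

end
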